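(* Let $m,n,p\ge 1$ be integers and let $\mathcal{B}=\{B_1,\ldots,B_p\}$ with each $B_j\in\mathbb{C}^{m\times n}$. Let $u=(u_1,\dots,u_n)$ be either a Gaussian sequence or a Rademacher sequence. Let $(C_1,C_2)=(\sqrt{2},2^{14})$ in the Gaussian case and $(C_1,C_2)=(4,1)$ in the Rademacher case. Let $L\in\mathbb{C}^{m\times p}$ be the matrix whose $j$-th column is $B_ju$, and let $M=L^*L$, $N=\mathbb{E}M$, $\kappa=\kappa(\mathcal{B})$ and $\lambda=\lambda(\mathcal{B})$. Suppose that $$n\ge p\,(C\kappa\lambda\log n)^2\quad\text{for some } C\ge 1 .$$ Then for every $t>0$, $$\mathbb{P}\left(\|M-N\|\ge \frac{t\|N\|}{\kappa}\right)\le 2C_2\,p\,n^{1-\alpha},\qquad \alpha=\frac{tC}{eC_1}.$$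
   Context: $\|\cdot\|$ is the spectral norm and $\|\cdot\|_F$ the Frobenius norm; $\langle A,B\rangle=\operatorname{tr}(A^*B)$ is the Frobenius inner product. A Gaussian sequence has i.i.d. real standard normal entries; a Rademacher sequence has i.i.d. entries equal to $\pm1$ with probability $1/2$ each. $\kappa(\mathcal{B})$ is the (spectral) condition number of the Gram matrix with entries $\langle B_j,B_k\rangle$, $1\le j,k\le p$ (infinite if this matrix is singular); this Gram matrix equals $N=\mathbb{E}M$. For a nonzero matrix $A$ with $n$ columns, the weak condition number is $\lambda(A)=\|A\|\,n^{1/2}/\|A\|_F$, and $\lambda(\mathcal{B})=\max_{A\in\mathcal{B}}\lambda(A)$. $\log$ is the natural logarithm and $e$ its base. *)

theory Defs
  imports "HOL-Probability.Probability"
begin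

text \<open>
  An $m \times n$ complex matrix is an element of \<^typ>\<open>complex^'n^'m\<close>; the index types are
  finite and nonempty, so the dimensions \<open>CARD('m)\<close>, \<open>CARD('n)\<close>, \<open>CARD('p)\<close> are arbitrary
  integers \<open>\<ge> 1\<close>.
\<close>

definition ctranspose :: "complex^'n^'m \<Rightarrow> complex^'m^'n" where
  "ctranspose A = (\<chi> i j. cnj (A $ j $ i))"

text \<open>The norm of \<^typ>\<open>complex^'n\<close> is Euclidean, so its operator norm is the spectral norm.\<close>

definition spectral_norm :: "complex^'n^'m \<Rightarrow> real" where
  "spectral_norm A = onorm (\<lambda>x. A *v x)"

definition frobenius_inner :: "complex^'n^'m \<Rightarrow> complex^'n^'m \<Rightarrow> complex" where
  "frobenius_inner A B = trace (ctranspose A ** B)"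

definition frobenius_norm :: "complex^'n^'m \<Rightarrow> real" where
  "frobenius_norm A = sqrt (\<Sum>i\<in>UNIV. \<Sum>j\<in>UNIV. (cmod (A $ i $ j))\<^sup>2)"

lemma frobenius_norm_eq_norm: "frobenius_norm A = norm A"
  by (simp add: frobenius_norm_def norm_vec_def L2_set_def sum_nonneg)

definition condition_number :: "complex^'p::finite^'p \<Rightarrow> ereal" where
  "condition_number G =
     (if invertible G then ereal (spectral_norm G * spectral_norm (matrix_inv G)) else \<infinity>)"

definition gram_matrix :: "('p::finite \<Rightarrow> complex^'n^'m) \<Rightarrow> complex^'p^'p" where
  "gram_matrix B = (\<chi> j k. frobenius_inner (B j) (B k))"

definition kappa :: "('p::finite \<Rightarrow> complex^'n^'m) \<Rightarrow> ereal" where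
  "kappa B = condition_number (gram_matrix B)"

text \<open>Meaningful for nonzero \<open>A\<close> only; division by zero gives the junk value \<open>0\<close> for \<open>A = 0\<close>.\<close>

definition weak_condition_number :: "complex^'n^'m \<Rightarrow> real" where
  "weak_condition_number A = spectral_norm A * sqrt (real CARD('n)) / frobenius_norm A"

definition weak_condition_number_family :: "('p::finite \<Rightarrow> complex^'n^'m) \<Rightarrow> real" where
  "weak_condition_number_family B = Max (weak_condition_number ` range B)"

definition (in prob_space) gaussian_sequence :: "('i \<Rightarrow> 'a \<Rightarrow> real) \<Rightarrow> bool" where
  "gaussian_sequence u \<longleftrightarrow>
     indep_vars (\<lambda>_. borel) u UNIV \<and>
     (\<forall>i. distributed M lborel (u i) std_normal_density)"

definition (in prob_space) rademacher_sequence :: "('i \<Rightarrow> 'a \<Rightarrow> real) \<Rightarrow> bool" where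
  "rademacher_sequence u \<longleftrightarrow>
     indep_vars (\<lambda>_. borel) u UNIV \<and>
     (\<forall>i. prob {\<omega> \<in> space M. u i \<omega> = 1} = 1 / 2 \<and>
          prob {\<omega> \<in> space M. u i \<omega> = - 1} = 1 / 2)"

definition column_matrix :: "('p::finite \<Rightarrow> complex^'n^'m) \<Rightarrow> ('n \<Rightarrow> real) \<Rightarrow> complex^'p^'m" where
  "column_matrix B x = (\<chi> i j. (B j *v (\<chi> k. complex_of_real (x k))) $ i)"

end

theory Submission
  imports Defs
begin

text \<open>
  Let \<open>R k\<close> be the matrix whose \<open>j\<close>-th column is column \<open>k\<close> of \<open>B j\<close>, so that
  \<open>L = (\<Sum>k. u k *\<^sub>R R k)\<close> and \<open>X = M - N\<close> is a quadratic matrix chaos. In the Gaussian case,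
  integration by parts in one factor of \<open>tr X ^ (2 * q)\<close>, and the inequality
  \<open>tr (Y X^r Y X^s) \<le> tr (Y^2 X^(r + s))\<close> for Hermitian \<open>X\<close>, \<open>Y\<close> with \<open>r + s\<close> even, bound the
  moment by \<open>2 * q - 1\<close> times that of \<open>tr X ^ (2 * q - 2)\<close> multiplied by squared norms of two linear
  series: \<open>L\<close> itself, and the matrices \<open>ctranspose L ** R k\<close> stacked on top of each other. The
  norms of linear series are controlled by the noncommutative Khintchine inequality, which follows
  from the same integration by parts applied to Hermitian dilations. Markov's inequality with \<open>q\<close>
  proportional to \<open>t * C * ln n\<close> concludes. For a Rademacher sequence \<open>s\<close>, the chaos is \<open>pi / 2\<close>
  times the conditional expectation of the Gaussian chaos at \<open>s k * \<bar>g k\<bar>\<close>, so Jensen's inequality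
  transfers the moment bounds; \<open>C\<^sub>1 = 4\<close> leaves room for the factor \<open>pi / 2\<close>. A surplus factor \<open>p\<close>
  is absorbed by \<open>n\<close>, as \<open>\<kappa> \<ge> 1\<close> and \<open>\<lambda> \<ge> 1\<close> give \<open>p \<le> 9 / 4 * n\<close> for \<open>n \<ge> 2\<close>.
\<close>

section \<open>Complex matrices as a real inner product space\<close>

text \<open>The hypothesis on \<open>n\<close> makes the two variances of \<open>L\<close> unequal.
  The sum of \<open>ctranspose (R k) ** R k\<close> is \<open>N\<close>, of norm \<nu>, while the
  sum of \<open>R k ** ctranspose (R k)\<close> is the sum of
  \<open>B j ** ctranspose (B j)\<close>, of norm at most \<nu> / l^2 with l = C \<kappa> ln n. The
  moment bound pairs a large variance with a small one, so the 2q-th moment of \<open>X\<close> has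
  size (q \<nu> / l)^(2q), whereas the threshold t \<nu> / \<kappa> equals x \<nu> / l with x = t C
  ln n: only q / x is left. The obstacle is that the weight produced by the integration by parts
  depends on the same randomness as the power of \<open>X\<close>; Young's inequality separates the
  two, and the resulting moment of \<open>X\<close> is absorbed into the left-hand side. No spectral
  theorem is used: traces of even powers are squared Frobenius norms, and eigenvalue arguments
  become log-convexity of sequences, that is, Cauchy-Schwarz. The moment bounds involve only
  expectations of polynomials, so a Gaussian sequence enters through its mixed moments, and the same
  bounds serve the given sequence and the signed Gaussians of the comparison.\<close>

lemma ctranspose_nth [simp]: "ctranspose A $ i $ j = cnj (A $ j $ i)"
  by (simp add: ctranspose_def)

lemma ctranspose_ctranspose [simp]: "ctranspose (ctranspose A) = A"
  by (simp add: vec_eq_iff)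

lemma ctranspose_mult:
  fixes A :: "complex^'n::finite^'m" and B :: "complex^'k^'n"
  shows "ctranspose (A ** B) = ctranspose B ** ctranspose A"
  by (simp add: vec_eq_iff matrix_matrix_mult_def mult.commute)

lemma ctranspose_mat_1 [simp]: "ctranspose (mat 1) = mat 1"
  by (simp add: vec_eq_iff mat_def)

lemma linear_ctranspose: "linear (ctranspose :: complex^'n::finite^'m::finite \<Rightarrow> _)"
  by (rule linearI) (simp_all add: vec_eq_iff)

lemma inner_ctranspose:
  fixes A B :: "complex^'n::finite^'m::finite"
  shows "inner (ctranspose A) (ctranspose B) = inner A B"
  unfolding inner_vec_def by (subst sum.swap) (simp add: inner_complex_def)

lemma norm_ctranspose:
  fixes A :: "complex^'n::finite^'m::finite"
  shows "norm (ctranspose A) = norm A"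
  by (simp add: norm_eq_sqrt_inner inner_ctranspose)

lemma inner_complex_cnj: "inner (a :: complex) b = Re (cnj a * b)"
  by (simp add: inner_complex_def)

text \<open>The real inner product of the type is Re tr (\<open>ctranspose A ** B\<close>), so left
  multiplication by a matrix has left multiplication by the conjugate transpose as its
  adjoint.\<close>

lemma inner_matrix_mult_left:
  fixes A :: "complex^'n::finite^'m::finite" and B :: "complex^'k::finite^'n" and C :: "complex^'k^'m"
  shows "inner (A ** B) C = inner B (ctranspose A ** C)"
proof -
  have "inner (A ** B) C = Re (\<Sum>i\<in>UNIV. \<Sum>j\<in>UNIV. \<Sum>k\<in>UNIV. cnj (A$i$k) * cnj (B$k$j) * C$i$j)"
    by (simp add: inner_vec_def inner_complex_cnj matrix_matrix_mult_def sum_distrib_right Re_sum del: times_complex.sel)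
  also have "(\<Sum>i\<in>UNIV. \<Sum>j\<in>UNIV. \<Sum>k\<in>UNIV. cnj (A$i$k) * cnj (B$k$j) * C$i$j)
     = (\<Sum>k\<in>UNIV. \<Sum>j\<in>UNIV. \<Sum>i\<in>UNIV. cnj (A$i$k) * cnj (B$k$j) * C$i$j)"
    by (subst sum.swap, subst (2) sum.swap, subst sum.swap) (rule refl)
  also have "Re \<dots> = inner B (ctranspose A ** C)"
    by (simp add: inner_vec_def inner_complex_cnj matrix_matrix_mult_def sum_distrib_left Re_sum mult_ac del: times_complex.sel)
  finally show ?thesis .
qed

lemma inner_matrix_mult_right:
  fixes A :: "complex^'n::finite^'m::finite" and B :: "complex^'k::finite^'n" and C :: "complex^'k^'m"
  shows "inner (A ** B) C = inner A (C ** ctranspose B)"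
proof -
  have "inner (A ** B) C = inner (ctranspose B ** ctranspose A) (ctranspose C)"
    by (simp only: ctranspose_mult[symmetric] inner_ctranspose)
  also have "\<dots> = inner (ctranspose A) (ctranspose (C ** ctranspose B))"
    by (simp only: inner_matrix_mult_left ctranspose_mult ctranspose_ctranspose)
  finally show ?thesis by (simp only: inner_ctranspose)
qed

lemma inner_matrix_vector_mult:
  fixes A :: "complex^'n::finite^'m::finite"
  shows "inner (A *v x) y = inner x (ctranspose A *v y)"
proof -
  have "inner (A *v x) y = Re (\<Sum>i\<in>UNIV. \<Sum>k\<in>UNIV. cnj (A$i$k) * cnj (x$k) * y$i)"
    by (simp add: inner_vec_def inner_complex_cnj matrix_vector_mult_def sum_distrib_right Re_sum del: times_complex.sel)
  also have "\<dots> = inner x (ctranspose A *v y)"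
    by (subst sum.swap)
       (simp add: inner_vec_def inner_complex_cnj matrix_vector_mult_def sum_distrib_left Re_sum mult_ac del: times_complex.sel)
  finally show ?thesis .
qed

lemma scaleR_matrix_mult:
  fixes A :: "complex^'n::finite^'m::finite" and B :: "complex^'k::finite^'n"
  shows "(c *\<^sub>R A) ** B = c *\<^sub>R (A ** B)" "A ** (c *\<^sub>R B) = c *\<^sub>R (A ** B)"
  by (simp_all add: vec_eq_iff matrix_matrix_mult_def scaleR_sum_right)

lemma matrix_add_rdistrib:
  fixes A B :: "complex^'n::finite^'m::finite" and C :: "complex^'k::finite^'n"
  shows "(A + B) ** C = A ** C + B ** C"
  by (simp add: vec_eq_iff matrix_matrix_mult_def sum.distrib distrib_right)

lemma bilinear_matrix_mult:
  "bilinear ((**) :: complex^'n::finite^'m::finite \<Rightarrow> complex^'k::finite^'n \<Rightarrow> _)"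
  unfolding bilinear_def
  by (intro conjI allI linearI) (simp_all only: matrix_add_ldistrib matrix_add_rdistrib scaleR_matrix_mult)

lemma sum_matrix_mult:
  fixes A :: "'i \<Rightarrow> complex^'n::finite^'m::finite" and B :: "complex^'k::finite^'n"
  shows "(\<Sum>i\<in>I. A i) ** B = (\<Sum>i\<in>I. A i ** B)" 
  by (rule linear_sum [where f = "\<lambda>X. X ** B"])
     (rule bilinear_matrix_mult[unfolded bilinear_def, THEN conjunct2, rule_format])

lemma matrix_mult_sum:
  fixes A :: "complex^'n::finite^'m::finite" and B :: "'i \<Rightarrow> complex^'k::finite^'n"
  shows "A ** (\<Sum>i\<in>I. B i) = (\<Sum>i\<in>I. A ** B i)" 
  by (rule linear_sum [where f = "\<lambda>X. A ** X"])
     (rule bilinear_matrix_mult[unfolded bilinear_def, THEN conjunct1, rule_format])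

lemma scaleR_matrix_vector_mult:
  fixes A :: "complex^'n::finite^'m::finite"
  shows "(c *\<^sub>R A) *v x = c *\<^sub>R (A *v x)" "A *v (c *\<^sub>R x) = c *\<^sub>R (A *v x)"
  by (simp_all add: vec_eq_iff matrix_vector_mult_def scaleR_sum_right)

lemma linear_matrix_vector_mult: "linear (\<lambda>x. (A :: complex^'n::finite^'m::finite) *v x)"
  by (rule linearI) (simp_all add: matrix_vector_right_distrib scaleR_matrix_vector_mult)

lemma linear_matrix_vector_mult_left: "linear (\<lambda>A :: complex^'n::finite^'m::finite. A *v x)"
  by (rule linearI) (simp_all add: matrix_vector_mult_add_rdistrib scaleR_matrix_vector_mult)

lemma sum_matrix_vector_mult:
  fixes A :: "'i \<Rightarrow> complex^'n::finite^'m::finite"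
  shows "(\<Sum>i\<in>I. A i) *v x = (\<Sum>i\<in>I. A i *v x)" 
  by (rule linear_sum [OF linear_matrix_vector_mult_left])

lemma norm_matrix_power2_columns:
  fixes A :: "complex^'n::finite^'m::finite"
  shows "(norm A)\<^sup>2 = (\<Sum>j\<in>UNIV. (norm (column j A))\<^sup>2)"
  by (simp add: power2_norm_eq_inner inner_vec_def column_def) (rule sum.swap)

lemma norm_vec_power2:
  fixes x :: "complex^'n::finite"
  shows "(norm x)\<^sup>2 = (\<Sum>j\<in>UNIV. (cmod (x $ j))\<^sup>2)"
  by (simp add: norm_vec_def L2_set_def sum_nonneg)

lemma norm_mat_1_power2: "(norm (mat 1 :: complex^'n::finite^'n))\<^sup>2 = real CARD('n)"
  unfolding norm_matrix_power2_columns norm_vec_power2 column_def mat_def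
  by (simp add: if_distrib[of cmod] if_distrib[of "\<lambda>x. x\<^sup>2"] cong: if_cong)

lemma column_matrix_mult: "column j (A ** B) = A *v column j B"
  by (simp add: vec_eq_iff column_def matrix_matrix_mult_def matrix_vector_mult_def)

lemma norm_matrix_vector_mult_le:
  fixes A :: "complex^'n::finite^'m::finite"
  shows "norm (A *v x) \<le> norm A * norm x"
proof -
  have row: "cmod ((A *v x) $ i) \<le> norm (A $ i) * norm x" for i
  proof -
    have "cmod ((A *v x) $ i) \<le> (\<Sum>j\<in>UNIV. \<bar>cmod (A $ i $ j)\<bar> * \<bar>cmod (x $ j)\<bar>)"
      unfolding matrix_vector_mult_def
      by (simp add: norm_mult[symmetric]) (rule norm_sum)
    also have "\<dots> \<le> norm (A $ i) * norm x"
      unfolding norm_vec_def by (rule L2_set_mult_ineq)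
    finally show ?thesis .
  qed
  have "norm (A *v x) \<le> L2_set (\<lambda>i. norm (A $ i) * norm x) UNIV"
    unfolding norm_vec_def[of "A *v x"] by (rule L2_set_mono) (use row in auto)
  also have "\<dots> = norm A * norm x"
    unfolding norm_vec_def[of A] by (simp add: L2_set_left_distrib)
  finally show ?thesis .
qed

lemma bounded_linear_matrix_vector_mult: "bounded_linear (\<lambda>x. (A :: complex^'n::finite^'m::finite) *v x)"
  using linear_matrix_vector_mult linear_conv_bounded_linear by blast

lemma spectral_norm_nonneg: "0 \<le> spectral_norm (A :: complex^'n::finite^'m::finite)"
  unfolding spectral_norm_def by (rule onorm_pos_le[OF bounded_linear_matrix_vector_mult])

lemma norm_le_spectral_norm:
  "norm ((A :: complex^'n::finite^'m::finite) *v x) \<le> spectral_norm A * norm x"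
  unfolding spectral_norm_def by (rule onorm[OF bounded_linear_matrix_vector_mult])

lemma spectral_norm_le:
  fixes A :: "complex^'n::finite^'m::finite"
  assumes "\<And>x. norm (A *v x) \<le> b * norm x" "b \<ge> 0"
  shows "spectral_norm A \<le> b"
  unfolding spectral_norm_def by (rule onorm_bound[OF assms(2,1)])

lemma norm_matrix_mult_le:
  fixes A :: "complex^'n::finite^'m::finite" and Z :: "complex^'k::finite^'n"
  shows "norm (A ** Z) \<le> spectral_norm A * norm Z"
proof (rule power2_le_imp_le)
  show "(norm (A ** Z))\<^sup>2 \<le> (spectral_norm A * norm Z)\<^sup>2"
    unfolding norm_matrix_power2_columns column_matrix_mult power_mult_distrib sum_distrib_left
    by (intro sum_mono) (metis norm_le_spectral_norm norm_ge_zero power_mono power_mult_distrib)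
qed (simp add: spectral_norm_nonneg)

text \<open>The assumption is the operator inequality \<Sum> \<open>ctranspose (A i) ** A i\<close>
  \<le> c I, written as a bound on vectors so that no positive semidefinite order is needed.
  Applying it to the columns of \<open>Z\<close> gives the Frobenius version. All variance bounds
  below have this form.\<close>

lemma sum_norm_matrix_mult_le:
  fixes A :: "'i \<Rightarrow> complex^'n::finite^'m::finite" and Z :: "complex^'k::finite^'n"
  assumes "\<And>x. (\<Sum>i\<in>I. (norm (A i *v x))\<^sup>2) \<le> c * (norm x)\<^sup>2"
  shows "(\<Sum>i\<in>I. (norm (A i ** Z))\<^sup>2) \<le> c * (norm Z)\<^sup>2"
  unfolding norm_matrix_power2_columns column_matrix_mult
  by (subst sum.swap) (auto simp: sum_distrib_left intro!: sum_mono assms)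

lemma spectral_norm_ctranspose_le:
  fixes A :: "complex^'n::finite^'m::finite"
  shows "spectral_norm (ctranspose A) \<le> spectral_norm A"
proof (rule spectral_norm_le)
  fix x
  have "(norm (ctranspose A *v x))\<^sup>2 = inner (A *v (ctranspose A *v x)) x"
    by (simp add: power2_norm_eq_inner inner_matrix_vector_mult)
  also have "\<dots> \<le> norm (A *v (ctranspose A *v x)) * norm x" by (rule norm_cauchy_schwarz)
  also have "\<dots> \<le> spectral_norm A * norm (ctranspose A *v x) * norm x"
    by (intro mult_right_mono norm_le_spectral_norm) auto
  finally show "norm (ctranspose A *v x) \<le> spectral_norm A * norm x"
    by (cases "norm (ctranspose A *v x) = 0") 
       (auto simp: power2_eq_square spectral_norm_nonneg mult_ac)
qed (rule spectral_norm_nonneg)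

section \<open>Powers of Hermitian matrices\<close>

text \<open>For Hermitian \<open>X\<close>, the trace of X^(2q) is written
  \<open>(norm (mpow X q))\<^sup>2\<close> throughout, which is visibly real and
  nonnegative.\<close>

fun mpow :: "complex^'n::finite^'n \<Rightarrow> nat \<Rightarrow> complex^'n^'n" where
  "mpow X 0 = mat 1"
| "mpow X (Suc k) = X ** mpow X k"

lemma mpow_add: "mpow X (a + b) = mpow X a ** mpow X b"
  by (induction a) (simp_all add: matrix_mul_assoc)

lemma mpow_Suc2: "mpow X (Suc k) = mpow X k ** X"
  using mpow_add[of X k 1] by simp

lemma ctranspose_mpow: "ctranspose X = X \<Longrightarrow> ctranspose (mpow X k) = mpow X k"
proof (induction k)
  case (Suc k)
  have "ctranspose (mpow X (Suc k)) = mpow X k ** X" using Suc by (simp add: ctranspose_mult)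
  thus ?case by (simp only: mpow_Suc2)
qed simp

lemma norm_mpow_power2:
  assumes "ctranspose X = X" "a + b = 2 * k"
  shows "(norm (mpow X k))\<^sup>2 = inner (mpow X a) (mpow X b)"
proof -
  have *: "inner (mpow X a) (mpow X b) = inner (mat 1) (mpow X (a + b))" for a b
    using inner_matrix_mult_left[of "mpow X a" "mat 1" "mpow X b"]
    by (simp add: ctranspose_mpow assms mpow_add)
  show ?thesis
    using assms(2) by (simp add: power2_norm_eq_inner *[of k k] *[of a b] mult_2)
qed

text \<open>A discretely convex sequence lies below its chord on {0..k}; denominators are cleared so
  that k = 0 needs no exception.\<close>

lemma convex_seq_chord:
  fixes c :: "nat \<Rightarrow> real"
  assumes "\<And>i. 0 < i \<Longrightarrow> i < k \<Longrightarrow> 2 * c i \<le> c (i - 1) + c (i + 1)" and "a \<le> k"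
  shows "k * c a \<le> (real k - a) * c 0 + a * c k"
  using assms
proof (induction k arbitrary: a)
  case (Suc k)
  have IH: "k * c a \<le> (real k - a) * c 0 + a * c k" if "a \<le> k" for a
    using Suc that by simp
  \<comment> \<open>The point at \<open>k\<close> lies below the chord from 0 to
    \<open>Suc k\<close>: insert the chord bound at \<open>k - 1\<close> into convexity at
    \<open>k\<close>. Substituting this into the shorter chord extends it by one.\<close>
  have ck: "(k + 1) * c k \<le> c 0 + k * c (Suc k)"
  proof (cases "k = 0")
    case False
    have "2 * c k \<le> c (k - 1) + c (k + 1)" using Suc.prems(1)[of k] False by simp
    moreover have "k * c (k - 1) \<le> (real k - (k - 1)) * c 0 + (k - 1) * c k"
      using IH[of "k - 1"] False by (simp add: of_nat_diff)
    ultimately have "k * (2 * c k) \<le> c 0 + (real k - 1) * c k + k * c (k + 1)"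
      using mult_left_mono[of "2 * c k" "c (k - 1) + c (k + 1)" "real k"] False
      by (simp add: algebra_simps of_nat_diff)
    thus ?thesis by (simp add: algebra_simps)
  qed simp
  show ?case
  proof (cases "a = Suc k")
    case False
    hence a: "a \<le> k" using Suc.prems by simp
    show ?thesis
    proof (cases "k = 0")
      case True thus ?thesis using a by simp
    next
      case False
      have "(k + 1) * (k * c a) \<le> (k + 1) * ((real k - a) * c 0 + a * c k)"
        using IH[OF a] by (intro mult_left_mono) auto
      also have "\<dots> = (k + 1) * (real k - a) * c 0 + a * ((k + 1) * c k)" by (simp add: algebra_simps)
      also have "\<dots> \<le> (k + 1) * (real k - a) * c 0 + a * (c 0 + k * c (Suc k))"
        using ck by (intro add_left_mono mult_left_mono) auto
      also have "\<dots> = k * ((real (Suc k) - a) * c 0 + a * c (Suc k))" by (simp add: algebra_simps)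
      finally have "k * (Suc k * c a) \<le> k * ((real (Suc k) - a) * c 0 + a * c (Suc k))"
        by (simp add: algebra_simps)
      thus ?thesis using False mult_le_cancel_left_pos[of "real k"] by (simp del: of_nat_Suc)
    qed
  qed simp
qed simp

lemma log_convex_imp_convex:
  fixes a b c :: real
  assumes "b\<^sup>2 \<le> a * c" "0 \<le> a" "0 \<le> c"
  shows "2 * b \<le> a + c"
proof (rule power2_le_imp_le)
  have "(2 * b)\<^sup>2 \<le> 4 * (a * c)" using assms by (simp add: power_mult_distrib)
  also have "\<dots> = (a + c)\<^sup>2 - (a - c)\<^sup>2" by (simp add: power2_eq_square algebra_simps)
  finally show "(2 * b)\<^sup>2 \<le> (a + c)\<^sup>2"
    using zero_le_power2[of "a - c"] by linarith
qed (use assms in auto)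

lemma log_convex_seq_chord:
  fixes c :: "nat \<Rightarrow> real"
  assumes "\<And>i. 0 < i \<Longrightarrow> i < k \<Longrightarrow> (c i)\<^sup>2 \<le> c (i - 1) * c (i + 1)" "\<And>i. 0 \<le> c i" "a \<le> k"
  shows "k * c a \<le> (real k - a) * c 0 + a * c k"
  using assms by (intro convex_seq_chord log_convex_imp_convex) auto

text \<open>The squared norm of \<open>mpow X a ** Y ** mpow X (k - a)\<close> is log-convex in
  \<open>a\<close> and symmetric under a \<mapsto> k - a, hence largest at the ends. An arbitrary
  word is the inner product of two such matrices, so Cauchy-Schwarz finishes.\<close>

lemma trace_word_le:
  fixes X Y :: "complex^'n::finite^'n"
  assumes X: "ctranspose X = X" and Y: "ctranspose Y = Y" and rs: "r + s = 2 * k"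
  shows "inner Y (mpow X r ** Y ** mpow X s) \<le> (norm (Y ** mpow X k))\<^sup>2"
proof -
  define e where "e a = (norm (mpow X a ** Y ** mpow X (k - a)))\<^sup>2" for a
  have sh: "inner (mpow X a ** Y ** mpow X c) (mpow X a' ** Y ** mpow X c')
    = inner Y (mpow X (a + a') ** Y ** mpow X (c' + c))" for a c a' c'
  proof -
    have "inner (mpow X a ** Y ** mpow X c) (mpow X a' ** Y ** mpow X c')
      = inner (mpow X a ** Y) (mpow X a' ** Y ** mpow X c' ** mpow X c)"
      by (subst inner_matrix_mult_right) (simp add: ctranspose_mpow X)
    also have "\<dots> = inner Y (mpow X a ** (mpow X a' ** Y ** mpow X c' ** mpow X c))"
      by (subst inner_matrix_mult_left) (simp add: ctranspose_mpow X)
    finally show ?thesis by (simp add: mpow_add matrix_mul_assoc)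
  qed
  \<comment> \<open>Conjugate transposition exchanges the two ends of the sequence.\<close>
  have ek: "e k = e 0"
  proof -
    have "e k = (norm (ctranspose (mpow X k ** Y)))\<^sup>2" by (simp only: norm_ctranspose) (simp add: e_def)
    also have "\<dots> = e 0" by (simp add: ctranspose_mult ctranspose_mpow X Y e_def)
    finally show ?thesis .
  qed
  have CS: "(inner (mpow X a ** Y ** mpow X (k - a)) (mpow X a' ** Y ** mpow X (k - a')))\<^sup>2 \<le> e a * e a'" for a a'
    unfolding e_def power_mult_distrib[symmetric]
    using Cauchy_Schwarz_ineq2[of "mpow X a ** Y ** mpow X (k - a)" "mpow X a' ** Y ** mpow X (k - a')"]
    by (metis abs_ge_zero power2_abs power_mono)
  have e0: "e a \<le> e 0" if "a \<le> k" for a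
  proof (cases "k = 0")
    case False
    have "k * e a \<le> (real k - a) * e 0 + a * e k"
    proof (rule log_convex_seq_chord)
      fix i assume i: "0 < i" "i < k"
      have "e i = inner (mpow X (i - 1) ** Y ** mpow X (k - (i - 1))) (mpow X (i + 1) ** Y ** mpow X (k - (i + 1)))"
        using i unfolding e_def power2_norm_eq_inner sh by (intro arg_cong2[where f = inner] arg_cong2[where f = "(**)"] arg_cong2[where f = mpow]) auto
      thus "(e i)\<^sup>2 \<le> e (i - 1) * e (i + 1)" by (simp only: CS)
    qed (use that in \<open>auto simp: e_def\<close>)
    hence "k * e a \<le> k * e 0" by (simp add: ek algebra_simps)
    thus ?thesis using False by simp
  qed (use that in simp)
  \<comment> \<open>Any splitting of \<open>r\<close> into two parts of size at most
    \<open>k\<close> would do; halving achieves this because r \<le> 2 k, also for odd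
    \<open>r\<close>.\<close>
  define a where "a = r div 2"
  define a' where "a' = r - a"
  have a: "a \<le> k" "a' \<le> k" "r = a + a'" "s = (k - a') + (k - a)" using rs by (auto simp: a_def a'_def)
  have "(inner Y (mpow X r ** Y ** mpow X s))\<^sup>2 \<le> e a * e a'"
    using CS[of a a'] unfolding sh a(3)[symmetric] a(4)[symmetric] .
  also have "\<dots> \<le> e 0 * e 0" using e0 a by (intro mult_mono) (auto simp: e_def)
  finally have "(inner Y (mpow X r ** Y ** mpow X s))\<^sup>2 \<le> (e 0)\<^sup>2" by (simp add: power2_eq_square)
  hence "inner Y (mpow X r ** Y ** mpow X s) \<le> e 0" by (rule power2_le_imp_le) (simp add: e_def)
  thus ?thesis by (simp add: e_def)
qed

text \<open>The sequence |X^k v| is log-convex by Cauchy-Schwarz and starts at 1, so its successive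
  ratios never fall below the first one, |X v|.\<close>

lemma norm_mpow_vector_ge:
  fixes X :: "complex^'n::finite^'n"
  assumes X: "ctranspose X = X" and v: "norm v = 1"
  shows "norm (X *v v) ^ q \<le> norm (mpow X q *v v)"
proof -
  define d where "d k = norm (mpow X k *v v)" for k
  have d: "(d (Suc k))\<^sup>2 \<le> d k * d (Suc (Suc k))" for k
  proof -
    have "(d (Suc k))\<^sup>2 = inner (X *v (mpow X k *v v)) (mpow X (Suc k) *v v)"
      by (simp add: d_def power2_norm_eq_inner matrix_vector_mul_assoc)
    also have "\<dots> = inner (mpow X k *v v) (mpow X (Suc (Suc k)) *v v)"
      by (simp only: inner_matrix_vector_mult[of X] X) (simp add: matrix_vector_mul_assoc)
    also have "\<dots> \<le> d k * d (Suc (Suc k))" unfolding d_def by (rule norm_cauchy_schwarz)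
    finally show ?thesis .
  qed
  have d0: "d k \<ge> 0" for k by (simp add: d_def)
  have step: "d 1 * d k \<le> d (Suc k)" for k
  proof (induction k)
    case 0 show ?case using v by (simp add: d_def)
  next
    case (Suc k)
    show ?case
    proof (cases "d (Suc k) = 0")
      case False
      have "d 1 * d (Suc k) * d (Suc k) \<le> d 1 * (d k * d (Suc (Suc k)))"
        using mult_left_mono[OF d[of k] d0[of 1]] by (simp add: power2_eq_square mult_ac)
      also have "\<dots> \<le> d (Suc k) * d (Suc (Suc k))"
        using mult_right_mono[OF Suc d0[of "Suc (Suc k)"]] by (simp add: mult_ac)
      finally have "d (Suc k) * (d 1 * d (Suc k)) \<le> d (Suc k) * d (Suc (Suc k))"
        by (simp add: mult_ac)
      thus ?thesis using False d0[of "Suc k"] by (metis less_eq_real_def mult_le_cancel_left_pos)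
    qed (use d0 in auto)
  qed
  have "d 1 ^ q \<le> d q"
  proof (induction q)
    case 0 show ?case using v by (simp add: d_def)
  next
    case (Suc q)
    show ?case using mult_left_mono[OF Suc d0[of 1]] step[of q] by simp
  qed
  thus ?thesis by (simp add: d_def)
qed

text \<open>Passing to the k-th root of \<open>D\<close> makes the bound homogeneous, so the
  supremum need not be attained.\<close>

lemma spectral_norm_power_le:
  fixes A :: "complex^'n::finite^'m::finite"
  assumes "\<And>v. norm v = 1 \<Longrightarrow> norm (A *v v) ^ k \<le> D" and "k > 0"
  shows "spectral_norm A ^ k \<le> D"
proof -
  \<comment> \<open>A unit vector exists, which forces D \<ge> 0 and makes the root
    meaningful.\<close>
  have "norm (axis undefined 1 :: complex^'n) = 1" by simp
  from assms(1)[OF this] have D: "D \<ge> 0" using order_trans[OF zero_le_power[OF norm_ge_zero]] by blast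
  define b where "b = root k D"
  have b: "b \<ge> 0" "b ^ k = D" using D assms(2) by (simp_all add: b_def)
  have "spectral_norm A \<le> b"
  proof (rule spectral_norm_le)
    fix x show "norm (A *v x) \<le> b * norm x"
    proof (cases "x = 0")
      case False
      define v where "v = (1 / norm x) *\<^sub>R x"
      have v: "norm v = 1" "x = norm x *\<^sub>R v" using False by (simp_all add: v_def)
      have "norm (A *v v) ^ k \<le> b ^ k" using assms(1)[OF v(1)] b by simp
      hence "norm (A *v v) \<le> b" using b assms(2) by (metis power_mono_iff norm_ge_zero)
      hence "norm x * norm (A *v v) \<le> b * norm x" by (simp add: mult_left_mono mult.commute[of b])
      moreover have "norm (A *v x) = norm x * norm (A *v v)"
        by (subst v(2), subst scaleR_matrix_vector_mult) simp
      ultimately show ?thesis by simp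
    qed simp
  qed (rule b)
  thus ?thesis using power_mono[OF _ spectral_norm_nonneg, of A b k] b by simp
qed

lemma norm_vector_power_le_mpow:
  fixes X :: "complex^'n::finite^'n"
  assumes X: "ctranspose X = X" and v: "norm v = 1"
  shows "norm (X *v v) ^ (2 * q) \<le> (norm (mpow X q))\<^sup>2"
proof -
  have "norm (X *v v) ^ q \<le> norm (mpow X q)"
    using norm_mpow_vector_ge[OF X v, of q] norm_matrix_vector_mult_le[of "mpow X q" v] v by simp
  hence "(norm (X *v v) ^ q)\<^sup>2 \<le> (norm (mpow X q))\<^sup>2" by (rule power_mono) simp
  thus ?thesis by (simp add: power_mult[symmetric] mult.commute)
qed

text \<open>The classical domination of the largest eigenvalue by the trace of an even power,
  obtained from the growth of |X^k v| instead of from eigenvalues.\<close>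

lemma spectral_norm_power_le_mpow:
  fixes X :: "complex^'n::finite^'n"
  assumes "ctranspose X = X" "q > 0"
  shows "spectral_norm X ^ (2 * q) \<le> (norm (mpow X q))\<^sup>2"
  using assms by (intro spectral_norm_power_le norm_vector_power_le_mpow) auto

section \<open>Gaussian integration by parts\<close>

definition normal_moment :: "nat \<Rightarrow> real" where
  "normal_moment a = (LINT x|lborel. std_normal_density x * x ^ a)"

lemma normal_moment_0 [simp]: "normal_moment 0 = 1"
  using integral_std_normal_moment_even[of 0] by (simp add: normal_moment_def)

lemma normal_moment_odd: "odd a \<Longrightarrow> normal_moment a = 0"
  unfolding normal_moment_def
  by (elim oddE) (use integral_std_normal_moment_odd in simp)

text \<open>Integration by parts in one variable, for monomials. At a = 0 the truncated
  \<open>a - 1\<close> is harmless because the factor \<open>a\<close> vanishes.\<close>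

lemma normal_moment_Suc: "normal_moment (Suc a) = a * normal_moment (a - 1)"
proof (cases "even a")
  case True
  thus ?thesis by (cases "a = 0") (auto simp: normal_moment_odd)
next
  case False
  then obtain k where k: "a = 2 * k + 1" by (elim oddE)
  have "normal_moment (Suc a) = normal_moment (2 * Suc k)" by (simp add: k)
  also have "\<dots> = fact (2 * Suc k) / (2 ^ Suc k * fact (Suc k))"
    unfolding normal_moment_def by (rule integral_std_normal_moment_even)
  also have "\<dots> = ((2 * (1 + real k)) * (a * fact (2 * k))) / ((2 * (1 + real k)) * (2 ^ k * fact k))"
    by (simp add: k algebra_simps)
  also have "\<dots> = a * (fact (2 * k) / (2 ^ k * fact k))"
    by (subst mult_divide_mult_cancel_left) simp_all
  also have "fact (2 * k) / (2 ^ k * fact k) = normal_moment (2 * k)"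
    unfolding normal_moment_def by (rule integral_std_normal_moment_even[symmetric])
  finally show ?thesis by (simp add: k)
qed

text \<open>The polynomial maps in the coordinates of a real vector; \<open>polymap_deriv i f f'\<close> says that
  \<open>f'\<close> is the partial derivative of \<open>f\<close> in direction \<open>i\<close>, computed formally.\<close>

inductive polymap :: "(('n \<Rightarrow> real) \<Rightarrow> 'v::real_vector) \<Rightarrow> bool" where
  polymap_const: "polymap (\<lambda>x. c)"
| polymap_var: "polymap f \<Longrightarrow> polymap (\<lambda>x. x j *\<^sub>R f x)"
| polymap_add: "polymap f \<Longrightarrow> polymap g \<Longrightarrow> polymap (\<lambda>x. f x + g x)"

inductive polymap_deriv ::
    "'n \<Rightarrow> (('n \<Rightarrow> real) \<Rightarrow> 'v::real_vector) \<Rightarrow> (('n \<Rightarrow> real) \<Rightarrow> 'v) \<Rightarrow> bool" for i where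
  deriv_const: "polymap_deriv i (\<lambda>x. c) (\<lambda>x. 0)"
| deriv_var: "polymap_deriv i f f' \<Longrightarrow>
    polymap_deriv i (\<lambda>x. x j *\<^sub>R f x) (\<lambda>x. (if i = j then f x else 0) + x j *\<^sub>R f' x)"
| deriv_add: "polymap_deriv i f f' \<Longrightarrow> polymap_deriv i g g' \<Longrightarrow>
    polymap_deriv i (\<lambda>x. f x + g x) (\<lambda>x. f' x + g' x)"

section \<open>Formal calculus of polynomial maps\<close>

lemma polymap_deriv_cong:
  "polymap_deriv i f f' \<Longrightarrow> (\<And>x. f x = g x) \<Longrightarrow> (\<And>x. f' x = g' x) \<Longrightarrow> polymap_deriv i g g'"
  by (metis ext)

lemma polymap_linear:
  assumes "linear h" "polymap f" shows "polymap (\<lambda>x. h (f x))"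
  using assms(2)
  by induction (simp_all add: linear_add[OF assms(1)] linear_scale[OF assms(1)] polymap.intros)

lemma polymap_bilinear:
  assumes "bilinear h" "polymap f" "polymap g" shows "polymap (\<lambda>x. h (f x) (g x))"
  using assms(2)
proof induction
  case (polymap_const c)
  show ?case using assms(1,3) by (intro polymap_linear[of "h c"]) (auto simp: bilinear_def)
qed (simp_all add: bilinear_ladd[OF assms(1)] bilinear_lmul[OF assms(1)] polymap.intros)

lemma polymap_sum:
  assumes "\<And>j. j \<in> I \<Longrightarrow> polymap (f j)"
  shows "polymap (\<lambda>x. \<Sum>j\<in>I. f j x)"
  using assms by (induction I rule: infinite_finite_induct) (simp_all add: polymap.intros)

lemma polymap_coord: "polymap (\<lambda>x. x j)"
  using polymap_var[OF polymap_const[of "1::real"], of j] by simp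

lemma deriv_linear:
  assumes "linear h" "polymap_deriv i f f'" shows "polymap_deriv i (\<lambda>x. h (f x)) (\<lambda>x. h (f' x))"
  using assms(2)
proof induction
  case (deriv_const c)
  thus ?case using polymap_deriv.deriv_const[of i "h c"] by (simp add: linear_0[OF assms(1)])
next
  case (deriv_var f f' j)
  show ?case
    by (rule polymap_deriv_cong[OF polymap_deriv.deriv_var[OF deriv_var.IH, of j]])
       (simp_all add: linear_add[OF assms(1)] linear_scale[OF assms(1)] linear_0[OF assms(1)])
next
  case (deriv_add f f' g g')
  show ?case
    by (rule polymap_deriv_cong[OF polymap_deriv.deriv_add[OF deriv_add.IH]])
       (simp_all add: linear_add[OF assms(1)])
qed

text \<open>The Leibniz rule for an arbitrary bilinear map covers matrix products and inner products
  at once. The induction runs over the first factor; for a constant first factor the map is linear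
  in the second.\<close>

lemma deriv_bilinear:
  assumes "bilinear h" "polymap_deriv i f f'" "polymap_deriv i g g'"
  shows "polymap_deriv i (\<lambda>x. h (f x) (g x)) (\<lambda>x. h (f' x) (g x) + h (f x) (g' x))"
  using assms(2)
proof induction
  case (deriv_const c)
  have "polymap_deriv i (\<lambda>x. h c (g x)) (\<lambda>x. h c (g' x))"
    using assms(1,3) by (intro deriv_linear[of "h c"]) (auto simp: bilinear_def)
  thus ?case by (simp add: bilinear_lzero[OF assms(1)])
next
  case (deriv_var f f' j)
  show ?case
    by (rule polymap_deriv_cong[OF polymap_deriv.deriv_var[OF deriv_var.IH, of j]])
       (simp_all add: bilinear_ladd[OF assms(1)] bilinear_lmul[OF assms(1)] bilinear_lzero[OF assms(1)] 
          scaleR_add_right)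
next
  case (deriv_add f f' f2 f2')
  show ?case
    by (rule polymap_deriv_cong[OF polymap_deriv.deriv_add[OF deriv_add.IH]])
       (simp_all add: bilinear_ladd[OF assms(1)])
qed

lemma deriv_sum:
  assumes "\<And>j. j \<in> I \<Longrightarrow> polymap_deriv i (f j) (f' j)"
  shows "polymap_deriv i (\<lambda>x. \<Sum>j\<in>I. f j x) (\<lambda>x. \<Sum>j\<in>I. f' j x)"
  using assms by (induction I rule: infinite_finite_induct) (simp_all add: polymap_deriv.intros)

definition series :: "('n::finite \<Rightarrow> 'v::real_vector) \<Rightarrow> ('n \<Rightarrow> real) \<Rightarrow> 'v" where
  "series A x = (\<Sum>k\<in>UNIV. x k *\<^sub>R A k)"

lemma linear_series: "linear h \<Longrightarrow> h (series A x) = series (\<lambda>k. h (A k)) x"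
  by (simp add: series_def linear_sum linear_scale)

lemma polymap_series: "polymap (series A)"
  unfolding series_def[abs_def] by (intro polymap_sum polymap_var polymap_const)

lemma deriv_series: "polymap_deriv i (series A) (\<lambda>x. A i)"
proof -
  have "polymap_deriv i (\<lambda>x. \<Sum>j\<in>UNIV. x j *\<^sub>R A j) (\<lambda>x. \<Sum>j\<in>UNIV. (if i = j then A j else 0) + x j *\<^sub>R 0)"
    by (intro deriv_sum deriv_var deriv_const)
  thus ?thesis by (simp add: series_def[abs_def])
qed

lemma polymap_deriv_imp_polymap:
  assumes "polymap_deriv i f f'" shows "polymap f" "polymap f'"
proof -
  have "polymap f \<and> polymap f'" using assms
  proof induction
    case (deriv_var f f' j)
    have "polymap (\<lambda>x. if i = j then f x else 0)" using deriv_var by (cases "i = j") (simp_all add: polymap.intros)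
    thus ?case using deriv_var by (simp add: polymap.intros)
  qed (simp_all add: polymap.intros)
  thus "polymap f" "polymap f'" by auto
qed

lemma polymap_mpow:
  assumes "polymap X" shows "polymap (\<lambda>x. mpow (X x) q)"
  by (induction q) (simp_all add: polymap.intros polymap_bilinear[OF bilinear_matrix_mult assms])

text \<open>\<open>X\<close> need not commute with its derivative, so each position of the
  differentiated factor contributes its own word.\<close>

lemma deriv_mpow:
  assumes "polymap_deriv i X Y"
  shows "polymap_deriv i (\<lambda>x. mpow (X x) q)
     (\<lambda>x. \<Sum>r<q. mpow (X x) r ** Y x ** mpow (X x) (q - 1 - r))"
proof (induction q)
  case 0 show ?case by (simp add: deriv_const)
next
  case (Suc q)
  have "Y x ** mpow (X x) q + X x ** (\<Sum>r<q. mpow (X x) r ** Y x ** mpow (X x) (q - 1 - r))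
      = (\<Sum>r<Suc q. mpow (X x) r ** Y x ** mpow (X x) (Suc q - 1 - r))" for x
    by (simp add: sum.lessThan_Suc_shift matrix_mult_sum matrix_mul_assoc del: sum.lessThan_Suc)
  thus ?case
    by (intro polymap_deriv_cong[OF deriv_bilinear[OF bilinear_matrix_mult assms Suc]]) simp_all
qed

section \<open>Mixed moments and Gaussian integration by parts\<close>

definition monomial :: "('n::finite \<Rightarrow> nat) \<Rightarrow> ('n \<Rightarrow> real) \<Rightarrow> real" where
  "monomial a x = (\<Prod>k\<in>UNIV. x k ^ a k)"

lemma monomial_0 [simp]: "monomial (\<lambda>k. 0) x = 1"
  by (simp add: monomial_def)

lemma monomial_Suc: "monomial (a(j := Suc (a j))) x = x j * monomial a x"
proof -
  have "monomial (a(j := Suc (a j))) x = x j ^ Suc (a j) * (\<Prod>k\<in>UNIV - {j}. x k ^ a k)"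
    unfolding monomial_def by (subst prod.remove[of _ j]) (auto intro!: prod.cong)
  also have "\<dots> = x j * monomial a x" 
    unfolding monomial_def by (subst prod.remove[of _ j]) (auto simp: mult_ac)
  finally show ?thesis .
qed

text \<open>Exactly what makes all polynomial expectations finite. It is shared by Gaussian
  sequences, Rademacher sequences and the products of signs with absolute values of
  Gaussians.\<close>

locale poly_moments = prob_space M for M :: "'w measure" +
  fixes u :: "'n::finite \<Rightarrow> 'w \<Rightarrow> real"
  assumes integrable_monomial: "integrable M (\<lambda>\<omega>. monomial a (\<lambda>k. u k \<omega>))"
begin

abbreviation uvec :: "'w \<Rightarrow> 'n \<Rightarrow> real" where "uvec \<omega> \<equiv> \<lambda>k. u k \<omega>"

lemma integrable_polymap_monomial:
  fixes f :: "('n \<Rightarrow> real) \<Rightarrow> 'v::euclidean_space"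
  assumes "polymap f"
  shows "integrable M (\<lambda>\<omega>. monomial a (uvec \<omega>) *\<^sub>R f (uvec \<omega>))"
  using assms
proof (induction arbitrary: a)
  case (polymap_const c)
  thus ?case using integrable_monomial by simp
next
  case (polymap_var f j)
  show ?case using polymap_var.IH[of "a(j := Suc (a j))"] unfolding monomial_Suc
    by (simp add: mult.commute)
next
  case (polymap_add f g)
  thus ?case by (simp add: scaleR_add_right)
qed

lemma integrable_polymap:
  fixes f :: "('n \<Rightarrow> real) \<Rightarrow> 'v::euclidean_space"
  assumes "polymap f"
  shows "integrable M (\<lambda>\<omega>. f (uvec \<omega>))"
  using integrable_polymap_monomial[OF assms, of "\<lambda>_. 0"] by simp

end

text \<open>The mixed moments replace the joint law, so the results apply both to the given Gaussian
  sequence and to \<open>\<lambda>k \<omega>. s k * \<omega> k\<close> on an auxiliary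
  space.\<close>

locale gaussian_moments = poly_moments M u for M :: "'w measure" and u :: "'n::finite \<Rightarrow> 'w \<Rightarrow> real" +
  assumes expectation_monomial: "(LINT \<omega>|M. monomial a (\<lambda>k. u k \<omega>)) = (\<Prod>k\<in>UNIV. normal_moment (a k))"
begin

lemma expectation_monomial_Suc:
  "(LINT \<omega>|M. u i \<omega> * monomial a (uvec \<omega>)) = a i * (LINT \<omega>|M. monomial (a(i := a i - 1)) (uvec \<omega>))"
proof -
  have "(LINT \<omega>|M. u i \<omega> * monomial a (uvec \<omega>)) = (LINT \<omega>|M. monomial (a(i := Suc (a i))) (uvec \<omega>))"
    by (simp only: monomial_Suc)
  also have "\<dots> = normal_moment (Suc (a i)) * (\<Prod>k\<in>UNIV - {i}. normal_moment (a k))"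
    unfolding expectation_monomial by (subst prod.remove[of _ i]) (auto intro!: prod.cong)
  also have "\<dots> = a i * (normal_moment (a i - 1) * (\<Prod>k\<in>UNIV - {i}. normal_moment (a k)))"
    by (simp add: normal_moment_Suc)
  also have "normal_moment (a i - 1) * (\<Prod>k\<in>UNIV - {i}. normal_moment (a k))
      = (LINT \<omega>|M. monomial (a(i := a i - 1)) (uvec \<omega>))"
    unfolding expectation_monomial by (subst (2) prod.remove[of _ i]) (auto intro!: prod.cong)
  finally show ?thesis .
qed

text \<open>The monomial weight strengthens integration by parts to a statement that can be proved
  by induction: a variable multiplying \<open>f\<close> is moved into the weight.\<close>

lemma gaussian_ibp_monomial:
  fixes f f' :: "('n \<Rightarrow> real) \<Rightarrow> 'v::euclidean_space"
  assumes "polymap_deriv i f f'"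
  shows "(LINT \<omega>|M. (u i \<omega> * monomial a (uvec \<omega>)) *\<^sub>R f (uvec \<omega>))
       = a i *\<^sub>R (LINT \<omega>|M. monomial (a(i := a i - 1)) (uvec \<omega>) *\<^sub>R f (uvec \<omega>))
         + (LINT \<omega>|M. monomial a (uvec \<omega>) *\<^sub>R f' (uvec \<omega>))"
  using assms
proof (induction arbitrary: a)
  case (deriv_const c)
  define b where "b = a(i := a i - 1)"
  have "integrable M (\<lambda>\<omega>. u i \<omega> * monomial a (uvec \<omega>))"
    using integrable_monomial[of "a(i := Suc (a i))"] by (simp only: monomial_Suc)
  thus ?case using expectation_monomial_Suc[of i a] integrable_monomial[of b]
    unfolding b_def[symmetric] by simp
next
  case (deriv_var f f' j)
  note pm = polymap_deriv_imp_polymap[OF deriv_var.hyps]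
  let ?b = "a(j := Suc (a j))"
  have "(LINT \<omega>|M. (u i \<omega> * monomial a (uvec \<omega>)) *\<^sub>R (u j \<omega> *\<^sub>R f (uvec \<omega>)))
      = (LINT \<omega>|M. (u i \<omega> * monomial ?b (uvec \<omega>)) *\<^sub>R f (uvec \<omega>))"
    by (simp add: monomial_Suc mult_ac)
  also have "\<dots> = ?b i *\<^sub>R (LINT \<omega>|M. monomial (?b(i := ?b i - 1)) (uvec \<omega>) *\<^sub>R f (uvec \<omega>))
         + (LINT \<omega>|M. monomial ?b (uvec \<omega>) *\<^sub>R f' (uvec \<omega>))"
    by (rule deriv_var.IH)
  \<comment> \<open>If i = j, the exponent \<open>Suc (a i)\<close> contributes \<open>a i\<close>
    copies from the old weight and one more, which is the derivative of the explicit
    variable.\<close>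
  also have "?b i *\<^sub>R (LINT \<omega>|M. monomial (?b(i := ?b i - 1)) (uvec \<omega>) *\<^sub>R f (uvec \<omega>))
     = a i *\<^sub>R (LINT \<omega>|M. monomial (a(i := a i - 1)) (uvec \<omega>) *\<^sub>R (u j \<omega> *\<^sub>R f (uvec \<omega>)))
       + (LINT \<omega>|M. monomial a (uvec \<omega>) *\<^sub>R (if i = j then f (uvec \<omega>) else 0))"
  proof (cases "i = j")
    case False
    have eq: "?b(i := ?b i - 1) = (a(i := a i - 1))(j := Suc ((a(i := a i - 1)) j))"
      using False by (auto simp: fun_eq_iff)
    have "monomial (?b(i := ?b i - 1)) x = x j * monomial (a(i := a i - 1)) x" for x
      unfolding eq monomial_Suc ..
    thus ?thesis using False by (simp add: mult.commute)
  next
    case True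
    \<comment> \<open>The condition keeps the subtraction from being truncated; for
      \<open>a j = 0\<close> the scalar in front vanishes instead.\<close>
    have *: "monomial (a(j := a j - 1)) (uvec \<omega>) * u j \<omega> = monomial a (uvec \<omega>)" if "a j \<noteq> 0" for \<omega>
      using that monomial_Suc[of "a(j := a j - 1)" j "uvec \<omega>"] by (simp add: mult.commute)
    have "a i *\<^sub>R (LINT \<omega>|M. monomial (a(i := a i - 1)) (uvec \<omega>) *\<^sub>R (u j \<omega> *\<^sub>R f (uvec \<omega>)))
      = a i *\<^sub>R (LINT \<omega>|M. monomial a (uvec \<omega>) *\<^sub>R f (uvec \<omega>))"
    proof (cases "a j = 0")
      case False
      show ?thesis unfolding True scaleR_scaleR *[OF False] ..
    qed (simp add: True)
    thus ?thesis using True by (auto simp: algebra_simps)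
  qed
  also have "(LINT \<omega>|M. monomial ?b (uvec \<omega>) *\<^sub>R f' (uvec \<omega>)) = (LINT \<omega>|M. monomial a (uvec \<omega>) *\<^sub>R (u j \<omega> *\<^sub>R f' (uvec \<omega>)))"
    by (simp add: monomial_Suc mult.commute)
  also have "a i *\<^sub>R (LINT \<omega>|M. monomial (a(i := a i - 1)) (uvec \<omega>) *\<^sub>R (u j \<omega> *\<^sub>R f (uvec \<omega>)))
       + (LINT \<omega>|M. monomial a (uvec \<omega>) *\<^sub>R (if i = j then f (uvec \<omega>) else 0)) + \<dots>
     = a i *\<^sub>R (LINT \<omega>|M. monomial (a(i := a i - 1)) (uvec \<omega>) *\<^sub>R (u j \<omega> *\<^sub>R f (uvec \<omega>)))
       + (LINT \<omega>|M. monomial a (uvec \<omega>) *\<^sub>R ((if i = j then f (uvec \<omega>) else 0) + u j \<omega> *\<^sub>R f' (uvec \<omega>)))"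
    unfolding add.assoc scaleR_add_right
    by (subst Bochner_Integration.integral_add)
       (use integrable_polymap_monomial[OF pm(1)] integrable_polymap_monomial[OF polymap_var[OF pm(2)]]
        in \<open>cases "i = j"; simp\<close>)+
  finally show ?case .
next
  case (deriv_add f f' g g')
  note pm = polymap_deriv_imp_polymap[OF deriv_add.hyps(1)] polymap_deriv_imp_polymap[OF deriv_add.hyps(2)]
  have 1: "integrable M (\<lambda>\<omega>. (u i \<omega> * monomial a (uvec \<omega>)) *\<^sub>R f (uvec \<omega>))" if "polymap f" for f :: "('n \<Rightarrow> real) \<Rightarrow> 'v"
    using integrable_polymap_monomial[OF that, of "a(i := Suc (a i))"] by (simp add: monomial_Suc)
  show ?case
    by (simp add: scaleR_add_right 1 pm integrable_polymap_monomial deriv_add.IH algebra_simps)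
qed

theorem gaussian_ibp:
  fixes f f' :: "('n \<Rightarrow> real) \<Rightarrow> 'v::euclidean_space"
  assumes "polymap_deriv i f f'"
  shows "(LINT \<omega>|M. u i \<omega> *\<^sub>R f (uvec \<omega>)) = (LINT \<omega>|M. f' (uvec \<omega>))"
  using gaussian_ibp_monomial[OF assms, of "\<lambda>_. 0"] by simp

end

lemma std_normal_distributed_moment:
  assumes "prob_space M" "distributed M lborel X std_normal_density"
  shows "integrable M (\<lambda>\<omega>. X \<omega> ^ a)" "(LINT \<omega>|M. X \<omega> ^ a) = normal_moment a"
  unfolding normal_moment_def
  by (subst distributed_integrable[OF assms(2), symmetric])
     (auto simp: integrable_std_normal_moment distributed_integral[OF assms(2)] intro!: distributed_integral[OF assms(2), symmetric])

lemma gaussian_sequence_imp_moments: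
  assumes "prob_space M" and "prob_space.gaussian_sequence M (u :: 'n::finite \<Rightarrow> _)"
  shows "gaussian_moments M u"
proof -
  interpret prob_space M by fact
  have ind: "indep_vars (\<lambda>_. borel) (\<lambda>k \<omega>. u k \<omega> ^ a k) UNIV" for a
    using assms(2) unfolding gaussian_sequence_def
    by (intro indep_vars_compose2[where Y = "\<lambda>k x. x ^ a k" and X = u]) auto
  have d: "distributed M lborel (u k) std_normal_density" for k
    using assms(2) unfolding gaussian_sequence_def by auto
  note mom = std_normal_distributed_moment[OF assms(1) d]
  show ?thesis
  proof unfold_locales
    fix a
    show "integrable M (\<lambda>\<omega>. monomial a (\<lambda>k. u k \<omega>))"
      unfolding monomial_def by (intro indep_vars_integrable ind mom) auto
    show "(LINT \<omega>|M. monomial a (\<lambda>k. u k \<omega>)) = (\<Prod>k\<in>UNIV. normal_moment (a k))"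
      unfolding monomial_def by (subst indep_vars_lebesgue_integral) (auto simp: ind mom)
  qed
qed

lemma bilinear_inner: "bilinear (inner :: 'a::euclidean_space \<Rightarrow> _)"
  by (simp add: bilinear_conv_bounded_bilinear bounded_bilinear_inner)

lemmas polymap_mult = polymap_bilinear[OF bilinear_matrix_mult]
lemmas polymap_inner = polymap_bilinear[OF bilinear_inner]

lemma polymap_norm_power2:
  fixes f :: "('n \<Rightarrow> real) \<Rightarrow> 'v::euclidean_space"
  shows "polymap f \<Longrightarrow> polymap (\<lambda>x. (norm (f x))\<^sup>2)"
  unfolding power2_norm_eq_inner by (rule polymap_inner)

lemma polymap_scale: "polymap f \<Longrightarrow> polymap (\<lambda>x. c * f x :: real)"
  using polymap_linear[of "\<lambda>y. c * y" f] by (simp add: linear_times)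

text \<open>The double factorial (2q - 1)!!, the 2q-th moment of a standard normal variable.\<close>

definition odd_fact :: "nat \<Rightarrow> real" where
  "odd_fact q = (\<Prod>k<q. 2 * real k + 1)"

lemma odd_fact_Suc: "odd_fact (Suc q) = odd_fact q * (2 * real q + 1)"
  by (simp add: odd_fact_def)

lemma odd_fact_pos: "odd_fact q > 0"
  unfolding odd_fact_def by (intro prod_pos) auto

section \<open>The noncommutative Khintchine inequality\<close>

context gaussian_moments
begin

text \<open>Integration by parts in every coordinate: a linear Gaussian factor is exchanged for a
  divergence.\<close>

lemma expectation_series_inner:
  fixes A :: "'n \<Rightarrow> 'v::euclidean_space"
  assumes "\<And>k. polymap_deriv k f (f' k)"
  shows "(LINT \<omega>|M. inner (series A (uvec \<omega>)) (f (uvec \<omega>)))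
    = (LINT \<omega>|M. (\<Sum>k\<in>UNIV. inner (A k) (f' k (uvec \<omega>))))"
proof -
  have d: "polymap_deriv k (\<lambda>x. inner (A k) (f x)) (\<lambda>x. inner (A k) (f' k x))" for k
    by (rule deriv_linear[OF _ assms]) (use bilinear_inner in \<open>auto simp: bilinear_def\<close>)
  note pm = polymap_deriv_imp_polymap[OF d]
  have "(LINT \<omega>|M. inner (series A (uvec \<omega>)) (f (uvec \<omega>)))
      = (LINT \<omega>|M. (\<Sum>k\<in>UNIV. u k \<omega> *\<^sub>R inner (A k) (f (uvec \<omega>))))"
    by (simp add: series_def inner_sum_left)
  also have "\<dots> = (\<Sum>k\<in>UNIV. LINT \<omega>|M. u k \<omega> *\<^sub>R inner (A k) (f (uvec \<omega>)))"
    by (rule Bochner_Integration.integral_sum) (rule integrable_polymap[OF polymap_var[OF pm(1)]])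
  also have "\<dots> = (\<Sum>k\<in>UNIV. LINT \<omega>|M. inner (A k) (f' k (uvec \<omega>)))"
    by (intro sum.cong refl gaussian_ibp[OF d])
  also have "\<dots> = (LINT \<omega>|M. (\<Sum>k\<in>UNIV. inner (A k) (f' k (uvec \<omega>))))"
    by (rule Bochner_Integration.integral_sum[symmetric]) (rule integrable_polymap[OF pm(2)])
  finally show ?thesis .
qed

lemma expectation_norm_series:
  fixes A :: "'n \<Rightarrow> 'v::euclidean_space"
  shows "(LINT \<omega>|M. (norm (series A (uvec \<omega>)))\<^sup>2) = (\<Sum>k\<in>UNIV. (norm (A k))\<^sup>2)"
  unfolding power2_norm_eq_inner
  by (subst expectation_series_inner[OF deriv_series]) (simp add: prob_space)

text \<open>Integrating one factor by parts leaves 2q + 1 words with two occurrences of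
  \<open>H k\<close>. By \<open>trace_word_le\<close> each is at most the squared norm of
  \<open>H k\<close> times the q-th power, and the variance bound sums these over
  \<open>k\<close>.\<close>

lemma khintchine_step:
  fixes H :: "'n \<Rightarrow> complex^'d::finite^'d"
  assumes herm: "\<And>k. ctranspose (H k) = H k"
    and var: "\<And>x. (\<Sum>k\<in>UNIV. (norm (H k *v x))\<^sup>2) \<le> c * (norm x)\<^sup>2"
  shows "(LINT \<omega>|M. (norm (mpow (series H (uvec \<omega>)) (Suc q)))\<^sup>2)
    \<le> (2 * real q + 1) * c * (LINT \<omega>|M. (norm (mpow (series H (uvec \<omega>)) q))\<^sup>2)"
proof -
  let ?S = "series H"
  have S: "ctranspose (?S x) = ?S x" for x
    by (simp add: linear_series[OF linear_ctranspose] herm)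
  have d: "polymap_deriv k (\<lambda>x. mpow (?S x) (Suc (2 * q)))
      (\<lambda>x. \<Sum>r<Suc (2 * q). mpow (?S x) r ** H k ** mpow (?S x) (Suc (2 * q) - 1 - r))" for k
    by (rule deriv_mpow[OF deriv_series])
  have "(LINT \<omega>|M. (norm (mpow (?S (uvec \<omega>)) (Suc q)))\<^sup>2)
      = (LINT \<omega>|M. inner (?S (uvec \<omega>)) (mpow (?S (uvec \<omega>)) (Suc (2 * q))))"
    by (subst norm_mpow_power2[OF S, of 1 "Suc (2 * q)"]) auto
  also have "\<dots> = (LINT \<omega>|M. (\<Sum>k\<in>UNIV. inner (H k) (\<Sum>r<Suc (2 * q). 
      mpow (?S (uvec \<omega>)) r ** H k ** mpow (?S (uvec \<omega>)) (Suc (2 * q) - 1 - r))))"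
    by (rule expectation_series_inner[OF d])
  also have "\<dots> \<le> (LINT \<omega>|M. ((2 * real q + 1) * c) * (norm (mpow (?S (uvec \<omega>)) q))\<^sup>2)"
  proof (rule integral_mono)
    show "integrable M (\<lambda>\<omega>. \<Sum>k\<in>UNIV. inner (H k) (\<Sum>r<Suc (2 * q). 
      mpow (?S (uvec \<omega>)) r ** H k ** mpow (?S (uvec \<omega>)) (Suc (2 * q) - 1 - r)))"
      by (rule integrable_polymap)
         (intro polymap_sum polymap_inner polymap_const polymap_mult polymap_mpow polymap_series)
    show "integrable M (\<lambda>\<omega>. ((2 * real q + 1) * c) * (norm (mpow (?S (uvec \<omega>)) q))\<^sup>2)"
      by (rule integrable_polymap)
         (intro polymap_scale polymap_norm_power2 polymap_mpow polymap_series)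
  next
    fix \<omega>
    let ?X = "?S (uvec \<omega>)"
    have "inner (H k) (\<Sum>r<Suc (2 * q). mpow ?X r ** H k ** mpow ?X (Suc (2 * q) - 1 - r))
        \<le> (2 * real q + 1) * (norm (H k ** mpow ?X q))\<^sup>2" for k
    proof -
      have "inner (H k) (\<Sum>r<Suc (2 * q). mpow ?X r ** H k ** mpow ?X (Suc (2 * q) - 1 - r))
        \<le> (\<Sum>r<Suc (2 * q). (norm (H k ** mpow ?X q))\<^sup>2)"
        unfolding inner_sum_right
        by (intro sum_mono trace_word_le S herm) auto
      thus ?thesis by (simp add: algebra_simps)
    qed
    hence "(\<Sum>k\<in>UNIV. inner (H k) (\<Sum>r<Suc (2 * q). mpow ?X r ** H k ** mpow ?X (Suc (2 * q) - 1 - r)))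
       \<le> (2 * real q + 1) * (\<Sum>k\<in>UNIV. (norm (H k ** mpow ?X q))\<^sup>2)"
      unfolding sum_distrib_left by (intro sum_mono)
    also have "\<dots> \<le> (2 * real q + 1) * (c * (norm (mpow ?X q))\<^sup>2)"
      by (intro mult_left_mono sum_norm_matrix_mult_le var) auto
    finally show "(\<Sum>k\<in>UNIV. inner (H k) (\<Sum>r<Suc (2 * q). mpow ?X r ** H k ** mpow ?X (Suc (2 * q) - 1 - r)))
       \<le> ((2 * real q + 1) * c) * (norm (mpow ?X q))\<^sup>2" by (simp only: mult.assoc)
  qed
  finally show ?thesis by simp
qed

text \<open>The recursion starts from the second moment, which is \<Sum> |H k|^2, and not from the
  zeroth, which is the dimension \<open>'d\<close>. For dilations of m by p matrices this keeps
  \<open>m\<close> out of the bound.\<close>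

lemma khintchine_hermitian:
  fixes H :: "'n \<Rightarrow> complex^'d::finite^'d"
  assumes herm: "\<And>k. ctranspose (H k) = H k"
    and var: "\<And>x. (\<Sum>k\<in>UNIV. (norm (H k *v x))\<^sup>2) \<le> c * (norm x)\<^sup>2" and c: "c \<ge> 0"
  shows "(LINT \<omega>|M. (norm (mpow (series H (uvec \<omega>)) (Suc q)))\<^sup>2)
    \<le> odd_fact (Suc q) * c ^ q * (\<Sum>k\<in>UNIV. (norm (H k))\<^sup>2)"
proof (induction q)
  case 0
  show ?case by (simp add: expectation_norm_series odd_fact_def)
next
  case (Suc q)
  have "(LINT \<omega>|M. (norm (mpow (series H (uvec \<omega>)) (Suc (Suc q))))\<^sup>2)
     \<le> (2 * real (Suc q) + 1) * c * (LINT \<omega>|M. (norm (mpow (series H (uvec \<omega>)) (Suc q)))\<^sup>2)"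
    by (rule khintchine_step[OF herm var])
  also have "\<dots> \<le> (2 * real (Suc q) + 1) * c * (odd_fact (Suc q) * c ^ q * (\<Sum>k\<in>UNIV. (norm (H k))\<^sup>2))"
    using c by (intro mult_left_mono Suc) auto
  also have "\<dots> = odd_fact (Suc (Suc q)) * c ^ Suc q * (\<Sum>k\<in>UNIV. (norm (H k))\<^sup>2)"
    unfolding odd_fact_Suc[of "Suc q"] power_Suc by (simp only: mult_ac)
  finally show ?case .
qed

end

section \<open>Hermitian dilation of rectangular matrices\<close>

text \<open>The block matrix with \<open>A\<close> and its adjoint off the diagonal and zeros on it.
  It is linear in \<open>A\<close> over the reals, so the dilation of a series is the series of the
  dilations.\<close>

definition dilation :: "complex^'p^'m \<Rightarrow> complex^('m + 'p)^('m + 'p)" where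
  "dilation A = (\<chi> a b. case a of
      Inl i \<Rightarrow> (case b of Inl _ \<Rightarrow> 0 | Inr j \<Rightarrow> A $ i $ j)
    | Inr j \<Rightarrow> (case b of Inl i \<Rightarrow> cnj (A $ i $ j) | Inr _ \<Rightarrow> 0))"

lemma dilation_nth [simp]:
  "dilation A $ Inl i $ Inl i' = 0" "dilation A $ Inl i $ Inr j = A $ i $ j"
  "dilation A $ Inr j $ Inl i = cnj (A $ i $ j)" "dilation A $ Inr j $ Inr j' = 0"
  by (simp_all add: dilation_def)

lemma all_sum: "(\<forall>x. P x) \<longleftrightarrow> (\<forall>i. P (Inl i)) \<and> (\<forall>j. P (Inr j))"
  by (metis sum.exhaust)

lemma sum_Plus_UNIV:
  fixes f :: "'m::finite + 'p::finite \<Rightarrow> 'v::comm_monoid_add"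
  shows "(\<Sum>a\<in>UNIV. f a) = (\<Sum>i\<in>UNIV. f (Inl i)) + (\<Sum>j\<in>UNIV. f (Inr j))"
  by (simp add: UNIV_Plus_UNIV[symmetric] sum.Plus o_def del: UNIV_Plus_UNIV)

lemma ctranspose_dilation [simp]: "ctranspose (dilation A) = dilation A"
  by (simp add: vec_eq_iff all_sum)

lemma linear_dilation: "linear (dilation :: complex^'p::finite^'m::finite \<Rightarrow> _)"
  by (rule linearI) (simp_all add: vec_eq_iff all_sum)

lemma norm_dilation:
  fixes A :: "complex^'p::finite^'m::finite"
  shows "(norm (dilation A))\<^sup>2 = 2 * (norm A)\<^sup>2"
proof -
  have "(norm A)\<^sup>2 = (\<Sum>j\<in>UNIV. \<Sum>i\<in>UNIV. (cmod (A $ i $ j))\<^sup>2)"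
    unfolding norm_matrix_power2_columns norm_vec_power2 by (simp add: column_def)
  moreover have "\<dots> = (\<Sum>i\<in>UNIV. \<Sum>j\<in>UNIV. (cmod (A $ i $ j))\<^sup>2)" by (rule sum.swap)
  ultimately show ?thesis
    unfolding norm_matrix_power2_columns norm_vec_power2 column_def by (simp add: sum_Plus_UNIV)
qed

lemma norm_dilation_vector:
  fixes A :: "complex^'p::finite^'m::finite"
  shows "(norm (dilation A *v x))\<^sup>2
    = (norm (A *v (\<chi> j. x $ Inr j)))\<^sup>2 + (norm (ctranspose A *v (\<chi> i. x $ Inl i)))\<^sup>2"
  by (simp add: norm_vec_power2 matrix_vector_mult_def sum_Plus_UNIV)

lemma norm_split_vector:
  fixes x :: "complex^('m::finite + 'p::finite)"
  shows "(norm x)\<^sup>2 = (norm (\<chi> j. x $ Inr j :: complex^'p))\<^sup>2 + (norm (\<chi> i. x $ Inl i :: complex^'m))\<^sup>2"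
  by (simp add: norm_vec_power2 sum_Plus_UNIV)

lemma spectral_norm_le_dilation:
  fixes A :: "complex^'p::finite^'m::finite"
  shows "spectral_norm A \<le> spectral_norm (dilation A)"
proof (rule spectral_norm_le)
  fix w :: "complex^'p"
  define x :: "complex^('m + 'p)" where "x = (\<chi> a. case a of Inl i \<Rightarrow> 0 | Inr j \<Rightarrow> w $ j)"
  have x: "(\<chi> j. x $ Inr j) = w" "(\<chi> i. x $ Inl i) = 0" by (simp_all add: x_def vec_eq_iff)
  have "(norm x)\<^sup>2 = (norm w)\<^sup>2" by (subst norm_split_vector) (simp add: x)
  moreover have "(norm (dilation A *v x))\<^sup>2 = (norm (A *v w))\<^sup>2"
    by (subst norm_dilation_vector) (simp add: x)
  ultimately show "norm (A *v w) \<le> spectral_norm (dilation A) * norm w"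
    using norm_le_spectral_norm[of "dilation A" x] by simp
qed (rule spectral_norm_nonneg)

lemma (in gaussian_moments) khintchine:
  fixes R :: "'n \<Rightarrow> complex^'p::finite^'m::finite"
  assumes col: "\<And>x. (\<Sum>k\<in>UNIV. (norm (R k *v x))\<^sup>2) \<le> c * (norm x)\<^sup>2"
    and row: "\<And>x. (\<Sum>k\<in>UNIV. (norm (ctranspose (R k) *v x))\<^sup>2) \<le> c * (norm x)\<^sup>2"
    and c: "c \<ge> 0" and q: "q > 0"
  shows "(LINT \<omega>|M. (norm (mpow (dilation (series R (uvec \<omega>))) q))\<^sup>2)
    \<le> 2 * real CARD('p) * odd_fact q * c ^ q"
proof -
  obtain q' where q': "q = Suc q'" using q by (cases q) auto
  have "(LINT \<omega>|M. (norm (mpow (series (\<lambda>k. dilation (R k)) (uvec \<omega>)) (Suc q')))\<^sup>2)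
    \<le> odd_fact (Suc q') * c ^ q' * (\<Sum>k\<in>UNIV. (norm (dilation (R k)))\<^sup>2)"
  proof (rule khintchine_hermitian)
    fix x :: "complex^('m + 'p)"
    show "(\<Sum>k\<in>UNIV. (norm (dilation (R k) *v x))\<^sup>2) \<le> c * (norm x)\<^sup>2"
      unfolding norm_dilation_vector norm_split_vector[of x] sum.distrib distrib_left
      by (intro add_mono col row)
  qed (use c in auto)
  also have "\<dots> \<le> odd_fact (Suc q') * c ^ q' * (2 * (c * real CARD('p)))"
  proof (rule mult_left_mono)
    \<comment> \<open>The column bound tested on the identity controls the total Frobenius mass by c
      p, which is the only place where a dimension enters.\<close>
    have "(\<Sum>k\<in>UNIV. (norm (R k ** mat 1))\<^sup>2) \<le> c * (norm (mat 1 :: complex^'p^'p))\<^sup>2"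
      by (rule sum_norm_matrix_mult_le[OF col])
    also have "(norm (mat 1 :: complex^'p^'p))\<^sup>2 = real CARD('p)"
      by (rule norm_mat_1_power2)
    finally show "(\<Sum>k\<in>UNIV. (norm (dilation (R k)))\<^sup>2) \<le> 2 * (c * real CARD('p))"
      by (simp add: norm_dilation sum_distrib_left[symmetric])
  qed (use c odd_fact_pos[of "Suc q'"] in simp)
  also have "\<dots> = 2 * real CARD('p) * odd_fact q * c ^ q" by (simp add: q')
  finally show ?thesis by (simp only: q' linear_series[OF linear_dilation])
qed

section \<open>Moments of the Gaussian matrix chaos\<close>

text \<open>Convexity of the q-th power at the midpoint of \<open>a\<close> and \<open>b\<close>.
  The induction uses that \<open>a - b\<close> and \<open>a ^ q - b ^ q\<close> have the same
  sign.\<close>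

lemma power_sum_le:
  fixes a b :: real
  assumes "a \<ge> 0" "b \<ge> 0"
  shows "2 * (a + b) ^ q \<le> 2 ^ q * (a ^ q + b ^ q)"
proof (induction q)
  case (Suc q)
  have "(a - b) * (a ^ q - b ^ q) \<ge> 0"
  proof (cases "a \<le> b")
    case True
    thus ?thesis using assms by (intro mult_nonpos_nonpos) (auto intro: power_mono)
  next
    case False
    thus ?thesis using assms by (intro mult_nonneg_nonneg) (auto intro: power_mono)
  qed
  hence *: "(a + b) * (a ^ q + b ^ q) \<le> 2 * (a ^ Suc q + b ^ Suc q)" by (simp add: algebra_simps)
  have "2 * (a + b) ^ Suc q = (a + b) * (2 * (a + b) ^ q)" by simp
  also have "\<dots> \<le> (a + b) * (2 ^ q * (a ^ q + b ^ q))" using assms Suc by (intro mult_left_mono) auto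
  also have "\<dots> = 2 ^ q * ((a + b) * (a ^ q + b ^ q))" by (simp only: mult_ac)
  also have "\<dots> \<le> 2 ^ q * (2 * (a ^ Suc q + b ^ Suc q))" by (intro mult_left_mono *) auto
  also have "\<dots> = 2 ^ Suc q * (a ^ Suc q + b ^ Suc q)" by (simp only: power_Suc mult_ac)
  finally show ?case .
qed simp

lemma norm_add_power2_le:
  fixes a b :: "'a::real_inner"
  shows "(norm (a + b))\<^sup>2 \<le> 2 * (norm a)\<^sup>2 + 2 * (norm b)\<^sup>2"
proof -
  have "(norm (a + b))\<^sup>2 + (norm (a - b))\<^sup>2 = 2 * (norm a)\<^sup>2 + 2 * (norm b)\<^sup>2"
    by (simp add: power2_norm_eq_inner inner_add inner_diff inner_commute)
  thus ?thesis using zero_le_power2[of "norm (a - b)"] by linarith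
qed

text \<open>Since \<open>k \<mapsto> w ^ (q - k) * (norm (mpow X k))\<^sup>2\<close> is log-convex, Young's inequality
  needs no diagonalization.\<close>

lemma trace_young:
  fixes X :: "complex^'p::finite^'p"
  assumes X: "ctranspose X = X" and w: "w \<ge> 0"
  shows "(real q + 1) * (w * (norm (mpow X q))\<^sup>2)
    \<le> real CARD('p) * w ^ Suc q + real q * (norm (mpow X (Suc q)))\<^sup>2"
proof -
  define c where "c k = w ^ (Suc q - k) * (norm (mpow X k))\<^sup>2" for k
  \<comment> \<open>The chord is evaluated one step before its right end; at its left end the norm
    is that of the identity, whose square is p.\<close>
  have "Suc q * c q \<le> (real (Suc q) - q) * c 0 + q * c (Suc q)"
  proof (rule log_convex_seq_chord)
    fix i assume i: "0 < i" "i < Suc q"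
    have "(norm (mpow X i))\<^sup>2 = inner (mpow X (i - 1)) (mpow X (i + 1))"
      using i by (intro norm_mpow_power2 X) auto
    also have "\<dots> \<le> norm (mpow X (i - 1)) * norm (mpow X (i + 1))" by (rule norm_cauchy_schwarz)
    finally have "((norm (mpow X i))\<^sup>2)\<^sup>2 \<le> (norm (mpow X (i - 1)) * norm (mpow X (i + 1)))\<^sup>2"
      by (intro power_mono) auto
    hence "(w ^ (Suc q - i))\<^sup>2 * ((norm (mpow X i))\<^sup>2)\<^sup>2
       \<le> (w ^ (Suc q - i))\<^sup>2 * ((norm (mpow X (i - 1)))\<^sup>2 * (norm (mpow X (i + 1)))\<^sup>2)"
      unfolding power_mult_distrib by (intro mult_left_mono) auto
    moreover have "(w ^ (Suc q - i))\<^sup>2 = w ^ (Suc q - (i - 1)) * w ^ (Suc q - (i + 1))"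
      using i unfolding power2_eq_square power_add[symmetric] by (intro arg_cong2[where f = power]) auto
    ultimately show "(c i)\<^sup>2 \<le> c (i - 1) * c (i + 1)"
      unfolding c_def power_mult_distrib by (simp only: mult_ac)
  qed (use w in \<open>auto simp: c_def\<close>)
  thus ?thesis by (simp add: c_def norm_mat_1_power2 mult_ac add.commute)
qed

text \<open>The matrices \<open>ctranspose A ** R i\<close> stacked on top of each other; row \<open>(i, l)\<close> is row \<open>l\<close> of the \<open>i\<close>-th one.\<close>

definition stacked :: "('n::finite \<Rightarrow> complex^'p::finite^'m::finite) \<Rightarrow> complex^'p^'m \<Rightarrow> complex^'p^('n \<times> 'p)" where
  "stacked R A = (\<chi> a j. (ctranspose A ** R (fst a)) $ snd a $ j)"

lemma linear_stacked: "linear (stacked R)"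
  by (rule linearI)
     (simp_all add: stacked_def vec_eq_iff linear_add[OF linear_ctranspose]
        linear_scale[OF linear_ctranspose] matrix_add_rdistrib scaleR_matrix_mult)

lemma norm_stacked_vector:
  fixes R :: "'n::finite \<Rightarrow> complex^'p::finite^'m::finite"
  shows "(norm (stacked R A *v v))\<^sup>2 = (\<Sum>i\<in>UNIV. (norm ((ctranspose A ** R i) *v v))\<^sup>2)"
  by (simp add: norm_vec_power2 matrix_vector_mult_def stacked_def sum.cartesian_product
      UNIV_Times_UNIV[symmetric] case_prod_beta del: UNIV_Times_UNIV)

text \<open>The purpose of stacking: a sum of squares over \<open>i\<close> becomes the square of
  one matrix product, hence is governed by a single spectral norm. The stacked matrix is linear in
  \<open>A\<close>, so for A = L it is again a linear series to which Khintchine applies.\<close>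

lemma norm_stacked_mult:
  fixes R :: "'n::finite \<Rightarrow> complex^'p::finite^'m::finite" and Z :: "complex^'k::finite^'p"
  shows "(\<Sum>i\<in>UNIV. (norm ((ctranspose A ** R i) ** Z))\<^sup>2) = (norm (stacked R A ** Z))\<^sup>2"
  unfolding norm_matrix_power2_columns column_matrix_mult norm_stacked_vector by (rule sum.swap)

section \<open>The centred quadratic chaos and its derivatives\<close>

text \<open>The mean of \<open>ctranspose L ** L\<close> when the coordinates are uncorrelated with
  unit second moment, as shown in \<open>expectation_gram_orthonormal\<close>.\<close>

definition gram_mean :: "('n::finite \<Rightarrow> complex^'p::finite^'m::finite) \<Rightarrow> complex^'p^'p" where
  "gram_mean R = (\<Sum>k\<in>UNIV. ctranspose (R k) ** R k)"

definition chaos :: "('n::finite \<Rightarrow> complex^'p::finite^'m::finite) \<Rightarrow> ('n \<Rightarrow> real) \<Rightarrow> complex^'p^'p" where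
  "chaos R x = ctranspose (series R x) ** series R x - gram_mean R"

lemma ctranspose_chaos: "ctranspose (chaos R x) = chaos R x"
  by (simp add: chaos_def gram_mean_def linear_diff[OF linear_ctranspose] linear_sum[OF linear_ctranspose]
      ctranspose_mult)

lemma polymap_chaos: "polymap (chaos R)"
proof -
  have "polymap (\<lambda>x. ctranspose (series R x) ** series R x + (- gram_mean R))"
    by (intro polymap_add polymap_const polymap_mult polymap_linear[OF linear_ctranspose] polymap_series)
  thus ?thesis by (simp add: chaos_def[abs_def])
qed

lemma deriv_chaos:
  "polymap_deriv k (chaos R) (\<lambda>x. ctranspose (R k) ** series R x + ctranspose (series R x) ** R k)"
proof -
  have "polymap_deriv k (\<lambda>x. ctranspose (series R x) ** series R x + (- gram_mean R))
     (\<lambda>x. (ctranspose (R k) ** series R x + ctranspose (series R x) ** R k) + 0)"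
    by (intro deriv_add deriv_const deriv_bilinear[OF bilinear_matrix_mult]
        deriv_linear[OF linear_ctranspose] deriv_series)
  thus ?thesis by (rule polymap_deriv_cong) (simp_all add: chaos_def)
qed

text \<open>Integration by parts yields a non-Hermitian \<open>Z\<close> against the Hermitian
  \<open>Z + ctranspose Z\<close>. Transposing reverses each word, and the sum over \<open>r\<close>
  is invariant under this reversal, so \<open>Z\<close> may be symmetrized at the price of the
  factor 2; then \<open>trace_word_le\<close> applies.\<close>

lemma chaos_word_sum_le:
  fixes X Z :: "complex^'p::finite^'p"
  assumes X: "ctranspose X = X"
  shows "2 * (\<Sum>r<Suc (2 * q). inner Z (mpow X r ** (Z + ctranspose Z) ** mpow X (2 * q - r)))
    \<le> (2 * real q + 1) * (norm ((Z + ctranspose Z) ** mpow X q))\<^sup>2"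
proof -
  let ?Y = "Z + ctranspose Z"
  have Y: "ctranspose ?Y = ?Y" by (simp add: linear_add[OF linear_ctranspose])
  let ?f = "\<lambda>Z r. inner Z (mpow X r ** ?Y ** mpow X (2 * q - r))"
  have "?f Z r = ?f (ctranspose Z) (2 * q - r)" if "r < Suc (2 * q)" for r
  proof -
    have "?f Z r = inner (ctranspose Z) (ctranspose (mpow X r ** ?Y ** mpow X (2 * q - r)))"
      by (simp only: inner_ctranspose)
    also have "ctranspose (mpow X r ** ?Y ** mpow X (2 * q - r)) = mpow X (2 * q - r) ** ?Y ** mpow X r"
      by (simp only: ctranspose_mult ctranspose_mpow[OF X] Y matrix_mul_assoc)
    finally show ?thesis using that by simp
  qed
  hence "(\<Sum>r<Suc (2 * q). ?f Z r) = (\<Sum>r<Suc (2 * q). ?f (ctranspose Z) (2 * q - r))"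
    by (intro sum.cong) auto
  also have "\<dots> = (\<Sum>r<Suc (2 * q). ?f (ctranspose Z) r)"
    using sum.nat_diff_reindex[of "?f (ctranspose Z)" "Suc (2 * q)"] by simp
  finally have "2 * (\<Sum>r<Suc (2 * q). ?f Z r) = (\<Sum>r<Suc (2 * q). ?f Z r) + (\<Sum>r<Suc (2 * q). ?f (ctranspose Z) r)"
    by simp
  also have "\<dots> = (\<Sum>r<Suc (2 * q). ?f ?Y r)"
    by (simp only: sum.distrib[symmetric] inner_add_left)
  also have "\<dots> \<le> (\<Sum>r<Suc (2 * q). (norm (?Y ** mpow X q))\<^sup>2)"
    by (intro sum_mono trace_word_le X Y) auto
  finally show ?thesis by (simp add: algebra_simps)
qed

text \<open>In \<open>ctranspose (R k) ** L\<close> the sum over \<open>k\<close> is removed by the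
  row bound, leaving the norm of \<open>L\<close>; in \<open>ctranspose L ** R k\<close> it is
  collected in the stacked matrix. The factor 2 lost in splitting the square cancels the factor 2 on
  the left of \<open>chaos_word_sum_le\<close>.\<close>

lemma chaos_derivative_sum_le:
  fixes R :: "'n::finite \<Rightarrow> complex^'p::finite^'m::finite" and L :: "complex^'p^'m"
  assumes X: "ctranspose X = X"
    and row: "\<And>x. (\<Sum>k\<in>UNIV. (norm (ctranspose (R k) *v x))\<^sup>2) \<le> b * (norm x)\<^sup>2" and b: "b \<ge> 0"
  shows "(\<Sum>k\<in>UNIV. inner (ctranspose (R k) ** L) (\<Sum>r<Suc (2 * q).
        mpow X r ** (ctranspose (R k) ** L + ctranspose L ** R k) ** mpow X (2 * q - r)))
    \<le> (2 * real q + 1) * (b * (spectral_norm L)\<^sup>2 + (spectral_norm (stacked R L))\<^sup>2) * (norm (mpow X q))\<^sup>2"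
proof -
  let ?P = "mpow X q"
  let ?Y = "\<lambda>k. ctranspose (R k) ** L + ctranspose L ** R k"
  have ct: "ctranspose L ** R k = ctranspose (ctranspose (R k) ** L)" for k
    by (simp add: ctranspose_mult)
  have "2 * (\<Sum>k\<in>UNIV. inner (ctranspose (R k) ** L) (\<Sum>r<Suc (2 * q). mpow X r ** ?Y k ** mpow X (2 * q - r)))
     \<le> (\<Sum>k\<in>UNIV. (2 * real q + 1) * (norm (?Y k ** ?P))\<^sup>2)"
    unfolding sum_distrib_left[of 2] inner_sum_right ct
    using chaos_word_sum_le[OF X] by (intro sum_mono) (simp only: sum_distrib_left)
  also have "\<dots> = (2 * real q + 1) * (\<Sum>k\<in>UNIV. (norm (?Y k ** ?P))\<^sup>2)" by (simp only: sum_distrib_left)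
  also have "\<dots> \<le> (2 * real q + 1) *
      (2 * (b * ((spectral_norm L)\<^sup>2 * (norm ?P)\<^sup>2)) + 2 * ((spectral_norm (stacked R L))\<^sup>2 * (norm ?P)\<^sup>2))"
  proof (rule mult_left_mono)
    have "(\<Sum>k\<in>UNIV. (norm (?Y k ** ?P))\<^sup>2)
      \<le> 2 * (\<Sum>k\<in>UNIV. (norm (ctranspose (R k) ** (L ** ?P)))\<^sup>2)
        + 2 * (\<Sum>k\<in>UNIV. (norm ((ctranspose L ** R k) ** ?P))\<^sup>2)"
      unfolding sum_distrib_left sum.distrib[symmetric] matrix_add_rdistrib
      by (intro sum_mono) (use norm_add_power2_le in \<open>simp only: matrix_mul_assoc\<close>)
    moreover have "(\<Sum>k\<in>UNIV. (norm (ctranspose (R k) ** (L ** ?P)))\<^sup>2) \<le> b * (norm (L ** ?P))\<^sup>2"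
      by (rule sum_norm_matrix_mult_le[OF row])
    moreover have "b * (norm (L ** ?P))\<^sup>2 \<le> b * ((spectral_norm L)\<^sup>2 * (norm ?P)\<^sup>2)"
      unfolding power_mult_distrib[symmetric] using b by (intro mult_left_mono power_mono norm_matrix_mult_le) auto
    moreover have "(\<Sum>k\<in>UNIV. (norm ((ctranspose L ** R k) ** ?P))\<^sup>2) \<le> (spectral_norm (stacked R L))\<^sup>2 * (norm ?P)\<^sup>2"
      unfolding norm_stacked_mult power_mult_distrib[symmetric] by (intro power_mono norm_matrix_mult_le) auto
    ultimately show "(\<Sum>k\<in>UNIV. (norm (?Y k ** ?P))\<^sup>2) \<le> 2 * (b * ((spectral_norm L)\<^sup>2 * (norm ?P)\<^sup>2))
        + 2 * ((spectral_norm (stacked R L))\<^sup>2 * (norm ?P)\<^sup>2)" by linarith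
  qed simp
  also have "\<dots> = 2 * ((2 * real q + 1) * (b * (spectral_norm L)\<^sup>2 + (spectral_norm (stacked R L))\<^sup>2) * (norm ?P)\<^sup>2)"
    by algebra
  finally show ?thesis by simp
qed

lemma spectral_norm_power_le_dilation:
  fixes A :: "complex^'p::finite^'m::finite"
  assumes "q > 0"
  shows "((spectral_norm A)\<^sup>2) ^ q \<le> (norm (mpow (dilation A) q))\<^sup>2"
proof -
  have "((spectral_norm A)\<^sup>2) ^ q = spectral_norm A ^ (2 * q)" by (simp add: power_mult)
  also have "\<dots> \<le> spectral_norm (dilation A) ^ (2 * q)"
    by (intro power_mono spectral_norm_le_dilation spectral_norm_nonneg)
  also have "\<dots> \<le> (norm (mpow (dilation A) q))\<^sup>2" by (rule spectral_norm_power_le_mpow) (simp_all add: assms)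
  finally show ?thesis .
qed

context gaussian_moments
begin

text \<open>Only the outer \<open>L\<close> is integrated by parts. The derivative of the remaining
  linear factor sums to \<open>gram_mean R\<close> and cancels the centring term, so only the
  derivatives of the odd power survive.\<close>

lemma expectation_chaos_power:
  fixes R :: "'n \<Rightarrow> complex^'p::finite^'m::finite"
  shows "(LINT \<omega>|M. (norm (mpow (chaos R (uvec \<omega>)) (Suc q)))\<^sup>2)
    = (LINT \<omega>|M. (\<Sum>k\<in>UNIV. inner (ctranspose (R k) ** series R (uvec \<omega>)) (\<Sum>r<Suc (2 * q).
        mpow (chaos R (uvec \<omega>)) r
        ** (ctranspose (R k) ** series R (uvec \<omega>) + ctranspose (series R (uvec \<omega>)) ** R k)
        ** mpow (chaos R (uvec \<omega>)) (2 * q - r))))"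
proof -
  let ?X = "chaos R" let ?L = "series R" let ?P = "\<lambda>x. mpow (?X x) (Suc (2 * q))"
  define D where "D k x = (\<Sum>r<Suc (2 * q). mpow (?X x) r
        ** (ctranspose (R k) ** ?L x + ctranspose (?L x) ** R k) ** mpow (?X x) (2 * q - r))" for k x
  \<comment> \<open>Transposition reverses the words, and reindexing r \<mapsto> 2q - r restores the
    sum.\<close>
  have ctD: "ctranspose (D k x) = D k x" for k x
  proof -
    have "ctranspose (D k x) = (\<Sum>r<Suc (2 * q). mpow (?X x) (2 * q - r)
        ** (ctranspose (R k) ** ?L x + ctranspose (?L x) ** R k) ** mpow (?X x) r)"
      unfolding D_def
      by (simp only: linear_sum[OF linear_ctranspose] linear_add[OF linear_ctranspose] ctranspose_mult
          ctranspose_mpow[OF ctranspose_chaos] ctranspose_ctranspose matrix_mul_assoc add.commute)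
    also have "\<dots> = D k x"
      unfolding D_def
      using sum.nat_diff_reindex[of "\<lambda>r. mpow (?X x) r
        ** (ctranspose (R k) ** ?L x + ctranspose (?L x) ** R k) ** mpow (?X x) (2 * q - r)" "Suc (2 * q)"]
      by (auto intro!: sum.cong elim!: trans[rotated])
    finally show ?thesis .
  qed
  have dP: "polymap_deriv k ?P (D k)" for k
    unfolding D_def[abs_def] using deriv_mpow[OF deriv_chaos[of k R], of "Suc (2 * q)"]
    by (simp del: mpow.simps sum.lessThan_Suc)
  have pP: "polymap ?P" by (intro polymap_mpow polymap_chaos)
  have pL: "polymap ?L" by (rule polymap_series)
  have pD: "polymap (D k)" for k by (rule polymap_deriv_imp_polymap[OF dP])
  have dLP: "polymap_deriv k (\<lambda>x. ?L x ** ?P x) (\<lambda>x. R k ** ?P x + ?L x ** D k x)" for k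
    by (intro deriv_bilinear[OF bilinear_matrix_mult] deriv_series dP)
  have pint: "integrable M (\<lambda>\<omega>. inner (f (uvec \<omega>)) (g (uvec \<omega>)))" if "polymap f" "polymap g"
    for f g :: "('n \<Rightarrow> real) \<Rightarrow> complex^'p^'p"
    by (intro integrable_polymap polymap_inner that)
  have pint': "integrable M (\<lambda>\<omega>. inner (f (uvec \<omega>)) (g (uvec \<omega>)))" if "polymap f" "polymap g"
    for f g :: "('n \<Rightarrow> real) \<Rightarrow> complex^'p^'m"
    by (intro integrable_polymap polymap_inner that)
  have "(LINT \<omega>|M. (norm (mpow (?X (uvec \<omega>)) (Suc q)))\<^sup>2)
      = (LINT \<omega>|M. inner (?L (uvec \<omega>)) (?L (uvec \<omega>) ** ?P (uvec \<omega>)) - inner (gram_mean R) (?P (uvec \<omega>)))"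
  proof (rule Bochner_Integration.integral_cong[OF refl])
    fix \<omega>
    let ?x = "uvec \<omega>"
    have "(norm (mpow (?X ?x) (Suc q)))\<^sup>2 = inner (mpow (?X ?x) 1) (?P ?x)"
      by (rule norm_mpow_power2[OF ctranspose_chaos]) simp
    also have "\<dots> = inner (?X ?x) (?P ?x)" by simp
    also have "\<dots> = inner (ctranspose (?L ?x) ** ?L ?x) (?P ?x) - inner (gram_mean R) (?P ?x)"
      by (subst chaos_def, subst inner_diff_left) (rule refl)
    also have "inner (ctranspose (?L ?x) ** ?L ?x) (?P ?x) = inner (?L ?x) (?L ?x ** ?P ?x)"
      by (subst inner_matrix_mult_left) (simp only: ctranspose_ctranspose)
    finally show "(norm (mpow (?X ?x) (Suc q)))\<^sup>2
      = inner (?L ?x) (?L ?x ** ?P ?x) - inner (gram_mean R) (?P ?x)" .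
  qed
  also have "\<dots> = (LINT \<omega>|M. inner (?L (uvec \<omega>)) (?L (uvec \<omega>) ** ?P (uvec \<omega>)))
      - (LINT \<omega>|M. inner (gram_mean R) (?P (uvec \<omega>)))"
    by (rule Bochner_Integration.integral_diff) (intro pint pint' polymap_const polymap_mult pL pP)+
  also have "(LINT \<omega>|M. inner (?L (uvec \<omega>)) (?L (uvec \<omega>) ** ?P (uvec \<omega>)))
      = (LINT \<omega>|M. (\<Sum>k\<in>UNIV. inner (R k) (R k ** ?P (uvec \<omega>) + ?L (uvec \<omega>) ** D k (uvec \<omega>))))"
    by (rule expectation_series_inner[OF dLP])
  also have "\<dots> = (LINT \<omega>|M. inner (gram_mean R) (?P (uvec \<omega>))
        + (\<Sum>k\<in>UNIV. inner (ctranspose (R k) ** ?L (uvec \<omega>)) (ctranspose (D k (uvec \<omega>)))))"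
  proof (rule Bochner_Integration.integral_cong[OF refl])
    fix \<omega>
    let ?x = "uvec \<omega>"
    have "inner (R k) (R k ** ?P ?x) = inner (ctranspose (R k) ** R k) (?P ?x)" for k
      by (subst inner_matrix_mult_left) (simp only: ctranspose_ctranspose)
    moreover have "inner (R k) (?L ?x ** D k ?x) = inner (ctranspose (R k) ** ?L ?x) (ctranspose (D k ?x))" for k
    proof -
      have "inner (R k) (?L ?x ** D k ?x) = inner (ctranspose (?L ?x) ** R k) (D k ?x)"
        by (subst inner_matrix_mult_left) (simp only: ctranspose_ctranspose)
      also have "\<dots> = inner (ctranspose (ctranspose (?L ?x) ** R k)) (ctranspose (D k ?x))"
        by (simp only: inner_ctranspose)
      finally show ?thesis by (simp only: ctranspose_mult ctranspose_ctranspose)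
    qed
    ultimately show "(\<Sum>k\<in>UNIV. inner (R k) (R k ** ?P ?x + ?L ?x ** D k ?x))
      = inner (gram_mean R) (?P ?x) + (\<Sum>k\<in>UNIV. inner (ctranspose (R k) ** ?L ?x) (ctranspose (D k ?x)))"
      by (simp only: inner_add_right sum.distrib gram_mean_def inner_sum_left)
  qed
  also have "\<dots> = (LINT \<omega>|M. inner (gram_mean R) (?P (uvec \<omega>)))
        + (LINT \<omega>|M. (\<Sum>k\<in>UNIV. inner (ctranspose (R k) ** ?L (uvec \<omega>)) (ctranspose (D k (uvec \<omega>)))))"
    by (rule Bochner_Integration.integral_add)
       (intro pint polymap_const pP integrable_polymap polymap_sum polymap_inner polymap_mult pL
          polymap_linear[OF linear_ctranspose] pD)+
  finally show ?thesis unfolding ctD by (simp add: D_def del: mpow.simps sum.lessThan_Suc)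
qed

text \<open>The integrand after integration by parts is a random weight times the (2q - 2)-th trace
  power, and the two are dependent. Young's inequality bounds the product by the q-th power of the
  weight, which Khintchine controls, plus a multiple of the 2q-th trace power. One factor p comes
  from Young, the other from Khintchine.\<close>

theorem chaos_moment:
  fixes R :: "'n \<Rightarrow> complex^'p::finite^'m::finite"
  assumes col: "\<And>x. (\<Sum>k\<in>UNIV. (norm (R k *v x))\<^sup>2) \<le> c * (norm x)\<^sup>2"
    and row: "\<And>x. (\<Sum>k\<in>UNIV. (norm (ctranspose (R k) *v x))\<^sup>2) \<le> b * (norm x)\<^sup>2"
    and stack: "\<And>x. (\<Sum>k\<in>UNIV. (norm (ctranspose (stacked R (R k)) *v x))\<^sup>2) \<le> b\<^sup>2 * (norm x)\<^sup>2"
    and b: "0 \<le> b" "b \<le> c" and q: "q > 0"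
  shows "(LINT \<omega>|M. (norm (mpow (chaos R (uvec \<omega>)) q))\<^sup>2)
    \<le> 2 * (real CARD('p))\<^sup>2 * (2 * (2 * real q - 1)) ^ q * odd_fact q * (b * c) ^ q"
proof -
  obtain q' where q': "q = Suc q'" using q by (cases q) auto
  let ?X = "\<lambda>\<omega>. chaos R (uvec \<omega>)" and ?L = "\<lambda>\<omega>. series R (uvec \<omega>)"
  define s where "s j \<omega> = (norm (mpow (?X \<omega>) j))\<^sup>2" for j \<omega>
  define d1 where "d1 \<omega> = (norm (mpow (dilation (series R (uvec \<omega>))) q))\<^sup>2" for \<omega>
  define d2 where "d2 \<omega> = (norm (mpow (dilation (series (\<lambda>k. stacked R (R k)) (uvec \<omega>))) q))\<^sup>2" for \<omega>
  define T where "T \<omega> = (\<Sum>k\<in>UNIV. inner (ctranspose (R k) ** ?L \<omega>) (\<Sum>r<Suc (2 * q').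
        mpow (?X \<omega>) r ** (ctranspose (R k) ** ?L \<omega> + ctranspose (?L \<omega>) ** R k) ** mpow (?X \<omega>) (2 * q' - r)))" for \<omega>
  define K where "K = real CARD('p) * (2 * (2 * real q - 1)) ^ q"
  have K: "K \<ge> 0" using q by (simp add: K_def)
  have int_s: "integrable M (s j)" for j
    unfolding s_def by (rule integrable_polymap) (intro polymap_norm_power2 polymap_mpow polymap_chaos)
  have int_d: "integrable M d1" "integrable M d2"
    unfolding d1_def d2_def
    by (rule integrable_polymap,
        intro polymap_norm_power2 polymap_mpow polymap_linear[OF linear_dilation] polymap_series)+
  have E1: "integral\<^sup>L M d1 \<le> 2 * real CARD('p) * odd_fact q * c ^ q"
    unfolding d1_def
  proof (rule khintchine[OF col])
    show "(\<Sum>k\<in>UNIV. (norm (ctranspose (R k) *v x))\<^sup>2) \<le> c * (norm x)\<^sup>2" for x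
      using row[of x] mult_right_mono[OF b(2), of "(norm x)\<^sup>2"] by simp
  qed (use b q in auto)
  have E2: "integral\<^sup>L M d2 \<le> 2 * real CARD('p) * odd_fact q * (b * c) ^ q"
    unfolding d2_def
  proof (rule khintchine)
    fix x :: "complex^'p"
    \<comment> \<open>The row bound removes the sum over \<open>k\<close> and the column bound the
      sum over \<open>i\<close>, which gives the variance b c; the other variance b^2 is no larger
      because b \<le> c.\<close>
    have "(\<Sum>k\<in>UNIV. (norm (stacked R (R k) *v x))\<^sup>2)
        = (\<Sum>i\<in>UNIV. \<Sum>k\<in>UNIV. (norm (ctranspose (R k) *v (R i *v x)))\<^sup>2)"
      unfolding norm_stacked_vector matrix_vector_mul_assoc by (rule sum.swap)
    also have "\<dots> \<le> (\<Sum>i\<in>UNIV. b * (norm (R i *v x))\<^sup>2)" by (intro sum_mono row)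
    also have "\<dots> \<le> b * (c * (norm x)\<^sup>2)"
      unfolding sum_distrib_left[symmetric] using b by (intro mult_left_mono col) auto
    finally show "(\<Sum>k\<in>UNIV. (norm (stacked R (R k) *v x))\<^sup>2) \<le> b * c * (norm x)\<^sup>2" by (simp add: mult_ac)
  next
    fix x :: "complex^('n \<times> 'p)"
    have "b\<^sup>2 * (norm x)\<^sup>2 \<le> b * c * (norm x)\<^sup>2"
      unfolding power2_eq_square[of b] using b by (intro mult_right_mono mult_left_mono) auto
    thus "(\<Sum>k\<in>UNIV. (norm (ctranspose (stacked R (R k)) *v x))\<^sup>2) \<le> b * c * (norm x)\<^sup>2"
      using stack[of x] by simp
  qed (use b q in auto)
  have pt: "q * T \<omega>
      \<le> K * (b ^ q * d1 \<omega> + d2 \<omega>) / 2 + real q' * s q \<omega>" for \<omega>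
  proof -
    define v1 v2 where "v1 = b * (spectral_norm (?L \<omega>))\<^sup>2" and "v2 = (spectral_norm (stacked R (?L \<omega>)))\<^sup>2"
    define w where "w = (2 * real q' + 1) * (v1 + v2)"
    have v: "v1 \<ge> 0" "v2 \<ge> 0" and w: "w \<ge> 0" using b by (auto simp: v1_def v2_def w_def)
    have "T \<omega> \<le> w * (norm (mpow (?X \<omega>) q'))\<^sup>2"
      unfolding T_def w_def v1_def v2_def by (rule chaos_derivative_sum_le[OF ctranspose_chaos row b(1)])
    hence "q * T \<omega> \<le> q * (w * (norm (mpow (?X \<omega>) q'))\<^sup>2)" by (intro mult_left_mono) auto
    also have "\<dots> \<le> real CARD('p) * w ^ q + real q' * s q \<omega>"
      using trace_young[OF ctranspose_chaos w, of q' R "uvec \<omega>"] by (simp add: s_def q' add.commute)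
    also have "real CARD('p) * w ^ q \<le> K * (b ^ q * d1 \<omega> + d2 \<omega>) / 2"
    proof -
      have "v1 ^ q \<le> b ^ q * d1 \<omega>"
        unfolding v1_def d1_def power_mult_distrib
        using b by (intro mult_left_mono spectral_norm_power_le_dilation q) auto
      moreover have "v2 ^ q \<le> d2 \<omega>"
        unfolding v2_def d2_def linear_series[OF linear_stacked, symmetric]
        by (rule spectral_norm_power_le_dilation[OF q])
      ultimately have "2 ^ q * (v1 ^ q + v2 ^ q) \<le> 2 ^ q * (b ^ q * d1 \<omega> + d2 \<omega>)"
        by (intro mult_left_mono) auto
      hence "2 * (v1 + v2) ^ q \<le> 2 ^ q * (b ^ q * d1 \<omega> + d2 \<omega>)"
        using power_sum_le[OF v, of q] by linarith
      hence "real CARD('p) * (2 * real q - 1) ^ q * (2 * (v1 + v2) ^ q)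
          \<le> real CARD('p) * (2 * real q - 1) ^ q * (2 ^ q * (b ^ q * d1 \<omega> + d2 \<omega>))"
        using q by (intro mult_left_mono) auto
      moreover have "w = (2 * real q - 1) * (v1 + v2)" by (simp add: w_def q')
      moreover have "x * (a * y) ^ q \<le> x * (2 * a) ^ q * z / 2"
        if "x * a ^ q * (2 * y ^ q) \<le> x * a ^ q * (2 ^ q * z)" for x a y z :: real
        using that by (simp add: power_mult_distrib mult_ac)
      ultimately show ?thesis unfolding K_def by metis
    qed
    finally show ?thesis by simp
  qed
  have "q * integral\<^sup>L M (s q) = (LINT \<omega>|M. q * T \<omega>)"
    unfolding T_def[abs_def] s_def[abs_def] unfolding q' expectation_chaos_power integral_mult_right_zero ..
  also have "\<dots> \<le> (LINT \<omega>|M. K * (b ^ q * d1 \<omega> + d2 \<omega>) / 2 + real q' * s q \<omega>)"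
  proof (rule integral_mono)
    show "integrable M (\<lambda>\<omega>. q * T \<omega>)" unfolding T_def
      by (rule integrable_polymap)
         (intro polymap_scale polymap_sum polymap_inner polymap_mult polymap_mpow polymap_chaos polymap_series
            polymap_const polymap_add polymap_linear[OF linear_ctranspose])
    show "integrable M (\<lambda>\<omega>. K * (b ^ q * d1 \<omega> + d2 \<omega>) / 2 + real q' * s q \<omega>)"
      using int_s int_d by simp
  qed (rule pt)
  also have "\<dots> = K * (b ^ q * integral\<^sup>L M d1 + integral\<^sup>L M d2) / 2 + real q' * integral\<^sup>L M (s q)"
    using int_s int_d by simp
  \<comment> \<open>The wanted moment has coefficient q on the left and q - 1 on the right, so
    exactly one copy remains.\<close>
  finally have "integral\<^sup>L M (s q) \<le> K * (b ^ q * integral\<^sup>L M d1 + integral\<^sup>L M d2) / 2"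
    by (simp add: q' algebra_simps)
  also have "\<dots> \<le> K * (b ^ q * (2 * real CARD('p) * odd_fact q * c ^ q) + 2 * real CARD('p) * odd_fact q * (b * c) ^ q) / 2"
    using E1 E2 K b by (intro divide_right_mono mult_left_mono add_mono) auto
  also have "\<dots> = 2 * (real CARD('p))\<^sup>2 * (2 * (2 * real q - 1)) ^ q * odd_fact q * (b * c) ^ q"
    by (simp add: K_def power_mult_distrib power2_eq_square algebra_simps)
  finally show ?thesis unfolding s_def[abs_def] .
qed

end

section \<open>The series attached to a family of matrices\<close>

definition coord_matrix :: "('p::finite \<Rightarrow> complex^'n^'m) \<Rightarrow> 'n \<Rightarrow> complex^'p^'m" where
  "coord_matrix B k = (\<chi> i j. B j $ i $ k)"

lemma column_matrix_eq_series:
  fixes B :: "'p::finite \<Rightarrow> complex^'n::finite^'m::finite"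
  shows "column_matrix B x = series (coord_matrix B) x"
  by (simp add: vec_eq_iff column_matrix_def series_def coord_matrix_def matrix_vector_mult_def
      scaleR_conv_of_real[where 'a = complex] mult.commute)

lemma gram_matrix_eq_gram_mean:
  fixes B :: "'p::finite \<Rightarrow> complex^'n::finite^'m::finite"
  shows "gram_matrix B = gram_mean (coord_matrix B)"
  by (simp add: vec_eq_iff gram_matrix_def gram_mean_def coord_matrix_def frobenius_inner_def trace_def
      matrix_matrix_mult_def)

lemma inner_gram_mean:
  fixes R :: "'n::finite \<Rightarrow> complex^'p::finite^'m::finite"
  shows "inner x (gram_mean R *v x) = (\<Sum>k\<in>UNIV. (norm (R k *v x))\<^sup>2)"
proof -
  have "inner x (gram_mean R *v x) = (\<Sum>k\<in>UNIV. inner x (ctranspose (R k) *v (R k *v x)))"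
    by (simp add: gram_mean_def sum_matrix_vector_mult inner_sum_right matrix_vector_mul_assoc)
  also have "\<dots> = (\<Sum>k\<in>UNIV. (norm (R k *v x))\<^sup>2)"
    by (simp only: inner_matrix_vector_mult[symmetric] power2_norm_eq_inner)
  finally show ?thesis .
qed

lemma sum_norm_le_gram_mean:
  fixes R :: "'n::finite \<Rightarrow> complex^'p::finite^'m::finite"
  shows "(\<Sum>k\<in>UNIV. (norm (R k *v x))\<^sup>2) \<le> spectral_norm (gram_mean R) * (norm x)\<^sup>2"
proof -
  have "inner x (gram_mean R *v x) \<le> norm x * norm (gram_mean R *v x)" by (rule norm_cauchy_schwarz)
  also have "\<dots> \<le> norm x * (spectral_norm (gram_mean R) * norm x)"
    by (intro mult_left_mono norm_le_spectral_norm) auto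
  finally show ?thesis by (simp add: inner_gram_mean power2_eq_square mult_ac)
qed

lemma norm_eq_sum_coord_matrix:
  fixes B :: "'p::finite \<Rightarrow> complex^'n::finite^'m::finite"
  shows "(norm (B j))\<^sup>2 = (\<Sum>k\<in>UNIV. (norm (coord_matrix B k *v axis j 1))\<^sup>2)"
proof -
  have "coord_matrix B k *v axis j 1 = column k (B j)" for k
    by (simp add: vec_eq_iff matrix_vector_mult_def coord_matrix_def column_def axis_def
        if_distrib[of "\<lambda>x. _ * x"] cong: if_cong)
  thus ?thesis by (simp add: norm_matrix_power2_columns)
qed

text \<open>The squared Frobenius norm of \<open>B j\<close> is the j-th diagonal entry of the Gram
  matrix, reached by testing on a basis vector.\<close>

lemma norm_le_spectral_gram_matrix:
  fixes B :: "'p::finite \<Rightarrow> complex^'n::finite^'m::finite"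
  shows "(norm (B j))\<^sup>2 \<le> spectral_norm (gram_matrix B)"
  using sum_norm_le_gram_mean[of "coord_matrix B" "axis j 1"]
  by (simp add: norm_eq_sum_coord_matrix gram_matrix_eq_gram_mean)

text \<open>Exchanging the indices \<open>k\<close> and \<open>j\<close> turns the row variance into
  the sum of \<open>B j ** ctranspose (B j)\<close>, so spectral norms of the \<open>B j\<close>
  replace their Frobenius norms.\<close>

lemma coord_matrix_row_bound:
  fixes B :: "'p::finite \<Rightarrow> complex^'n::finite^'m::finite"
  assumes b: "(\<Sum>j\<in>UNIV. (spectral_norm (B j))\<^sup>2) \<le> b"
  shows "(\<Sum>k\<in>UNIV. (norm (ctranspose (coord_matrix B k) *v z))\<^sup>2) \<le> b * (norm z)\<^sup>2"
proof -
  have "(ctranspose (coord_matrix B k) *v z) $ j = (ctranspose (B j) *v z) $ k" for k j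
    by (simp add: matrix_vector_mult_def coord_matrix_def)
  hence "(\<Sum>k\<in>UNIV. (norm (ctranspose (coord_matrix B k) *v z))\<^sup>2) = (\<Sum>j\<in>UNIV. (norm (ctranspose (B j) *v z))\<^sup>2)"
    unfolding norm_vec_power2 by (simp) (rule sum.swap)
  also have "\<dots> \<le> (\<Sum>j\<in>UNIV. (spectral_norm (B j))\<^sup>2 * (norm z)\<^sup>2)"
  proof (rule sum_mono)
    fix j
    have "norm (ctranspose (B j) *v z) \<le> spectral_norm (B j) * norm z"
      using norm_le_spectral_norm[of "ctranspose (B j)" z] spectral_norm_ctranspose_le[of "B j"]
        mult_right_mono[of _ _ "norm z"] norm_ge_zero order_trans by blast
    thus "(norm (ctranspose (B j) *v z))\<^sup>2 \<le> (spectral_norm (B j))\<^sup>2 * (norm z)\<^sup>2"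
      unfolding power_mult_distrib[symmetric] by (rule power_mono) simp
  qed
  also have "\<dots> \<le> b * (norm z)\<^sup>2" unfolding sum_distrib_right[symmetric] by (intro mult_right_mono b) simp
  finally show ?thesis .
qed

lemma norm_prod_index_power2:
  fixes z :: "complex^('n::finite \<times> 'p::finite)"
  shows "(norm z)\<^sup>2 = (\<Sum>l\<in>UNIV. (norm (\<chi> i. cnj (z $ (i, l))))\<^sup>2)"
  unfolding norm_vec_power2
  by (subst sum.swap) (simp add: sum.cartesian_product UNIV_Times_UNIV[symmetric] case_prod_beta del: UNIV_Times_UNIV)

text \<open>Regrouping the indices writes the left-hand side as \<Sum> |y j|^2, where
  \<open>y j\<close> sums \<open>ctranspose (B l) ** B j\<close> applied to slices of the conjugate
  of \<open>z\<close>. Cauchy-Schwarz over \<open>l\<close> gives one factor b, the sum over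
  \<open>j\<close> the other.\<close>

lemma coord_matrix_stacked_bound:
  fixes B :: "'p::finite \<Rightarrow> complex^'n::finite^'m::finite"
  assumes b: "(\<Sum>j\<in>UNIV. (spectral_norm (B j))\<^sup>2) \<le> b"
  shows "(\<Sum>k\<in>UNIV. (norm (ctranspose (stacked (coord_matrix B) (coord_matrix B k)) *v z))\<^sup>2) \<le> b\<^sup>2 * (norm z)\<^sup>2"
proof -
  define c where "c l = (\<chi> i. cnj (z $ (i, l)))" for l
  define y where "y j = (\<Sum>l\<in>UNIV. ctranspose (B l) *v (B j *v c l))" for j
  let ?S = "\<Sum>l\<in>UNIV. (spectral_norm (B l))\<^sup>2"
  have S: "0 \<le> ?S" by (intro sum_nonneg) simp
  have entry: "(ctranspose (stacked (coord_matrix B) (coord_matrix B k)) *v z) $ j = cnj (y j $ k)" for k j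
  proof -
    have "(ctranspose (stacked (coord_matrix B) (coord_matrix B k)) *v z) $ j
       = (\<Sum>a\<in>UNIV. (\<Sum>i\<in>UNIV. B (snd a) $ i $ k * cnj (B j $ i $ fst a)) * z $ a)"
      by (simp add: matrix_vector_mult_def stacked_def matrix_matrix_mult_def coord_matrix_def)
    also have "\<dots> = (\<Sum>l\<in>UNIV. \<Sum>i'\<in>UNIV. (\<Sum>i\<in>UNIV. B l $ i $ k * cnj (B j $ i $ i')) * z $ (i', l))"
      by (subst sum.swap) (simp add: sum.cartesian_product UNIV_Times_UNIV[symmetric] case_prod_beta del: UNIV_Times_UNIV)
    also have "\<dots> = (\<Sum>l\<in>UNIV. \<Sum>i\<in>UNIV. B l $ i $ k * (\<Sum>i'\<in>UNIV. cnj (B j $ i $ i') * z $ (i', l)))"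
      unfolding sum_distrib_left sum_distrib_right by (subst (2) sum.swap) (simp add: mult.assoc)
    also have "\<dots> = cnj (y j $ k)"
      by (simp add: y_def c_def matrix_vector_mult_def)
    finally show ?thesis .
  qed
  have y: "(norm (y j))\<^sup>2 \<le> (spectral_norm (B j))\<^sup>2 * (?S * (norm z)\<^sup>2)" for j
  proof -
    have "norm (y j) \<le> (\<Sum>l\<in>UNIV. norm (ctranspose (B l) *v (B j *v c l)))" unfolding y_def by (rule norm_sum)
    also have "\<dots> \<le> (\<Sum>l\<in>UNIV. spectral_norm (B l) * (spectral_norm (B j) * norm (c l)))"
    proof (rule sum_mono)
      fix l
      have "norm (ctranspose (B l) *v (B j *v c l)) \<le> spectral_norm (ctranspose (B l)) * norm (B j *v c l)"
        by (rule norm_le_spectral_norm)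
      also have "\<dots> \<le> spectral_norm (B l) * (spectral_norm (B j) * norm (c l))"
        by (intro mult_mono spectral_norm_ctranspose_le norm_le_spectral_norm) (auto simp: spectral_norm_nonneg)
      finally show "norm (ctranspose (B l) *v (B j *v c l)) \<le> spectral_norm (B l) * (spectral_norm (B j) * norm (c l))" .
    qed
    also have "\<dots> = spectral_norm (B j) * (\<Sum>l\<in>UNIV. \<bar>spectral_norm (B l)\<bar> * \<bar>norm (c l)\<bar>)"
      by (simp add: sum_distrib_left mult_ac spectral_norm_nonneg)
    also have "\<dots> \<le> spectral_norm (B j) * (L2_set (\<lambda>l. spectral_norm (B l)) UNIV * L2_set (\<lambda>l. norm (c l)) UNIV)"
      by (intro mult_left_mono L2_set_mult_ineq spectral_norm_nonneg)
    finally have "(norm (y j))\<^sup>2 \<le> (spectral_norm (B j) * (L2_set (\<lambda>l. spectral_norm (B l)) UNIV * L2_set (\<lambda>l. norm (c l)) UNIV))\<^sup>2"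
      by (rule power_mono) simp
    also have "\<dots> = (spectral_norm (B j))\<^sup>2 * (?S * (norm z)\<^sup>2)"
      unfolding norm_prod_index_power2[of z] by (simp add: power_mult_distrib L2_set_def sum_nonneg c_def)
    finally show ?thesis .
  qed
  have "(\<Sum>k\<in>UNIV. (norm (ctranspose (stacked (coord_matrix B) (coord_matrix B k)) *v z))\<^sup>2) = (\<Sum>j\<in>UNIV. (norm (y j))\<^sup>2)"
    unfolding norm_vec_power2 entry by simp (rule sum.swap)
  also have "\<dots> \<le> (\<Sum>j\<in>UNIV. (spectral_norm (B j))\<^sup>2 * (?S * (norm z)\<^sup>2))" by (intro sum_mono y)
  also have "\<dots> = ?S\<^sup>2 * (norm z)\<^sup>2" by (simp add: sum_distrib_right[symmetric] power2_eq_square)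
  also have "\<dots> \<le> b\<^sup>2 * (norm z)\<^sup>2" by (intro mult_right_mono power_mono b S) simp
  finally show ?thesis .
qed

section \<open>Bounds from the two condition numbers\<close>

lemma one_le_condition_number:
  fixes G :: "complex^'p::finite^'p"
  assumes "invertible G"
  shows "1 \<le> spectral_norm G * spectral_norm (matrix_inv G)"
proof -
  define e :: "complex^'p" where "e = axis undefined 1"
  have e: "norm e = 1" by (simp add: e_def)
  have "G ** matrix_inv G = mat 1"
    using someI_ex[OF assms[unfolded invertible_def]] by (simp add: matrix_inv_def)
  hence "e = G *v (matrix_inv G *v e)" by (simp add: matrix_vector_mul_assoc)
  hence "1 \<le> spectral_norm G * norm (matrix_inv G *v e)" using norm_le_spectral_norm[of G "matrix_inv G *v e"] e by simp
  also have "\<dots> \<le> spectral_norm G * (spectral_norm (matrix_inv G) * norm e)"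
    by (intro mult_left_mono norm_le_spectral_norm spectral_norm_nonneg)
  finally show ?thesis using e by simp
qed

lemma one_le_weak_condition_number:
  fixes A :: "complex^'n::finite^'m::finite"
  assumes "A \<noteq> 0" shows "1 \<le> weak_condition_number A"
proof -
  have "(norm A)\<^sup>2 = (norm (A ** mat 1))\<^sup>2" by simp
  also have "\<dots> \<le> (spectral_norm A * norm (mat 1 :: complex^'n^'n))\<^sup>2"
    by (intro power_mono norm_matrix_mult_le) simp
  also have "(norm (mat 1 :: complex^'n^'n))\<^sup>2 = real CARD('n)"
    by (rule norm_mat_1_power2)
  hence "(spectral_norm A * norm (mat 1 :: complex^'n^'n))\<^sup>2 = (spectral_norm A * sqrt (real CARD('n)))\<^sup>2"
    by (simp add: power_mult_distrib)
  finally have "norm A \<le> spectral_norm A * sqrt (real CARD('n))"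
    by (rule power2_le_imp_le) (simp add: spectral_norm_nonneg)
  thus ?thesis using assms by (simp add: weak_condition_number_def frobenius_norm_eq_norm field_simps)
qed

text \<open>The weak condition number compares n |B j|^2 with the squared Frobenius norm, which is a
  diagonal entry of the Gram matrix.\<close>

lemma spectral_norm_le_weak_condition_number:
  fixes B :: "'p::finite \<Rightarrow> complex^'n::finite^'m::finite"
  assumes "B j \<noteq> 0"
  shows "real CARD('n) * (spectral_norm (B j))\<^sup>2
    \<le> (weak_condition_number_family B)\<^sup>2 * spectral_norm (gram_matrix B)"
proof -
  have "weak_condition_number (B j) \<le> weak_condition_number_family B"
    unfolding weak_condition_number_family_def by (rule Max_ge) auto
  hence "spectral_norm (B j) * sqrt (real CARD('n)) \<le> weak_condition_number_family B * norm (B j)"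
    using assms by (simp add: weak_condition_number_def frobenius_norm_eq_norm field_simps)
  hence "(spectral_norm (B j) * sqrt (real CARD('n)))\<^sup>2 \<le> (weak_condition_number_family B * norm (B j))\<^sup>2"
    by (rule power_mono) (simp add: spectral_norm_nonneg)
  also have "\<dots> \<le> (weak_condition_number_family B)\<^sup>2 * spectral_norm (gram_matrix B)"
    unfolding power_mult_distrib by (intro mult_left_mono norm_le_spectral_gram_matrix) simp
  finally show ?thesis by (simp add: power_mult_distrib mult.commute)
qed

section \<open>Double factorials and explicit constants\<close>

lemma one_plus_power_ge_quadratic:
  fixes x :: real
  assumes "x \<ge> 0"
  shows "1 + real n * x + real n * (real n - 1) / 2 * x\<^sup>2 \<le> (1 + x) ^ n"
proof (induction n)
  case (Suc n)
  have "real n * (real n - 1) / 2 * x\<^sup>2 * x \<ge> 0"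
    using assms by (cases n) auto
  hence "1 + real (Suc n) * x + real (Suc n) * (real (Suc n) - 1) / 2 * x\<^sup>2
     \<le> (1 + x) * (1 + real n * x + real n * (real n - 1) / 2 * x\<^sup>2)"
    by (simp add: field_simps power2_eq_square)
  also have "\<dots> \<le> (1 + x) * (1 + x) ^ n" using assms by (intro mult_left_mono Suc) auto
  finally show ?case by simp
qed simp

text \<open>The base \<open>8 / 9\<close> replaces the sharp \<open>2 / e\<close> of Stirling's formula: it is what
  \<open>(1 + 1 / q) ^ q \<ge> 9 / 4\<close> for \<open>q \<ge> 2\<close> yields.\<close>

lemma odd_fact_le: "odd_fact (Suc q) \<le> 9 / 8 * (8 / 9 * real (Suc q)) ^ Suc q"
proof (induction q)
  \<comment> \<open>The prefactor 9/8 makes the estimate an equality here.\<close>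
  case 0 show ?case by (simp add: odd_fact_def)
next
  case (Suc q)
  show ?case
  proof (cases "q = 0")
    \<comment> \<open>Checked directly, since (1 + 1/1)^1 = 2 is below 9/4.\<close>
    case True thus ?thesis by (simp add: odd_fact_def power2_eq_square numeral_2_eq_2)
  next
    case False
    define n where "n = Suc q"
    have n: "n \<ge> 2" using False by (simp add: n_def)
    have "9 / 4 \<le> 1 + real n * (1 / n) + real n * (real n - 1) / 2 * (1 / n)\<^sup>2"
      using n by (simp add: field_simps power2_eq_square)
    also have "\<dots> \<le> (1 + 1 / n) ^ n" by (rule one_plus_power_ge_quadratic) simp
    finally have "(9 / 4) * real n ^ n \<le> (1 + 1 / n) ^ n * real n ^ n" by (intro mult_right_mono) auto
    also have "\<dots> = (real n + 1) ^ n" using n by (simp add: power_mult_distrib[symmetric] field_simps)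
    finally have *: "(9 / 4) * real n ^ n \<le> (real n + 1) ^ n" .
    have "odd_fact (Suc n) \<le> 9 / 8 * (8 / 9 * real n) ^ n * (2 * real n + 1)"
      using Suc unfolding n_def[symmetric] odd_fact_Suc[of n] by (intro mult_right_mono) auto
    also have "\<dots> \<le> 9 / 8 * (8 / 9 * real n) ^ n * (2 * (real n + 1))"
      by (intro mult_left_mono) auto
    also have "\<dots> = 9 / 8 * (8 / 9) ^ n * (8 / 9) * (real n + 1) * ((9 / 4) * real n ^ n)"
      unfolding power_mult_distrib by simp
    also have "\<dots> \<le> 9 / 8 * (8 / 9) ^ n * (8 / 9) * (real n + 1) * (real n + 1) ^ n"
      by (intro mult_left_mono *) auto
    also have "\<dots> = 9 / 8 * (8 / 9 * real (Suc n)) ^ Suc n"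
      unfolding power_mult_distrib by (simp add: add.commute)
    finally show ?thesis by (simp only: n_def)
  qed
qed

text \<open>The column variance \<nu> is enlarged to 9/4 \<nu> so that it dominates \<nu> / l^2 for
  every l \<ge> 2/3. The constants then combine as 4 * 8/9 * 9/4 = 8 and 2 * 9/8 = 9/4; the base 8
  is what matches \<open>C\<^sub>1 = sqrt 2\<close>.\<close>

lemma (in gaussian_moments) family_chaos_moment:
  fixes B :: "'p::finite \<Rightarrow> complex^'n^'m::finite"
  assumes b: "(\<Sum>j\<in>UNIV. (spectral_norm (B j))\<^sup>2) \<le> \<nu> / l\<^sup>2"
    and \<nu>: "\<nu> = spectral_norm (gram_matrix B)" and l: "2 / 3 \<le> l" and q: "q > 0"
  shows "(LINT \<omega>|M. (norm (mpow (chaos (coord_matrix B) (uvec \<omega>)) q))\<^sup>2)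
    \<le> 9 / 4 * (real CARD('p))\<^sup>2 * (8 * (q * \<nu> / l)\<^sup>2) ^ q"
proof -
  have \<nu>0: "\<nu> \<ge> 0" by (simp add: \<nu> spectral_norm_nonneg)
  have "(2 / 3)\<^sup>2 \<le> l\<^sup>2" using l by (intro power_mono) auto
  hence l2: "4 / 9 \<le> l\<^sup>2" by (simp add: power2_eq_square)
  have "4 / 9 * \<nu> \<le> l\<^sup>2 * \<nu>" by (rule mult_right_mono[OF l2 \<nu>0])
  hence bc: "\<nu> / l\<^sup>2 \<le> 9 / 4 * \<nu>" using l by (simp add: field_simps)
  have "(LINT \<omega>|M. (norm (mpow (chaos (coord_matrix B) (uvec \<omega>)) q))\<^sup>2)
    \<le> 2 * (real CARD('p))\<^sup>2 * (2 * (2 * real q - 1)) ^ q * odd_fact q * (\<nu> / l\<^sup>2 * (9 / 4 * \<nu>)) ^ q"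
  proof (rule chaos_moment)
    show "(\<Sum>k\<in>UNIV. (norm (coord_matrix B k *v x))\<^sup>2) \<le> 9 / 4 * \<nu> * (norm x)\<^sup>2" for x
    proof -
      have "(\<Sum>k\<in>UNIV. (norm (coord_matrix B k *v x))\<^sup>2) \<le> \<nu> * (norm x)\<^sup>2"
        unfolding \<nu> gram_matrix_eq_gram_mean by (rule sum_norm_le_gram_mean)
      also have "\<dots> \<le> 9 / 4 * \<nu> * (norm x)\<^sup>2" using \<nu>0 by (intro mult_right_mono) auto
      finally show ?thesis .
    qed
  qed (rule coord_matrix_row_bound[OF b] coord_matrix_stacked_bound[OF b] bc q | use \<nu>0 in simp)+
  also have "\<dots> \<le> 2 * (real CARD('p))\<^sup>2 * (4 * real q) ^ q * (9 / 8 * (8 / 9 * real q) ^ q) * (\<nu> / l\<^sup>2 * (9 / 4 * \<nu>)) ^ q"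
  proof -
    have "(2 * (2 * real q - 1)) ^ q \<le> (4 * real q) ^ q" using q by (intro power_mono) auto
    moreover have "0 \<le> (2 * (2 * real q - 1)) ^ q" using q by simp
    moreover have "odd_fact q \<le> 9 / 8 * (8 / 9 * real q) ^ q" using odd_fact_le[of "q - 1"] q by simp
    moreover have "0 \<le> (\<nu> / l\<^sup>2 * (9 / 4 * \<nu>)) ^ q" using \<nu>0 by simp
    ultimately show ?thesis using odd_fact_pos[of q]
      by (intro mult_right_mono mult_mono) auto
  qed
  also have "\<dots> = 9 / 4 * (real CARD('p))\<^sup>2 * ((4 * real q) * (8 / 9 * real q) * (\<nu> / l\<^sup>2 * (9 / 4 * \<nu>))) ^ q"
    unfolding power_mult_distrib[of "(4 * real q) * (8 / 9 * real q)"] power_mult_distrib[of "4 * real q" "8 / 9 * real q"]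
    by (simp only: mult_ac)
  also have "(4 * real q) * (8 / 9 * real q) * (\<nu> / l\<^sup>2 * (9 / 4 * \<nu>)) = 8 * (q * \<nu> / l)\<^sup>2"
    by (simp add: power2_eq_square)
  finally show ?thesis .
qed

section \<open>Comparison of Rademacher and Gaussian moments\<close>

lemma series_gram:
  fixes R :: "'n::finite \<Rightarrow> complex^'p::finite^'m::finite"
  shows "ctranspose (series R x) ** series R x
    = (\<Sum>i\<in>UNIV. \<Sum>k\<in>UNIV. (x i * x k) *\<^sub>R (ctranspose (R i) ** R k))"
  unfolding linear_series[OF linear_ctranspose] unfolding series_def
  by (subst sum.swap)
     (simp add: sum_matrix_mult matrix_mult_sum scaleR_matrix_mult scaleR_sum_right mult.commute)

lemma (in poly_moments) expectation_series_gram: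
  fixes R :: "'n \<Rightarrow> complex^'p::finite^'m::finite"
  shows "(LINT \<omega>|M. ctranspose (series R (uvec \<omega>)) ** series R (uvec \<omega>))
    = (\<Sum>i\<in>UNIV. \<Sum>k\<in>UNIV. (LINT \<omega>|M. u i \<omega> * u k \<omega>) *\<^sub>R (ctranspose (R i) ** R k))"
proof -
  have int: "integrable M (\<lambda>\<omega>. u i \<omega> * u k \<omega>)" for i k
    using integrable_polymap[OF polymap_var[OF polymap_coord]] by simp
  show ?thesis unfolding series_gram using int by simp
qed

lemma (in poly_moments) expectation_gram_orthonormal:
  fixes R :: "'n \<Rightarrow> complex^'p::finite^'m::finite"
  assumes "\<And>i k. (LINT \<omega>|M. u i \<omega> * u k \<omega>) = (if i = k then 1 else 0)"
  shows "(LINT \<omega>|M. ctranspose (series R (uvec \<omega>)) ** series R (uvec \<omega>)) = gram_mean R"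
  unfolding expectation_series_gram assms gram_mean_def
  by (simp add: if_distrib[of "\<lambda>c. c *\<^sub>R _"] cong: if_cong)

lemma (in gaussian_moments) expectation_mult:
  "(LINT \<omega>|M. u i \<omega> * u k \<omega>) = (if i = k then 1 else 0)"
proof -
  have "polymap_deriv i (\<lambda>x. x k *\<^sub>R (1::real)) (\<lambda>x. (if i = k then 1 else 0) + x k *\<^sub>R 0)"
    by (intro deriv_var deriv_const)
  from gaussian_ibp[OF this] show ?thesis by (simp add: prob_space)
qed

section \<open>Gaussian product space and absolute values\<close>

text \<open>An auxiliary space: the comparison is made for each fixed sign vector, so no common
  space carrying both the Gaussian and the Rademacher sequence is formed.\<close>

definition gauss_space :: "('n::finite \<Rightarrow> real) measure" where
  "gauss_space = PiM UNIV (\<lambda>_. density lborel std_normal_density)"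

lemma product_sigma_finite_gauss: "product_sigma_finite (\<lambda>_. density lborel std_normal_density)"
  unfolding product_sigma_finite_def
  by (auto intro!: finite_measure.sigma_finite_measure prob_space.finite_measure prob_space_normal_density)

lemma prob_space_gauss_space: "prob_space gauss_space"
  unfolding gauss_space_def by (intro prob_space_PiM prob_space_normal_density) simp

lemma integrable_integral_std_normal:
  fixes f :: "real \<Rightarrow> real"
  assumes "f \<in> borel_measurable borel"
  shows "integrable (density lborel std_normal_density) f \<longleftrightarrow> integrable lborel (\<lambda>x. std_normal_density x * f x)"
    "integral\<^sup>L (density lborel std_normal_density) f = (LINT x|lborel. std_normal_density x * f x)"
  using assms by (auto simp: integrable_density integral_density)

lemma gauss_space_product:
  fixes f :: "'n::finite \<Rightarrow> real \<Rightarrow> real"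
  assumes "\<And>k. f k \<in> borel_measurable borel" "\<And>k. integrable lborel (\<lambda>x. std_normal_density x * f k x)"
  shows "integrable gauss_space (\<lambda>\<omega>. \<Prod>k\<in>UNIV. f k (\<omega> k))"
    "(LINT \<omega>|gauss_space. (\<Prod>k\<in>UNIV. f k (\<omega> k))) = (\<Prod>k\<in>UNIV. LINT x|lborel. std_normal_density x * f k x)"
  unfolding gauss_space_def
  by (rule product_sigma_finite.product_integrable_prod[OF product_sigma_finite_gauss];
      simp add: integrable_integral_std_normal assms)
     (subst product_sigma_finite.product_integral_prod[OF product_sigma_finite_gauss];
      simp add: integrable_integral_std_normal assms)

lemma power_sign_mult: "(s::real) \<in> {1, -1} \<Longrightarrow> s ^ a * normal_moment a = normal_moment a"
  by (cases "even a") (auto simp: normal_moment_odd)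

lemma gaussian_moments_sign:
  fixes s :: "'n::finite \<Rightarrow> real"
  assumes "\<And>k. s k \<in> {1, -1}"
  shows "gaussian_moments gauss_space (\<lambda>k \<omega>. s k * \<omega> k)"
proof -
  have eq: "std_normal_density x * (s k * x) ^ a = s k ^ a * (std_normal_density x * x ^ a)" for x k a
    by (simp add: power_mult_distrib)
  have int: "integrable lborel (\<lambda>x. std_normal_density x * (s k * x) ^ a)" for k a
    unfolding eq by (intro integrable_mult_right integrable_std_normal_moment)
  show ?thesis
  proof (intro gaussian_moments.intro poly_moments.intro poly_moments_axioms.intro gaussian_moments_axioms.intro
      prob_space_gauss_space)
    fix a :: "'n \<Rightarrow> nat"
    show "integrable gauss_space (\<lambda>\<omega>. monomial a (\<lambda>k. s k * \<omega> k))"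
      unfolding monomial_def by (rule gauss_space_product(1)[of "\<lambda>k x. (s k * x) ^ a k"]) (auto intro: int)
    have "(LINT \<omega>|gauss_space. monomial a (\<lambda>k. s k * \<omega> k))
      = (\<Prod>k\<in>UNIV. LINT x|lborel. std_normal_density x * (s k * x) ^ a k)"
      unfolding monomial_def by (rule gauss_space_product(2)[of "\<lambda>k x. (s k * x) ^ a k"]) (auto intro: int)
    thus "(LINT \<omega>|gauss_space. monomial a (\<lambda>k. s k * \<omega> k)) = (\<Prod>k\<in>UNIV. normal_moment (a k))"
      unfolding eq by (simp add: normal_moment_def[symmetric] power_sign_mult[OF assms])
  qed
qed

lemma poly_moments_abs:
  fixes s :: "'n::finite \<Rightarrow> real"
  shows "poly_moments gauss_space (\<lambda>k \<omega>. s k * \<bar>\<omega> k\<bar>)"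
proof (intro poly_moments.intro poly_moments_axioms.intro prob_space_gauss_space)
  fix a :: "'n \<Rightarrow> nat"
  have eq: "std_normal_density x * (s k * \<bar>x\<bar>) ^ a = s k ^ a * (std_normal_density x * \<bar>x\<bar> ^ a)" for x k a
    by (simp add: power_mult_distrib)
  have "integrable lborel (\<lambda>x. std_normal_density x * (s k * \<bar>x\<bar>) ^ a)" for k a
    unfolding eq by (intro integrable_mult_right integrable_std_normal_moment_abs)
  thus "integrable gauss_space (\<lambda>\<omega>. monomial a (\<lambda>k. s k * \<bar>\<omega> k\<bar>))"
    unfolding monomial_def by (intro gauss_space_product(1)[of "\<lambda>k x. (s k * \<bar>x\<bar>) ^ a k"]) auto
qed

lemma expectation_abs_mult:
  fixes i k :: "'n::finite"
  shows "(LINT \<omega>|gauss_space. \<bar>\<omega> i\<bar> * \<bar>\<omega> k\<bar>) = (if i = k then 1 else 2 / pi)"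
proof (cases "i = k")
  case True
  interpret gaussian_moments "gauss_space :: ('n \<Rightarrow> real) measure" "\<lambda>k \<omega>. 1 * \<omega> k"
    by (rule gaussian_moments_sign) simp
  show ?thesis using True expectation_mult[of k k] by simp
next
  case False
  \<comment> \<open>Exponent 1 at the two distinct indices and 0 elsewhere, so the expectation
    factors into two copies of sqrt (2 / pi).\<close>
  define a where "a l = (if l = i \<or> l = k then 1 else 0 :: nat)" for l
  have eq: "(\<Prod>l\<in>UNIV. f l) = f i * f k * (\<Prod>l\<in>UNIV - {i} - {k}. f l)" for f :: "'n \<Rightarrow> real"
    using False by (subst prod.remove[of _ i], simp, simp, subst prod.remove[of _ k]) auto
  have "(LINT \<omega>|gauss_space. \<bar>\<omega> i\<bar> * \<bar>\<omega> k\<bar>) = (LINT \<omega>|gauss_space. (\<Prod>l\<in>UNIV. \<bar>\<omega> l\<bar> ^ a l))"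
    unfolding eq by (simp add: a_def)
  also have "\<dots> = (\<Prod>l\<in>UNIV. LINT x|lborel. std_normal_density x * \<bar>x\<bar> ^ a l)"
    by (rule gauss_space_product) (auto intro: integrable_std_normal_moment_abs)
  also have "\<dots> = (LINT x|lborel. std_normal_density x * \<bar>x\<bar>) * (LINT x|lborel. std_normal_density x * \<bar>x\<bar>)"
    using integral_std_normal_moment_even[of 0] unfolding eq by (simp add: a_def)
  also have "\<dots> = 2 / pi"
  proof -
    have "(LINT x|lborel. std_normal_density x * \<bar>x\<bar>) = sqrt (2 / pi)"
      using integral_std_normal_moment_abs_odd[of 0] by simp
    thus ?thesis by (simp only: real_sqrt_mult_self) simp
  qed
  finally show ?thesis using False by simp
qed

text \<open>Off the diagonal the absolute values contribute 2 / pi, on the diagonal they contribute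
  1. For signs, however, the diagonal part is the constant \<open>gram_mean R\<close>, which
  centring removes, so the factor 2 / pi applies to the whole chaos.\<close>

lemma expectation_chaos_abs:
  fixes R :: "'n::finite \<Rightarrow> complex^'p::finite^'m::finite"
  assumes s: "\<And>k. s k \<in> {1, -1}"
  shows "(LINT \<omega>|gauss_space. chaos R (\<lambda>k. s k * \<bar>\<omega> k\<bar>)) = (2 / pi) *\<^sub>R chaos R s"
proof -
  interpret poly_moments gauss_space "\<lambda>k \<omega>. s k * \<bar>\<omega> k\<bar>" by (rule poly_moments_abs)
  let ?G = "\<lambda>i k. ctranspose (R i) ** R k"
  have E: "(LINT \<omega>|gauss_space. s i * \<bar>\<omega> i\<bar> * (s k * \<bar>\<omega> k\<bar>))
     = (2 / pi) * (s i * s k) + (if i = k then 1 - 2 / pi else 0)" for i k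
  proof -
    have "(LINT \<omega>|gauss_space. s i * \<bar>\<omega> i\<bar> * (s k * \<bar>\<omega> k\<bar>)) = (LINT \<omega>|gauss_space. (s i * s k) * (\<bar>\<omega> i\<bar> * \<bar>\<omega> k\<bar>))"
      by (simp add: mult_ac)
    also have "\<dots> = (s i * s k) * (if i = k then 1 else 2 / pi)"
      by (simp only: integral_mult_right_zero expectation_abs_mult)
    finally show ?thesis using s[of i] s[of k] by auto
  qed
  have int: "integrable gauss_space (\<lambda>\<omega>. ctranspose (series R (\<lambda>k. s k * \<bar>\<omega> k\<bar>)) ** series R (\<lambda>k. s k * \<bar>\<omega> k\<bar>))"
    by (rule integrable_polymap) (intro polymap_mult polymap_linear[OF linear_ctranspose] polymap_series)
  have "(LINT \<omega>|gauss_space. chaos R (\<lambda>k. s k * \<bar>\<omega> k\<bar>))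
      = (\<Sum>i\<in>UNIV. \<Sum>k\<in>UNIV. ((2 / pi) * (s i * s k) + (if i = k then 1 - 2 / pi else 0)) *\<^sub>R ?G i k) - gram_mean R"
    unfolding chaos_def using int expectation_series_gram[of R] by (simp add: E prob_space)
  also have "(\<Sum>i\<in>UNIV. \<Sum>k\<in>UNIV. ((2 / pi) * (s i * s k) + (if i = k then 1 - 2 / pi else 0)) *\<^sub>R ?G i k)
      = (2 / pi) *\<^sub>R (\<Sum>i\<in>UNIV. \<Sum>k\<in>UNIV. (s i * s k) *\<^sub>R ?G i k) + (1 - 2 / pi) *\<^sub>R gram_mean R"
    unfolding gram_mean_def scaleR_sum_right scaleR_add_left sum.distrib
    by (simp add: if_distrib[of "\<lambda>c. c *\<^sub>R _"] cong: if_cong)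
  also have "(\<Sum>i\<in>UNIV. \<Sum>k\<in>UNIV. (s i * s k) *\<^sub>R ?G i k) = ctranspose (series R s) ** series R s"
    by (rule series_gram[symmetric])
  finally show ?thesis by (simp add: chaos_def scaleR_diff_right scaleR_diff_left)
qed

text \<open>Scalar Jensen suffices: for each unit vector \<open>v\<close>, the norm of the image is
  read off by one linear functional of the chaos, whose even power is dominated by the trace
  power.\<close>

lemma rademacher_chaos_le:
  fixes R :: "'n::finite \<Rightarrow> complex^'p::finite^'m::finite"
  assumes s: "\<And>k. s k \<in> {1, -1}" and q: "q > 0"
  shows "(2 / pi) ^ (2 * q) * spectral_norm (chaos R s) ^ (2 * q)
    \<le> (LINT \<omega>|gauss_space. (norm (mpow (chaos R (\<lambda>k. s k * \<bar>\<omega> k\<bar>)) q))\<^sup>2)"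
proof -
  interpret poly_moments gauss_space "\<lambda>k \<omega>. s k * \<bar>\<omega> k\<bar>" by (rule poly_moments_abs)
  define D where "D = (LINT \<omega>|gauss_space. (norm (mpow (chaos R (uvec \<omega>)) q))\<^sup>2)"
  have intF: "integrable gauss_space (\<lambda>\<omega>. (norm (mpow (chaos R (uvec \<omega>)) q))\<^sup>2)"
    by (rule integrable_polymap) (intro polymap_norm_power2 polymap_mpow polymap_chaos)
  have "spectral_norm (chaos R s) ^ (2 * q) \<le> (pi / 2) ^ (2 * q) * D"
  proof (rule spectral_norm_power_le)
    fix v :: "complex^'p" assume v: "norm v = 1"
    define z where "z = chaos R s *v v"
    \<comment> \<open>For z = 0 this is 0 by the division convention, which is why only
      \<open>norm w \<le> 1\<close> is claimed.\<close>
    define w where "w = (1 / norm z) *\<^sub>R z"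
    have w: "norm w \<le> 1" "inner w z = norm z"
      by (auto simp: w_def power2_norm_eq_inner[symmetric] power2_eq_square)
    define y where "y \<omega> = inner w (chaos R (uvec \<omega>) *v v)" for \<omega>
    have pm_y: "polymap (\<lambda>x. inner w (chaos R x *v v))"
      by (intro polymap_inner polymap_const polymap_linear[OF linear_matrix_vector_mult_left] polymap_chaos)
    have int_y: "integrable gauss_space y" unfolding y_def by (rule integrable_polymap[OF pm_y])
    have y_le: "y \<omega> ^ (2 * q) \<le> (norm (mpow (chaos R (uvec \<omega>)) q))\<^sup>2" for \<omega>
    proof -
      have "\<bar>y \<omega>\<bar> \<le> norm w * norm (chaos R (uvec \<omega>) *v v)" unfolding y_def by (rule Cauchy_Schwarz_ineq2)
      also have "\<dots> \<le> norm (chaos R (uvec \<omega>) *v v)" using mult_right_mono[OF w(1)] by simp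
      finally have "\<bar>y \<omega>\<bar> ^ (2 * q) \<le> norm (chaos R (uvec \<omega>) *v v) ^ (2 * q)" by (rule power_mono) simp
      also have "\<dots> \<le> (norm (mpow (chaos R (uvec \<omega>)) q))\<^sup>2"
        by (rule norm_vector_power_le_mpow[OF ctranspose_chaos v])
      finally show ?thesis by (simp add: power_even_abs)
    qed
    have int_yq: "integrable gauss_space (\<lambda>\<omega>. y \<omega> ^ (2 * q))"
      using y_le int_y by (intro Bochner_Integration.integrable_bound[OF intF]) (auto simp: zero_le_even_power)
    have int_c: "integrable gauss_space (\<lambda>\<omega>. chaos R (uvec \<omega>))" by (rule integrable_polymap[OF polymap_chaos])
    have blin: "bounded_linear (\<lambda>A. inner w (A *v v))" for A :: "complex^'p^'p"
      by (rule linear_conv_bounded_linear[THEN iffD1])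
         (auto intro!: linearI simp: inner_add_right matrix_vector_mult_add_rdistrib scaleR_matrix_vector_mult)
    have "(2 / pi) * norm z = inner w (((2 / pi) *\<^sub>R chaos R s) *v v)"
      by (simp add: scaleR_matrix_vector_mult z_def[symmetric] w)
    also have "\<dots> = integral\<^sup>L gauss_space y"
      unfolding expectation_chaos_abs[OF s, symmetric] y_def
      by (rule integral_bounded_linear[OF blin int_c, symmetric])
    finally have "((2 / pi) * norm z) ^ (2 * q) = (integral\<^sup>L gauss_space y) ^ (2 * q)" by simp
    also have "\<dots> \<le> (LINT \<omega>|gauss_space. y \<omega> ^ (2 * q))"
      by (rule jensens_inequality[where I = UNIV and q = "\<lambda>x. x ^ (2 * q)"]) (auto simp: int_y int_yq intro: convex_power_even)
    also have "\<dots> \<le> D" unfolding D_def by (rule integral_mono[OF int_yq intF y_le])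
    finally have "(pi / 2) ^ (2 * q) * ((2 / pi) * norm z) ^ (2 * q) \<le> (pi / 2) ^ (2 * q) * D"
      by (intro mult_left_mono) auto
    thus "norm (chaos R s *v v) ^ (2 * q) \<le> (pi / 2) ^ (2 * q) * D"
      unfolding power_mult_distrib[symmetric] z_def by simp
  qed (use q in simp)
  hence "(2 / pi) ^ (2 * q) * spectral_norm (chaos R s) ^ (2 * q) \<le> (2 / pi) ^ (2 * q) * ((pi / 2) ^ (2 * q) * D)"
    by (intro mult_left_mono) auto
  also have "\<dots> = ((2 / pi) * (pi / 2)) ^ (2 * q) * D" by (simp only: power_mult_distrib mult.assoc)
  finally show ?thesis by (simp add: D_def)
qed

section \<open>Averaging over sign vectors\<close>

definition signs :: "('n::finite \<Rightarrow> real) set" where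
  "signs = {s. \<forall>k. s k \<in> {1, -1}}"

lemma signs_eq_PiE: "signs = PiE UNIV (\<lambda>_. {1, -1})"
  by (auto simp: signs_def PiE_UNIV_domain)

lemma finite_signs: "finite (signs :: ('n::finite \<Rightarrow> real) set)"
  unfolding signs_eq_PiE by (intro finite_PiE) auto

lemma card_signs: "card (signs :: ('n::finite \<Rightarrow> real) set) = 2 ^ CARD('n)"
  unfolding signs_eq_PiE by (subst card_PiE) (auto simp: numeral_2_eq_2)

text \<open>Multiplying coordinatewise by the signs of \<open>x\<close> is an involution of
  \<open>signs\<close>; a zero coordinate may take either sign. After averaging over signs the
  absolute values therefore disappear.\<close>

lemma sum_signs_abs:
  fixes F :: "('n::finite \<Rightarrow> real) \<Rightarrow> 'v::comm_monoid_add"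
  shows "(\<Sum>s\<in>signs. F (\<lambda>k. s k * \<bar>x k\<bar>)) = (\<Sum>s\<in>signs. F (\<lambda>k. s k * x k))"
proof (rule sum.reindex_bij_witness[where i = "\<lambda>s k. s k * (if x k < 0 then -1 else 1)"
      and j = "\<lambda>s k. s k * (if x k < 0 then -1 else 1)"])
  show "F (\<lambda>k. s k * (if x k < 0 then - 1 else 1) * x k) = F (\<lambda>k. s k * \<bar>x k\<bar>)" for s
    by (rule arg_cong[where f = F]) (auto simp: fun_eq_iff)
qed (auto simp: signs_def fun_eq_iff)

text \<open>Once the absolute values are gone, each summand is an expectation for signed Gaussians,
  which again have Gaussian moments, so the bound \<open>D\<close> holds for each of the 2^n sign
  vectors.\<close>

lemma rademacher_sum_le:
  fixes R :: "'n::finite \<Rightarrow> complex^'p::finite^'m::finite"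
  assumes q: "q > 0"
    and D: "\<And>u :: 'n \<Rightarrow> ('n \<Rightarrow> real) \<Rightarrow> real. gaussian_moments gauss_space u \<Longrightarrow>
      (LINT \<omega>|gauss_space. (norm (mpow (chaos R (\<lambda>k. u k \<omega>)) q))\<^sup>2) \<le> D"
  shows "(2 / pi) ^ (2 * q) * (\<Sum>s\<in>signs. spectral_norm (chaos R s) ^ (2 * q)) \<le> 2 ^ CARD('n) * D"
proof -
  let ?F = "\<lambda>x. (norm (mpow (chaos R x) q))\<^sup>2"
  have pm: "polymap ?F" by (intro polymap_norm_power2 polymap_mpow polymap_chaos)
  have "(2 / pi) ^ (2 * q) * (\<Sum>s\<in>signs. spectral_norm (chaos R s) ^ (2 * q))
      \<le> (\<Sum>s\<in>signs. LINT \<omega>|gauss_space. ?F (\<lambda>k. s k * \<bar>\<omega> k\<bar>))"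
    unfolding sum_distrib_left by (intro sum_mono rademacher_chaos_le q) (auto simp: signs_def)
  also have "\<dots> = (LINT \<omega>|gauss_space. (\<Sum>s\<in>signs. ?F (\<lambda>k. s k * \<bar>\<omega> k\<bar>)))"
    by (rule Bochner_Integration.integral_sum[symmetric])
       (rule poly_moments.integrable_polymap[OF poly_moments_abs pm])
  also have "\<dots> = (LINT \<omega>|gauss_space. (\<Sum>s\<in>signs. ?F (\<lambda>k. s k * \<omega> k)))"
    by (intro Bochner_Integration.integral_cong refl sum_signs_abs)
  also have "\<dots> = (\<Sum>s\<in>signs. LINT \<omega>|gauss_space. ?F (\<lambda>k. s k * \<omega> k))"
  proof (rule Bochner_Integration.integral_sum)
    fix s :: "'n \<Rightarrow> real" assume "s \<in> signs"
    then interpret gaussian_moments gauss_space "\<lambda>k \<omega>. s k * \<omega> k"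
      by (intro gaussian_moments_sign) (auto simp: signs_def)
    show "integrable gauss_space (\<lambda>\<omega>. ?F (\<lambda>k. s k * \<omega> k))" by (rule integrable_polymap[OF pm])
  qed
  also have "\<dots> \<le> (\<Sum>s\<in>(signs :: ('n \<Rightarrow> real) set). D)"
  proof (rule sum_mono)
    fix s :: "'n \<Rightarrow> real" assume "s \<in> signs"
    hence "gaussian_moments gauss_space (\<lambda>k \<omega>. s k * \<omega> k)"
      by (intro gaussian_moments_sign) (auto simp: signs_def)
    thus "(LINT \<omega>|gauss_space. ?F (\<lambda>k. s k * \<omega> k)) \<le> D" by (rule D)
  qed
  finally show ?thesis by (simp add: card_signs)
qed

section \<open>Law and moments of a Rademacher sequence\<close>

lemma (in prob_space) rademacher_AE:
  assumes "rademacher_sequence u"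
  shows "AE \<omega> in M. u i \<omega> \<in> {1, -1}"
proof -
  have m: "u i \<in> borel_measurable M"
    using assms unfolding rademacher_sequence_def indep_vars_def by auto
  have e: "{\<omega>\<in>space M. u i \<omega> \<in> {1, -1}} = {\<omega>\<in>space M. u i \<omega> = 1} \<union> {\<omega>\<in>space M. u i \<omega> = -1}" by auto
  have s: "{\<omega>\<in>space M. u i \<omega> = c} \<in> events" for c using m by measurable
  have p: "prob {\<omega>\<in>space M. u i \<omega> = 1} = 1 / 2" "prob {\<omega>\<in>space M. u i \<omega> = -1} = 1 / 2"
    using assms by (simp_all only: rademacher_sequence_def)
  have "prob {\<omega>\<in>space M. u i \<omega> \<in> {1, -1}} = 1"
    unfolding e by (subst finite_measure_Union) (auto simp: s p)
  thus ?thesis using prob_eq_1[of "{\<omega>\<in>space M. u i \<omega> \<in> {1, -1}}"] s e by auto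
qed

lemma (in prob_space) rademacher_imp_poly_moments:
  fixes u :: "'n::finite \<Rightarrow> 'a \<Rightarrow> real"
  assumes rad: "rademacher_sequence u"
  shows "poly_moments M u" "\<And>i k. (LINT \<omega>|M. u i \<omega> * u k \<omega>) = (if i = k then 1 else 0)"
proof -
  have m: "u i \<in> borel_measurable M" for i
    using rad unfolding rademacher_sequence_def indep_vars_def by auto
  have int: "integrable M (\<lambda>\<omega>. u i \<omega> ^ a)" for i a
  proof (rule integrable_const_bound[where B = 1])
    show "AE \<omega> in M. norm (u i \<omega> ^ a) \<le> 1"
      using rademacher_AE[OF rad, of i] by eventually_elim (auto simp: power_abs)
  qed (use m in simp)
  have ind: "indep_vars (\<lambda>_. borel) (\<lambda>k \<omega>. u k \<omega> ^ a k) UNIV" for a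
    using rad unfolding rademacher_sequence_def
    by (intro indep_vars_compose2[where Y = "\<lambda>k x. x ^ a k" and X = u]) auto
  show "poly_moments M u"
  proof (intro poly_moments.intro poly_moments_axioms.intro prob_space_axioms)
    show "integrable M (\<lambda>\<omega>. monomial a (\<lambda>k. u k \<omega>))" for a
      unfolding monomial_def by (intro indep_vars_integrable ind int) auto
  qed
  have s: "{\<omega>\<in>space M. u i \<omega> = c} \<in> events" for i c using m[of i] by measurable
  have E1: "(LINT \<omega>|M. u i \<omega>) = 0" for i
  proof -
    have "(LINT \<omega>|M. u i \<omega>) = (LINT \<omega>|M. indicator {\<omega>\<in>space M. u i \<omega> = 1} \<omega> - indicator {\<omega>\<in>space M. u i \<omega> = -1} \<omega>)"
    proof (rule integral_cong_AE)
      show "AE \<omega> in M. u i \<omega> = indicator {\<omega>\<in>space M. u i \<omega> = 1} \<omega> - indicator {\<omega>\<in>space M. u i \<omega> = -1} \<omega>"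
        using rademacher_AE[OF rad, of i] AE_space by eventually_elim auto
    qed (use m s in auto)
    also have "\<dots> = prob {\<omega>\<in>space M. u i \<omega> = 1} - prob {\<omega>\<in>space M. u i \<omega> = -1}"
      by (subst Bochner_Integration.integral_diff)
         (auto simp: s less_top[symmetric] intro!: integrable_real_indicator)
    also have "\<dots> = 0"
    proof -
      have "prob {\<omega>\<in>space M. u i \<omega> = 1} = 1 / 2" "prob {\<omega>\<in>space M. u i \<omega> = -1} = 1 / 2"
        using rad by (simp_all only: rademacher_sequence_def)
      thus ?thesis by simp
    qed
    finally show ?thesis .
  qed
  show "(LINT \<omega>|M. u i \<omega> * u k \<omega>) = (if i = k then 1 else 0)" for i k
  proof (cases "i = k")
    case True
    have "(LINT \<omega>|M. u i \<omega> * u k \<omega>) = (LINT \<omega>|M. 1)"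
    proof (rule integral_cong_AE)
      show "AE \<omega> in M. u i \<omega> * u k \<omega> = 1"
        using rademacher_AE[OF rad, of k] by eventually_elim (auto simp: True)
    qed (use m in auto)
    thus ?thesis using True by (simp add: prob_space)
  next
    case False
    have "indep_vars (\<lambda>_. borel) u {i, k}"
      using rad unfolding rademacher_sequence_def by (auto intro: indep_vars_subset)
    moreover have "integrable M (u l)" for l using int[of l 1] by simp
    ultimately have "(LINT \<omega>|M. (\<Prod>l\<in>{i, k}. u l \<omega>)) = (\<Prod>l\<in>{i, k}. LINT \<omega>|M. u l \<omega>)"
      by (intro indep_vars_lebesgue_integral) simp_all
    thus ?thesis using False by (simp add: E1)
  qed
qed

text \<open>Up to a null set the event is covered by the atoms of the admissible sign vectors, each
  of probability 2^(-n) by independence.\<close>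

lemma (in prob_space) rademacher_prob_le:
  fixes u :: "'n::finite \<Rightarrow> 'a \<Rightarrow> real"
  assumes rad: "rademacher_sequence u"
  shows "prob {\<omega> \<in> space M. P (\<lambda>k. u k \<omega>)} \<le> card {s \<in> signs. P s} / 2 ^ CARD('n)"
proof -
  have m: "u i \<in> borel_measurable M" for i
    using rad unfolding rademacher_sequence_def indep_vars_def by auto
  let ?E = "\<lambda>s. \<Inter>k\<in>UNIV. u k -` {s k} \<inter> space M"
  let ?U = "\<Union>s\<in>{s \<in> signs. P s}. ?E s"
  have Eev: "?E s \<in> events" for s
    using measurable_sets[OF m, of "{s _}"] by (intro sets.finite_INT) auto
  have fin: "finite {s \<in> (signs :: ('n \<Rightarrow> real) set). P s}" by (rule finite_subset[OF _ finite_signs]) auto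
  have AEs: "AE \<omega> in M. \<forall>k\<in>UNIV. u k \<omega> \<in> {1, -1}"
    by (rule AE_finite_allI) (use rademacher_AE[OF rad] in auto)
  have "AE \<omega> in M. \<omega> \<in> {\<omega> \<in> space M. P (\<lambda>k. u k \<omega>)} \<longrightarrow> \<omega> \<in> ?U"
    using AEs AE_space by eventually_elim (auto simp: signs_def)
  hence "prob {\<omega> \<in> space M. P (\<lambda>k. u k \<omega>)} \<le> prob ?U"
    by (rule finite_measure_mono_AE) (rule sets.finite_UN[OF fin Eev])
  also have "\<dots> \<le> (\<Sum>s\<in>{s \<in> signs. P s}. prob (?E s))"
    by (rule finite_measure_subadditive_finite[OF fin]) (use Eev in auto)
  also have "\<dots> = (\<Sum>s\<in>{s \<in> (signs :: ('n \<Rightarrow> real) set). P s}. (1 / 2) ^ CARD('n))"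
  proof (rule sum.cong[OF refl])
    fix s :: "'n \<Rightarrow> real" assume s: "s \<in> {s \<in> signs. P s}"
    have "prob (?E s) = (\<Prod>k\<in>UNIV. prob (u k -` {s k} \<inter> space M))"
      using rad unfolding rademacher_sequence_def by (intro indep_varsD_finite) auto
    also have "\<dots> = (\<Prod>k\<in>(UNIV :: 'n set). 1 / 2)"
    proof (rule prod.cong[OF refl])
      fix k
      have p: "prob {\<omega>\<in>space M. u k \<omega> = 1} = 1 / 2" "prob {\<omega>\<in>space M. u k \<omega> = -1} = 1 / 2"
        using rad by (simp_all only: rademacher_sequence_def)
      have "u k -` {c} \<inter> space M = {\<omega>\<in>space M. u k \<omega> = c}" for c by auto
      moreover have "s k = 1 \<or> s k = -1" using s by (auto simp: signs_def)
      ultimately show "prob (u k -` {s k} \<inter> space M) = 1 / 2" using p by auto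
    qed
    finally show "prob (?E s) = (1 / 2) ^ CARD('n)" by simp
  qed
  also have "\<dots> = card {s \<in> (signs :: ('n \<Rightarrow> real) set). P s} / 2 ^ CARD('n)"
    by (simp add: power_one_over)
  finally show ?thesis .
qed

section \<open>Tail bounds\<close>

text \<open>Turns the base 8 of the Gaussian moments into 20 for Rademacher sequences. If the bound
  failed, the cosine would be positive at sqrt (5/2), but its Taylor polynomial with eighth-order
  remainder is negative there.\<close>

lemma half_pi_power2_le: "(pi / 2)\<^sup>2 \<le> 5 / 2"
proof (rule ccontr)
  assume *: "\<not> (pi / 2)\<^sup>2 \<le> 5 / 2"
  define x where "x = sqrt (5 / 2)"
  have x2: "x\<^sup>2 = 5 / 2" "0 < x" by (simp_all add: x_def)
  have "x < pi / 2" using * x2 by (intro power_less_imp_less_base[of x 2 "pi / 2"]) auto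
  hence "cos x > 0" using x2 by (intro cos_gt_zero_pi) auto
  moreover have "cos x < 0"
  proof -
    obtain t where t: "cos x = (\<Sum>m<8. cos_coeff m * x ^ m) + (cos(t + 1/2 * real 8 * pi) / fact 8) * x ^ 8"
      using Maclaurin_cos_expansion[of x 8] by auto
    have "x ^ 4 = (x\<^sup>2)\<^sup>2" "x ^ 6 = (x\<^sup>2) ^ 3" "x ^ 8 = (x\<^sup>2) ^ 4" by (simp_all flip: power_mult)
    hence p: "x ^ 4 = 25 / 4" "x ^ 6 = 125 / 8" "x ^ 8 = 625 / 16" by (simp_all add: x2 power_divide)
    have "{..<8::nat} = {0, 1, 2, 3, 4, 5, 6, 7}" by auto
    hence "(\<Sum>m<8. cos_coeff m * x ^ m) = 1 - x\<^sup>2 / 2 + x ^ 4 / 24 - x ^ 6 / 720"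
      by (simp add: cos_coeff_def fact_numeral)
    also have "\<dots> = - (13 / 1152)" by (simp add: x2 p)
    finally have S: "(\<Sum>m<8. cos_coeff m * x ^ m) = - (13 / 1152)" .
    have "(cos(t + 1/2 * real 8 * pi) / fact 8) * x ^ 8 \<le> (1 / fact 8) * x ^ 8"
      by (intro mult_right_mono divide_right_mono) auto
    also have "\<dots> = 625 / 645120" by (simp add: p fact_numeral)
    finally show ?thesis using t S by simp
  qed
  ultimately show False by simp
qed

text \<open>The value 7.2 is close enough for \<open>rademacher_exponent\<close>: 5/4 * 9/4 / 7.2 is
  just below 32/81.\<close>

lemma exp_two_ge: "7.2 \<le> exp (2::real)"
proof -
  have "1 + 1 / 4 + (1 / 4)\<^sup>2 / 2 \<le> exp (1 / 4 :: real)" by (rule exp_lower_Taylor_quadratic) simp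
  hence "(41 / 32) ^ 8 \<le> exp (1 / 4 :: real) ^ 8" by (intro power_mono) (simp_all add: power2_eq_square)
  also have "\<dots> = exp 2" by (simp add: exp_of_nat_mult[symmetric])
  finally show ?thesis by (simp add: eval_nat_numeral)
qed

text \<open>The logarithmic derivative 1 - k / y is nonpositive up to k; the proof uses ln (y / z)
  \<ge> 1 - z / y in place of calculus.\<close>

lemma exp_div_power_decreasing:
  fixes y z :: real
  assumes "0 < z" "z \<le> y" "y \<le> real k"
  shows "exp y / y ^ k \<le> exp z / z ^ k"
proof -
  have "ln (z / y) \<le> z / y - 1" using assms by (intro ln_le_minus_one) auto
  hence "ln (y / z) \<ge> (y - z) / y" using assms by (simp add: ln_div field_simps)
  hence "k * ln (y / z) \<ge> k * ((y - z) / y)" by (intro mult_left_mono) auto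
  moreover have "k * ((y - z) / y) \<ge> y * ((y - z) / y)" using assms by (intro mult_right_mono) auto
  ultimately have "y - z \<le> k * ln (y / z)" using assms by simp
  hence "exp (y - z) \<le> exp (k * ln (y / z))" by simp
  also have "\<dots> = (y / z) ^ k" using assms by (simp add: exp_of_nat_mult)
  finally show ?thesis using assms by (simp add: exp_diff power_divide field_simps)
qed

text \<open>The base equals (2 q / y)^2 exp (-2), so the largest integer q \<le> y / 2 leaves exp
  (-2 q). Rounding costs at most exp 2, which \<open>C\<^sub>2\<close> absorbs, and y \<ge> 2 makes
  \<open>q\<close> positive.\<close>

lemma gaussian_exponent:
  fixes y :: real
  assumes "y \<ge> 2"
  obtains q :: nat where "q > 0" "(8 * (q / (exp 1 * sqrt 2 * y))\<^sup>2) ^ q \<le> exp 2 * exp (- y)"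
proof -
  define q where "q = nat \<lfloor>y / 2\<rfloor>"
  have q: "q > 0" "real q \<le> y / 2" "y / 2 - 1 \<le> real q" using assms by (simp_all add: q_def) linarith+
  have e: "exp (2::real) = exp 1 * exp 1" by (simp add: exp_add[symmetric])
  have "8 * (q / (exp 1 * sqrt 2 * y))\<^sup>2 = (2 * q / y)\<^sup>2 * exp (- 2)"
    using assms by (simp add: power_mult_distrib power_divide exp_minus e field_simps power2_eq_square)
  also have "\<dots> \<le> 1 * exp (- 2)"
    using q assms by (intro mult_right_mono) (auto simp: abs_square_le_1)
  finally have "(8 * (q / (exp 1 * sqrt 2 * y))\<^sup>2) ^ q \<le> exp (- 2) ^ q" by (intro power_mono) auto
  also have "\<dots> = exp (- 2 * q)" by (simp add: exp_of_nat_mult[symmetric] mult.commute)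
  also have "\<dots> \<le> exp 2 * exp (- y)" using q by (simp add: exp_add[symmetric])
  finally show ?thesis using that q by blast
qed

text \<open>Here \<open>C\<^sub>2 = 1\<close> leaves no room for a rounding loss. The target 32/81
  is 2 / (9/4)^2: one factor 9/4 is the prefactor of the moment bound, the other comes from p \<le>
  9/4 n. The gain comes from \<open>C\<^sub>1 = 4\<close> and from rounding y / 2 up.\<close>

lemma rademacher_exponent:
  fixes y :: real
  assumes "4 \<le> exp y"
  obtains q :: nat where "q > 0" "(20 * (q / (exp 1 * 4 * y))\<^sup>2) ^ q \<le> 32 / 81 * exp (- y)"
proof -
  have y: "ln 4 \<le> y" using assms by (metis exp_gt_zero ln_exp ln_le_cancel_iff zero_less_numeral)
  have l4: "4 / 3 \<le> ln (4::real)" using ln2_ge_two_thirds ln_realpow[of 2 2] by simp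
  have y0: "y > 0" using y l4 by simp
  have e: "exp (2::real) = exp 1 * exp 1" by (simp add: exp_add[symmetric])
  have eq: "20 * (q / (exp 1 * 4 * y))\<^sup>2 = 5 / 4 * (real q)\<^sup>2 / exp 2 / y\<^sup>2" for q :: nat
    using y0 by (simp add: power_mult_distrib power_divide e field_simps power2_eq_square)
  have "\<exists>q::nat. q > 0 \<and> (5 / 4 * (real q)\<^sup>2 / exp 2) ^ q * (exp y / y ^ (2 * q)) \<le> 32 / 81"
  proof (cases "y \<le> 2")
    case True
    \<comment> \<open>For q = 1 the function decreases up to 2, so the worst case is the smallest
      admissible value ln 4, which is at least 4/3.\<close>
    have "exp y / y ^ 2 \<le> exp (ln 4) / (ln 4) ^ 2"
      using True y l4 by (intro exp_div_power_decreasing) auto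
    also have "\<dots> \<le> 4 / (4 / 3) ^ 2"
      using l4 by (simp, intro divide_left_mono power_mono[of "4/3" "ln 4" 2, simplified]) auto
    finally have "exp y / y\<^sup>2 \<le> 9 / 4" by (simp add: power2_eq_square)
    hence "(5 / 4 / exp 2) * (exp y / y ^ 2) \<le> (5 / 4 / 7.2) * (9 / 4)"
      using exp_two_ge by (intro mult_mono divide_left_mono) auto
    thus ?thesis by (intro exI[of _ 1]) simp
  next
    case False
    define q where "q = nat \<lceil>y / 2\<rceil>"
    have q: "q \<ge> 2" "y \<le> 2 * real q" "2 * real q - 2 \<le> y" using False by (simp_all add: q_def) linarith+
    have qr: "real q \<ge> 2" using q(1) by simp
    \<comment> \<open>The left end of the range of \<open>y\<close> that rounds up to this
      \<open>q\<close>; the decreasing function is largest there.\<close>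
    define z where "z = 2 * real q - 2"
    have z: "z > 0" "z \<le> y" "z \<noteq> 0" using q qr by (auto simp: z_def)
    have "(5 / 4 * (real q)\<^sup>2 / exp 2) ^ q * (exp y / y ^ (2 * q))
        \<le> (5 / 4 * (real q)\<^sup>2 / exp 2) ^ q * (exp z / z ^ (2 * q))"
      using z q by (intro mult_left_mono exp_div_power_decreasing) auto
    also have "exp z = exp 2 ^ q / exp 2"
    proof -
      have "exp 2 ^ q = exp (2 * real q)" by (simp add: exp_of_nat_mult[symmetric] mult.commute)
      thus ?thesis by (simp add: z_def exp_diff)
    qed
    also have "(5 / 4 * (real q)\<^sup>2 / exp 2) ^ q * (exp 2 ^ q / exp 2 / z ^ (2 * q)) = (5 / 4 * (real q / z)\<^sup>2) ^ q / exp 2"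
      using z by (simp add: power_mult_distrib power_divide power_mult[symmetric] mult.commute)
    also have "\<dots> \<le> (25 / 16) / 7.2"
    proof (rule frac_le)
      show "(5 / 4 * (real q / z)\<^sup>2) ^ q \<le> 25 / 16"
      \<comment> \<open>For q = 2 the ratio q / z is 1 and the power is (5/4)^2. From q = 3 on, q /
        z \<le> 3/4 brings the base below 1.\<close>
      proof (cases "q = 2")
        case True thus ?thesis by (simp add: z_def power2_eq_square)
      next
        case False
        hence "real q \<ge> 3" using q(1) by simp
        hence "real q / z \<le> 3 / 4" using z by (simp add: field_simps) (simp add: z_def)
        hence "(real q / z)\<^sup>2 \<le> (3 / 4)\<^sup>2" using z by (intro power_mono) auto
        hence "(5 / 4 * (real q / z)\<^sup>2) ^ q \<le> 1" by (intro power_le_one) (auto simp: power2_eq_square)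
        thus ?thesis by simp
      qed
    qed (use exp_two_ge in auto)
    finally have "(5 / 4 * (real q)\<^sup>2 / exp 2) ^ q * (exp y / y ^ (2 * q)) \<le> 32 / 81" by simp
    thus ?thesis using q(1) by (intro exI[of _ q]) auto
  qed
  then obtain q :: nat where q: "q > 0" "(5 / 4 * (real q)\<^sup>2 / exp 2) ^ q * (exp y / y ^ (2 * q)) \<le> 32 / 81" by blast
  have "(20 * (q / (exp 1 * 4 * y))\<^sup>2) ^ q = (5 / 4 * (real q)\<^sup>2 / exp 2) ^ q * (exp y / y ^ (2 * q)) * exp (- y)"
  proof -
    have "(a / y\<^sup>2) ^ q = a ^ q * (exp y / y ^ (2 * q)) * exp (- y)" for a
      using y0 by (simp add: power_divide power_mult exp_minus)
    thus ?thesis unfolding eq by blast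
  qed
  also have "\<dots> \<le> 32 / 81 * exp (- y)" by (intro mult_right_mono q) simp
  finally show ?thesis using that q(1) by blast
qed

section \<open>Markov's inequality for both kinds of sequences\<close>

lemma (in gaussian_moments) chaos_tail:
  fixes R :: "'n \<Rightarrow> complex^'p::finite^'m::finite"
  assumes D: "(LINT \<omega>|M. (norm (mpow (chaos R (uvec \<omega>)) q))\<^sup>2) \<le> D" and q: "q > 0" and s: "s > 0"
  shows "prob {\<omega> \<in> space M. s \<le> spectral_norm (chaos R (uvec \<omega>))} \<le> D / s ^ (2 * q)"
proof -
  let ?F = "\<lambda>\<omega>. (norm (mpow (chaos R (uvec \<omega>)) q))\<^sup>2"
  have int: "integrable M ?F"
    by (rule integrable_polymap) (intro polymap_norm_power2 polymap_mpow polymap_chaos)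
  have "prob {\<omega> \<in> space M. s \<le> spectral_norm (chaos R (uvec \<omega>))} \<le> prob {\<omega> \<in> space M. s ^ (2 * q) \<le> ?F \<omega>}"
  proof (rule finite_measure_mono)
    show "{\<omega> \<in> space M. s \<le> spectral_norm (chaos R (uvec \<omega>))} \<subseteq> {\<omega> \<in> space M. s ^ (2 * q) \<le> ?F \<omega>}"
    proof safe
      fix \<omega> assume "s \<le> spectral_norm (chaos R (uvec \<omega>))"
      hence "s ^ (2 * q) \<le> spectral_norm (chaos R (uvec \<omega>)) ^ (2 * q)" using s by (intro power_mono) auto
      also have "\<dots> \<le> ?F \<omega>" by (rule spectral_norm_power_le_mpow[OF ctranspose_chaos q])
      finally show "s ^ (2 * q) \<le> ?F \<omega>" .
    qed
    show "{\<omega> \<in> space M. s ^ (2 * q) \<le> ?F \<omega>} \<in> events"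
      using borel_measurable_integrable[OF int] by measurable
  qed
  also have "\<dots> \<le> (LINT \<omega>|M. ?F \<omega>) / s ^ (2 * q)"
    by (rule integral_Markov_inequality_measure[OF int sets.top]) (use s in auto)
  also have "\<dots> \<le> D / s ^ (2 * q)" using s D by (intro divide_right_mono) auto
  finally show ?thesis .
qed

text \<open>Markov's inequality in counting form, over the finite set of sign vectors.\<close>

lemma (in prob_space) rademacher_chaos_tail:
  fixes R :: "'n::finite \<Rightarrow> complex^'p::finite^'m::finite" and u :: "'n \<Rightarrow> 'a \<Rightarrow> real"
  assumes rad: "rademacher_sequence u" and q: "q > 0" and s: "s > 0"
    and D: "\<And>u :: 'n \<Rightarrow> ('n \<Rightarrow> real) \<Rightarrow> real. gaussian_moments gauss_space u \<Longrightarrow>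
      (LINT \<omega>|gauss_space. (norm (mpow (chaos R (\<lambda>k. u k \<omega>)) q))\<^sup>2) \<le> D"
  shows "prob {\<omega> \<in> space M. s \<le> spectral_norm (chaos R (\<lambda>k. u k \<omega>))} \<le> (pi / 2) ^ (2 * q) * D / s ^ (2 * q)"
proof -
  let ?S = "{x \<in> signs. s \<le> spectral_norm (chaos R x)}"
  have "real (card ?S) * s ^ (2 * q) = (\<Sum>x\<in>?S. s ^ (2 * q))" by simp
  also have "\<dots> \<le> (\<Sum>x\<in>?S. spectral_norm (chaos R x) ^ (2 * q))"
    using s by (intro sum_mono power_mono) auto
  also have "\<dots> \<le> (\<Sum>x\<in>signs. spectral_norm (chaos R x) ^ (2 * q))"
    using finite_signs by (intro sum_mono2) (auto simp: spectral_norm_nonneg)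
  finally have "(2 / pi) ^ (2 * q) * (real (card ?S) * s ^ (2 * q))
      \<le> (2 / pi) ^ (2 * q) * (\<Sum>x\<in>signs. spectral_norm (chaos R x) ^ (2 * q))"
    by (intro mult_left_mono) auto
  also have "\<dots> \<le> 2 ^ CARD('n) * D" by (rule rademacher_sum_le[OF q D])
  finally have "(pi / 2) ^ (2 * q) * ((2 / pi) ^ (2 * q) * (real (card ?S) * s ^ (2 * q)))
      \<le> (pi / 2) ^ (2 * q) * (2 ^ CARD('n) * D)" by (intro mult_left_mono) auto
  moreover have "(pi / 2) ^ (2 * q) * ((2 / pi) ^ (2 * q) * x) = x" for x :: real
    unfolding mult.assoc[symmetric] power_mult_distrib[symmetric] by simp
  ultimately have "real (card ?S) * s ^ (2 * q) \<le> (pi / 2) ^ (2 * q) * (2 ^ CARD('n) * D)" by simp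
  hence "real (card ?S) / 2 ^ CARD('n) \<le> (pi / 2) ^ (2 * q) * D / s ^ (2 * q)"
    using s by (simp add: field_simps)
  thus ?thesis using rademacher_prob_le[OF rad, of "\<lambda>x. s \<le> spectral_norm (chaos R x)"] by simp
qed

section \<open>From the hypothesis on n to the tail bound\<close>

theorem theorem1p3:
  fixes B :: "'p::finite \<Rightarrow> complex^'n::finite^'m::finite"
    and \<Omega> :: "'w measure"
    and u :: "'n \<Rightarrow> 'w \<Rightarrow> real"
    and L :: "'w \<Rightarrow> complex^'p^'m"
    and M :: "'w \<Rightarrow> complex^'p^'p"
    and N :: "complex^'p^'p"
    and \<kappa> :: ereal
    and lam C C\<^sub>1 C\<^sub>2 t :: real
  assumes "prob_space \<Omega>"
    and "(prob_space.gaussian_sequence \<Omega> u \<and> C\<^sub>1 = sqrt 2 \<and> C\<^sub>2 = 2 ^ 14) \<or>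
         (prob_space.rademacher_sequence \<Omega> u \<and> C\<^sub>1 = 4 \<and> C\<^sub>2 = 1)"
    and "\<And>j. B j \<noteq> 0"
    and "\<And>\<omega>. L \<omega> = column_matrix B (\<lambda>k. u k \<omega>)"
    and "\<And>\<omega>. M \<omega> = ctranspose (L \<omega>) ** L \<omega>"
    and "N = integral\<^sup>L \<Omega> M"
    and "\<kappa> = kappa B"
    and "lam = weak_condition_number_family B"
    and "C \<ge> 1"
    and "ereal (real CARD('n)) \<ge>
         ereal (real CARD('p)) * (ereal C * \<kappa> * ereal lam * ereal (ln (real CARD('n))))\<^sup>2"
    and "t > 0"
  shows "measure \<Omega> {\<omega> \<in> space \<Omega>.
           ereal (spectral_norm (M \<omega> - N)) \<ge> ereal (t * spectral_norm N) / \<kappa>}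
         \<le> 2 * C\<^sub>2 * real CARD('p) * real CARD('n) powr (1 - t * C / (exp 1 * C\<^sub>1))"
proof -
  interpret prob_space \<Omega> by fact
  let ?E = "{\<omega> \<in> space \<Omega>. ereal (spectral_norm (M \<omega> - N)) \<ge> ereal (t * spectral_norm N) / \<kappa>}"
  define n p where "n = real CARD('n)" and "p = real CARD('p)"
  define R where "R = coord_matrix B"
  define y where "y = t * C * ln n / (exp 1 * C\<^sub>1)"
  have np: "n \<ge> 1" "p \<ge> 1" by (simp_all add: n_def p_def Suc_leI)
  have C1: "C\<^sub>1 > 0" and C2: "C\<^sub>2 \<ge> 1" using assms(2) by auto
  have rhs: "2 * C\<^sub>2 * real CARD('p) * real CARD('n) powr (1 - t * C / (exp 1 * C\<^sub>1)) = 2 * C\<^sub>2 * p * n * exp (- y)"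
    using np by (simp add: n_def[symmetric] p_def[symmetric] y_def powr_def exp_diff exp_minus algebra_simps divide_inverse)
  have trivial: ?thesis if "1 \<le> 2 * C\<^sub>2 * p * n * exp (- y)"
    unfolding rhs using that prob_le_1[of ?E] by linarith
  show ?thesis
  proof (cases "CARD('n) = 1")
    \<comment> \<open>Here ln n = 0, so the size hypothesis carries no information, but y = 0 and
      the claimed bound is at least 1.\<close>
    case True
    hence n1: "n = 1" by (simp add: n_def)
    have "1 * 1 \<le> C\<^sub>2 * p" using C2 np by (intro mult_mono) auto
    thus ?thesis using n1 by (intro trivial) (simp add: y_def)
  next
    case False
    have "CARD('n) \<noteq> 0" by simp
    hence n2: "n \<ge> 2" using False unfolding n_def by linarith
    hence lnn: "2 / 3 \<le> ln n" using ln2_ge_two_thirds ln_le_cancel_iff[of 2 n] by linarith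
    have lam: "1 \<le> lam"
      using one_le_weak_condition_number[OF assms(3)] Max_ge[of "weak_condition_number ` range B" "weak_condition_number (B undefined)"]
      unfolding assms(8) weak_condition_number_family_def by (force intro: order_trans)
    define \<nu> where "\<nu> = spectral_norm (gram_matrix B)"
    \<comment> \<open>A singular Gram matrix has infinite \<kappa>, and since C, p, \<lambda> and ln
      n are positive the size hypothesis would force an infinite n.\<close>
    have inv: "invertible (gram_matrix B)"
    proof (rule ccontr)
      assume "\<not> invertible (gram_matrix B)"
      hence "\<kappa> = \<infinity>" by (simp add: assms(7) kappa_def condition_number_def)
      moreover have "0 < ln n" "n \<noteq> 1" "0 < p" using lnn n2 np by auto
      ultimately show False using assms(9,10) lam unfolding n_def[symmetric] p_def[symmetric]
        by (simp add: power2_eq_square)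
    qed
    define k where "k = spectral_norm (gram_matrix B) * spectral_norm (matrix_inv (gram_matrix B))"
    have k: "\<kappa> = ereal k" using inv by (simp add: assms(7) kappa_def condition_number_def k_def)
    have k1: "1 \<le> k" unfolding k_def by (rule one_le_condition_number[OF inv])
    define l where "l = C * k * ln n"
    have "1 * 1 * ln n \<le> l" unfolding l_def using assms(9) k1 lnn by (intro mult_mono) auto
    hence l: "2 / 3 \<le> l" using lnn by simp
    have size: "p * (lam * l)\<^sup>2 \<le> n"
      using assms(10) unfolding k n_def[symmetric] p_def[symmetric] by (simp add: l_def power2_eq_square mult_ac)
    have "(1 * (2 / 3))\<^sup>2 \<le> (lam * l)\<^sup>2" using lam l by (intro power_mono mult_mono) auto
    hence "p * (4 / 9) \<le> p * (lam * l)\<^sup>2" using np by (intro mult_left_mono) (auto simp: power2_eq_square)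
    hence pn: "p \<le> 9 / 4 * n" using size by simp
    have \<nu>: "\<nu> > 0"
    proof -
      have "0 < (norm (B undefined))\<^sup>2" using assms(3) by simp
      also have "\<dots> \<le> \<nu>" unfolding \<nu>_def by (rule norm_le_spectral_gram_matrix)
      finally show ?thesis .
    qed
    \<comment> \<open>Summing n |B j|^2 \<le> \<lambda>^2 \<nu> over the p matrices and using p
      (\<lambda> l)^2 \<le> n gives the small row variance.\<close>
    have b: "(\<Sum>j\<in>UNIV. (spectral_norm (B j))\<^sup>2) \<le> \<nu> / l\<^sup>2"
    proof -
      have "n * (\<Sum>j\<in>UNIV. (spectral_norm (B j))\<^sup>2) \<le> (\<Sum>j\<in>(UNIV :: 'p set). lam\<^sup>2 * \<nu>)"
        unfolding sum_distrib_left n_def \<nu>_def assms(8)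
        by (intro sum_mono spectral_norm_le_weak_condition_number assms(3))
      also have "\<dots> = p * lam\<^sup>2 * \<nu>" by (simp add: p_def)
      finally have "l\<^sup>2 * (n * (\<Sum>j\<in>UNIV. (spectral_norm (B j))\<^sup>2)) \<le> l\<^sup>2 * (p * lam\<^sup>2 * \<nu>)"
        by (intro mult_left_mono) auto
      also have "\<dots> = (p * (lam * l)\<^sup>2) * \<nu>" by (simp add: power_mult_distrib)
      also have "\<dots> \<le> n * \<nu>" using \<nu> by (intro mult_right_mono size) auto
      finally have "n * (l\<^sup>2 * (\<Sum>j\<in>UNIV. (spectral_norm (B j))\<^sup>2)) \<le> n * \<nu>" by (simp add: mult_ac)
      thus ?thesis using n2 l by (simp add: pos_le_divide_eq mult.commute)
    qed
    define s where "s = t * \<nu> / k"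
    have s: "s > 0" using assms(11) \<nu> k1 by (simp add: s_def)
    define x where "x = exp 1 * C\<^sub>1 * y"
    have x: "x = t * C * ln n" using C1 by (simp add: x_def y_def)
    have x0: "x > 0" unfolding x using assms(9,11) lnn by (intro mult_pos_pos) auto
    have y0: "y > 0" using x0 C1 unfolding y_def x[symmetric] by simp
    \<comment> \<open>Moments have scale \<nu> / l, and in the same unit the threshold is x = t C ln
      n; after division only q / x remains.\<close>
    have sx: "s = x * \<nu> / l" using assms(9) lnn k1 unfolding s_def x l_def by simp
    have ratio: "(c * (8 * (q * \<nu> / l)\<^sup>2)) ^ q / s ^ (2 * q) = (c * 8 * (q / x)\<^sup>2) ^ q" for c and q :: nat
      unfolding sx power_mult power_divide[symmetric]
      using \<nu> l x0 by (simp add: power_divide power_mult_distrib)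
    have moment: "(LINT \<omega>|M'. (norm (mpow (chaos R (\<lambda>k. v k \<omega>)) q))\<^sup>2) \<le> 9 / 4 * p\<^sup>2 * (8 * (q * \<nu> / l)\<^sup>2) ^ q"
      if "gaussian_moments M' v" "q > 0" for M' :: "'x measure" and v :: "'n \<Rightarrow> 'x \<Rightarrow> real" and q
      unfolding R_def p_def
      by (rule gaussian_moments.family_chaos_moment[OF that(1) b \<nu>_def l that(2)])
    have Meq: "M \<omega> = ctranspose (series R (\<lambda>k. u k \<omega>)) ** series R (\<lambda>k. u k \<omega>)" for \<omega>
      by (simp add: assms(4,5) R_def column_matrix_eq_series)
    have event: "?E = {\<omega> \<in> space \<Omega>. s \<le> spectral_norm (chaos R (\<lambda>k. u k \<omega>))}"
      if "poly_moments \<Omega> u" "\<And>i k. (LINT \<omega>|\<Omega>. u i \<omega> * u k \<omega>) = (if i = k then 1 else 0)"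
    proof -
      have N: "N = gram_mean R"
        unfolding assms(6) Meq[abs_def] by (rule poly_moments.expectation_gram_orthonormal[OF that])
      have "spectral_norm N = \<nu>" by (simp add: N \<nu>_def R_def gram_matrix_eq_gram_mean)
      thus ?thesis using k1 by (simp add: Meq N chaos_def k s_def)
    qed
    have pp: "p\<^sup>2 \<le> 9 / 4 * (p * n)" using mult_left_mono[OF pn, of p] np by (simp add: power2_eq_square)
    from assms(2) show ?thesis
    proof
      assume *: "gaussian_sequence u \<and> C\<^sub>1 = sqrt 2 \<and> C\<^sub>2 = 2 ^ 14"
      have e2: "exp (2::real) \<le> 9"
        using power_mono[OF exp_le, of 2] by (simp add: exp_of_nat_mult[of 2 1, symmetric, simplified])
      have pn1: "1 \<le> p * n" using mult_mono[of 1 p 1 n] np by simp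
      show ?thesis
      proof (cases "y < 2")
        case True
        \<comment> \<open>For y < 2 no positive moment order of size y / 2 is available, but then
          exp (-y) \<ge> 1/9 and \<open>C\<^sub>2\<close> makes the claimed bound exceed 1.\<close>
        have "exp y \<le> 9" using True e2 exp_less_mono[of y 2] by linarith
        hence "1 / 9 \<le> exp (- y)" by (simp add: exp_minus field_simps)
        hence "1 * (1 / 9) \<le> (p * n) * exp (- y)" using pn1 by (intro mult_mono) auto
        thus ?thesis using * by (intro trivial) simp
      next
        case False
        then obtain q :: nat where q: "q > 0" "(8 * (q / (exp 1 * sqrt 2 * y))\<^sup>2) ^ q \<le> exp 2 * exp (- y)"
          using gaussian_exponent[of y] by auto
        interpret gaussian_moments \<Omega> u using * assms(1) by (intro gaussian_sequence_imp_moments) auto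
        have ev: "?E = {\<omega> \<in> space \<Omega>. s \<le> spectral_norm (chaos R (\<lambda>k. u k \<omega>))}"
          by (rule event[OF poly_moments_axioms expectation_mult])
        have "prob ?E \<le> 9 / 4 * p\<^sup>2 * (8 * (q * \<nu> / l)\<^sup>2) ^ q / s ^ (2 * q)"
          unfolding ev by (rule chaos_tail[OF moment[OF gaussian_moments_axioms q(1)] q(1) s])
        also have "\<dots> = 9 / 4 * p\<^sup>2 * ((8 * (q * \<nu> / l)\<^sup>2) ^ q / s ^ (2 * q))" by simp
        also have "\<dots> = 9 / 4 * p\<^sup>2 * (8 * (q / x)\<^sup>2) ^ q"
          unfolding ratio[of 1 q, unfolded mult_1_left] ..
        also have "\<dots> \<le> 9 / 4 * (9 / 4 * (p * n)) * (exp 2 * exp (- y))"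
          using q(2) pp * np by (intro mult_mono) (auto simp: x_def)
        also have "\<dots> = (81 / 16 * exp 2) * (p * n * exp (- y))" by simp
        also have "\<dots> \<le> (2 * C\<^sub>2) * (p * n * exp (- y))"
          using e2 * np by (intro mult_right_mono) auto
        finally show ?thesis unfolding rhs by (simp add: mult_ac)
      qed
    next
      assume *: "rademacher_sequence u \<and> C\<^sub>1 = 4 \<and> C\<^sub>2 = 1"
      show ?thesis
      proof (cases "1 \<le> 2 * C\<^sub>2 * p * n * exp (- y)")
        case False
        \<comment> \<open>A nontrivial bound forces 2 p n \<le> exp y, and p n \<ge> 2, so y is at
          least ln 4 as the choice of \<open>q\<close> requires.\<close>
        hence "2 * p * n \<le> exp y" using * by (simp add: exp_minus field_simps)
        moreover have "1 * 2 \<le> p * n" using n2 np by (intro mult_mono) auto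
        ultimately have "4 \<le> exp y" by linarith
        then obtain q :: nat where q: "q > 0" "(20 * (q / (exp 1 * 4 * y))\<^sup>2) ^ q \<le> 32 / 81 * exp (- y)"
          by (rule rademacher_exponent)
        have rad: "rademacher_sequence u" using * by simp
        have ev: "?E = {\<omega> \<in> space \<Omega>. s \<le> spectral_norm (chaos R (\<lambda>k. u k \<omega>))}"
          by (rule event[OF rademacher_imp_poly_moments[OF rad]])
        have "prob ?E \<le> (pi / 2) ^ (2 * q) * (9 / 4 * p\<^sup>2 * (8 * (q * \<nu> / l)\<^sup>2) ^ q) / s ^ (2 * q)"
          unfolding ev by (rule rademacher_chaos_tail[OF rad q(1) s moment]) (use q(1) in simp_all)
        also have "\<dots> = 9 / 4 * p\<^sup>2 * (((pi / 2)\<^sup>2 * (8 * (q * \<nu> / l)\<^sup>2)) ^ q / s ^ (2 * q))"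
          by (simp add: power_mult_distrib power_mult)
        also have "\<dots> = 9 / 4 * p\<^sup>2 * ((pi / 2)\<^sup>2 * 8 * (q / x)\<^sup>2) ^ q" unfolding ratio ..
        also have "\<dots> \<le> 9 / 4 * p\<^sup>2 * (20 * (q / x)\<^sup>2) ^ q"
          using half_pi_power2_le by (intro mult_left_mono power_mono mult_right_mono) auto
        also have "\<dots> \<le> 9 / 4 * (9 / 4 * (p * n)) * (32 / 81 * exp (- y))"
          using q(2) pp * np by (intro mult_mono) (auto simp: x_def)
        \<comment> \<open>The constants multiply to 9/4 * 9/4 * 32/81 = 2, with nothing to
          spare.\<close>
        also have "\<dots> = 2 * C\<^sub>2 * p * n * exp (- y)" using * by simp
        finally show ?thesis unfolding rhs .
      qed (rule trivial)
    qed
  qed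
qed

end
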